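(* Let $F$ be a field of characteristic zero, $G$ a finite abelian group, and $g\in G$ with $|g|>2$. Below, $h$ ranges over $\{1,g,g^2\}$, $r$ ranges over $G\setminus\{1,g,g^2\}$, and $x_{i,s}$ (without sign) stands for each of $x_{i,s}^+$ and $x_{i,s}^-$. Then: 1) $\mathrm{Id}^{\sharp}(C_3^{\mathsf g})=\langle x_{1,h}^-,\ x_{1,g}^+x_{2,g}^+x_{3,g}^+,\ x_{1,g}^+x_{2,g^2}^+,\ x_{1,g^2}^+x_{2,g^2}^+,\ x_{1,r}\rangle_{T_G^*}$. 2) $\mathrm{Id}^{\sharp}(C_{3,*}^{\mathsf g})=\langle x_{1,1}^-,\ x_{1,g^2}^-,\ x_{1,g}^+,\ [x_{1,h},x_{2,r}],\ x_{1,g^2}^+x_{2,g^2}^+,\ x_{1,g}^-x_{2,g^2}^+,\ x_{1,r}\rangle_{T_G^*}$. Moreover, for every $n\ge2$: 3) $\mathcal{X}_n(C_3^{\mathsf g})=(\chi_{((n)_{1^+})};\ \chi_{((n-1)_{1^+},(1)_{g^+})};\ \chi_{((n-2)_{1^+},(2)_{g^+})};\ \chi_{((n-1)_{1^+},(1)_{(g^2)^+})})$. 4) $\mathcal{X}_n(C_{3,*}^{\mathsf g})=(\chi_{((n)_{1^+})};\ \chi_{((n-1)_{1^+},(1)_{g^-})};\ \chi_{((n-2)_{1^+},(2)_{g^-})};\ \chi_{((n-1)_{1^+},(1)_{(g^2)^+})})$. 5) $c_n^{\sharp}(C_3^{\mathsf g})=c_n^{\sharp}(C_{3,*}^{\mathsf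 g})=1+2n+\binom{n}{2}$ and $l_n^{\sharp}(C_3^{\mathsf g})=l_n^{\sharp}(C_{3,*}^{\mathsf g})=4$.
   Context: **General setting.** $G$ is a finite abelian group of order $t$ with unit $1$. A $(G,* )$-algebra is an associative $F$-algebra $A=\bigoplus_{g\in G}A_g$ with $A_gA_h\subseteq A_{gh}$ and an involution $*$ with $A_g^*=A_g$ for all $g$; $A_g^{\pm}=\{a\in A_g:a^*=\pm a\}$. The free $(G,* )$-algebra $\mathcal F$ is the free associative algebra on variables $x_{i,g}^+$ and $x_{i,g}^-$ ($i\ge1$, $g\in G$), of degree $g$, with involution determined by $(x_{i,g}^{\pm})^*=\pm x_{i,g}^{\pm}$. A polynomial is a $(G,* )$-identity of $A$ if it vanishes whenever each $x_{i,g}^{\varepsilon}$ is replaced by an element of $A_g^{\varepsilon}$; $\mathrm{Id}^{\sharp}(A)$ is the set of these identities. A $T_G^*$-ideal is an ideal of $\mathcal F$ invariant under all endomorphisms of $\mathcal F$ that preserve the grading and commute with $*$ (and, as all ideals $\mathrm{Id}^{\sharp}(A)$ are, invariant under $*$); $\langle S\rangle_{T_G^*}$ is the $T_G^*$-ideal generated by $S$. $[a,b]=ab-ba$. **Codimension, cocharacter, colength.** $P_n^{\sharp}=\mathrm{span}_F\{w_{\sigma(1)}\cdots w_{\sigma(n)}:\sigma\in S_n,\ w_i\in\{x_{i,g}^+,x_{i,g}^-\},\ g\in G\}$, $c_n^{\sharp}(A)=\dim_FP_n^{\sharp}/(P_n^{\sharp}\cap\mathrm{Id}^{\sharp}(A))$.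 With $G=\{g_1=1,\dots,g_t\}$ and $\langle n\rangle=(n_1,\dots,n_{2t})$, $\sum n_i=n$, $P_{\langle n\rangle}$ is the space of multilinear polynomials in $n_{2i-1}$ symmetric and $n_{2i}$ skew variables of degree $g_i$; $\chi_{\langle n\rangle}(A)$ is the character of the $S_{n_1}\times\cdots\times S_{n_{2t}}$-module $P_{\langle n\rangle}/(P_{\langle n\rangle}\cap\mathrm{Id}^{\sharp}(A))$ (each factor permutes the variables of one type). $l_n^{\sharp}(A)$ is the sum over all $\langle n\rangle$ with $\sum n_i=n$ of the number of irreducible constituents, with multiplicity, of $\chi_{\langle n\rangle}(A)$. The notation $\chi_{((\lambda)_{s^{\varepsilon}},(\mu)_{u^{\delta}},\dots)}$ denotes the irreducible character given by the outer tensor product in which $\lambda$ is the partition for the variables of degree $s$ and sign $\varepsilon$, $\mu$ the one for degree $u$ and sign $\delta$, etc., omitted partitions being empty. The equality $\mathcal{X}_n(A)=(\chi;\chi';\dots)$ means that the nonzero characters $\chi_{\langle n\rangle}(A)$, over all $\langle n\rangle$ with $\sum n_i=n$, are exactly the listed ones. **Algebras.** $C_3=\{\alpha I_3+\alpha_1E_1+\alpha_2E_1^2:\alpha,\alpha_1,\alpha_2\in F\}\subset UT_3(F)$, $E_1=e_{12}+e_{23}$. $C_3^{\mathsf g}$ is $C_3$ with $I_3,E_1,E_1^2$ of degrees $1,g,g^2$ and trivial (identity) involution; $C_{3,*}^{\mathsf g}$ has the same grading and the involution $\alpha I_3+\alpha_1E_1+\alpha_2E_1^2\mapsto\alpha I_3-\alpha_1E_1+\alpha_2E_1^2$.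 Their support is $\{1,g,g^2\}$. *)

theory Defs
  imports
    "HOL-Library.Poly_Mapping"
    "HOL-Algebra.Ideal"
    "HOL-Algebra.Product_Groups"
    "HOL-Algebra.Sym_Groups"
    "HOL-Algebra.Multiplicative_Group"
    "Jordan_Normal_Form.Matrix"
begin

section \<open>\<open>(G,*)\<close>-algebras\<close>

text \<open>The base field is a type of class \<open>field\<close>; the group and the algebras are
  records with explicit carriers. Algebras are unital, as evaluating a constant term needs a unit.\<close>

definition scalars :: "'f::field ring" where
  "scalars = \<lparr>carrier = UNIV, monoid.mult = (*), one = 1, zero = 0, add = (+)\<rparr>"

record ('f, 'a, 'g) gs_algebra = "('f, 'a) module" +
  homog :: "'g \<Rightarrow> 'a set"
  star :: "'a \<Rightarrow> 'a"

definition is_gs_algebra ::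
    "('g, 'm) monoid_scheme \<Rightarrow> ('f::field, 'a, 'g) gs_algebra \<Rightarrow> bool" where
  "is_gs_algebra G A \<longleftrightarrow>
     ring A \<and> module scalars A \<and>
     (\<forall>c. \<forall>a\<in>carrier A. \<forall>b\<in>carrier A.
        (c \<odot>\<^bsub>A\<^esub> a) \<otimes>\<^bsub>A\<^esub> b = c \<odot>\<^bsub>A\<^esub> (a \<otimes>\<^bsub>A\<^esub> b) \<and> a \<otimes>\<^bsub>A\<^esub> (c \<odot>\<^bsub>A\<^esub> b) = c \<odot>\<^bsub>A\<^esub> (a \<otimes>\<^bsub>A\<^esub> b)) \<and>
     (\<forall>s\<in>carrier G. submodule (homog A s) scalars A) \<and>
     (\<forall>a\<in>carrier A. \<exists>!c. c \<in> (\<Pi>\<^sub>E s\<in>carrier G. homog A s) \<and> a = finsum A c (carrier G)) \<and>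
     (\<forall>s\<in>carrier G. \<forall>t\<in>carrier G. \<forall>a\<in>homog A s. \<forall>b\<in>homog A t.
        a \<otimes>\<^bsub>A\<^esub> b \<in> homog A (s \<otimes>\<^bsub>G\<^esub> t)) \<and>
     (\<forall>a\<in>carrier A. star A a \<in> carrier A \<and> star A (star A a) = a) \<and>
     (\<forall>a\<in>carrier A. \<forall>b\<in>carrier A. star A (a \<oplus>\<^bsub>A\<^esub> b) = star A a \<oplus>\<^bsub>A\<^esub> star A b \<and>
        star A (a \<otimes>\<^bsub>A\<^esub> b) = star A b \<otimes>\<^bsub>A\<^esub> star A a) \<and>
     (\<forall>c. \<forall>a\<in>carrier A. star A (c \<odot>\<^bsub>A\<^esub> a) = c \<odot>\<^bsub>A\<^esub> star A a) \<and>
     (\<forall>s\<in>carrier G. star A ` homog A s = homog A s)"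

datatype symmetry = Sym | Skew

fun signed_homog :: "('f, 'a, 'g) gs_algebra \<Rightarrow> 'g \<Rightarrow> symmetry \<Rightarrow> 'a set" where
  "signed_homog A s Sym = {a \<in> homog A s. star A a = a}"
| "signed_homog A s Skew = {a \<in> homog A s. star A a = \<ominus>\<^bsub>A\<^esub> a}"


section \<open>The free \<open>(G,*)\<close>-algebra\<close>

text \<open>\<open>Var i s Sym\<close> and \<open>Var i s Skew\<close> are the variables $x_{i,s}^+$ and $x_{i,s}^-$.\<close>

datatype 'g var = Var nat (var_deg: 'g) (var_sym: symmetry)

definition vars :: "('g, 'm) monoid_scheme \<Rightarrow> 'g var set" where
  "vars G = {Var i s e | i s e. 1 \<le> i \<and> s \<in> carrier G}"

text \<open>With concatenation as addition of words, convolution on finitely supported functions is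
  the multiplication of noncommutative polynomials.\<close>

instantiation list :: (type) monoid_add
begin
definition zero_list :: "'a list" where "zero_list = []"
definition plus_list :: "'a list \<Rightarrow> 'a list \<Rightarrow> 'a list" where "plus_list = (@)"
instance by standard (simp_all add: zero_list_def plus_list_def)
end

type_synonym ('g, 'f) ncpoly = "'g var list \<Rightarrow>\<^sub>0 'f"

definition pm_scale :: "'f::field \<Rightarrow> ('k \<Rightarrow>\<^sub>0 'f) \<Rightarrow> ('k \<Rightarrow>\<^sub>0 'f)" where
  "pm_scale c p = Poly_Mapping.map ((*) c) p"

lemma lookup_pm_scale [simp]: "Poly_Mapping.lookup (pm_scale c p) k = c * Poly_Mapping.lookup p k"
  by (simp add: pm_scale_def map.rep_eq when_def)

interpretation pm: vector_space pm_scale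
  by unfold_locales (auto intro!: poly_mapping_eqI simp: lookup_add algebra_simps)

definition word_deg :: "('g, 'm) monoid_scheme \<Rightarrow> 'g var list \<Rightarrow> 'g" where
  "word_deg G w = foldr (\<lambda>x d. var_deg x \<otimes>\<^bsub>G\<^esub> d) w \<one>\<^bsub>G\<^esub>"

definition word_sign :: "'g var list \<Rightarrow> 'f::field" where
  "word_sign w = (\<Prod>x\<leftarrow>w. case var_sym x of Sym \<Rightarrow> 1 | Skew \<Rightarrow> - 1)"

definition free_star :: "('g, 'f::field) ncpoly \<Rightarrow> ('g, 'f) ncpoly" where
  "free_star p = (\<Sum>w\<in>Poly_Mapping.keys p.
     Poly_Mapping.single (rev w) (word_sign w * Poly_Mapping.lookup p w))"

definition free_gs_algebra ::
    "('g, 'm) monoid_scheme \<Rightarrow> ('f::field, ('g, 'f) ncpoly, 'g) gs_algebra" where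
  "free_gs_algebra G = \<lparr>
     carrier = {p. \<forall>w\<in>Poly_Mapping.keys p. set w \<subseteq> vars G},
     monoid.mult = (*), one = 1, zero = 0, add = (+), smult = pm_scale,
     homog = (\<lambda>s. {p. \<forall>w\<in>Poly_Mapping.keys p. set w \<subseteq> vars G \<and> word_deg G w = s}),
     star = free_star\<rparr>"

definition X :: "nat \<Rightarrow> 'g \<Rightarrow> symmetry \<Rightarrow> ('g, 'f::field) ncpoly" where
  "X i s e = Poly_Mapping.single [Var i s e] 1"

definition commutator :: "'a::ring \<Rightarrow> 'a \<Rightarrow> 'a" where
  "commutator a b = a * b - b * a"


section \<open>Identities and \<open>T\<^sub>G\<^sup>*\<close>-ideals\<close>

definition admissible ::
    "('g, 'm) monoid_scheme \<Rightarrow> ('f, 'a, 'g) gs_algebra \<Rightarrow> ('g var \<Rightarrow> 'a) \<Rightarrow> bool" where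
  "admissible G A \<phi> \<longleftrightarrow> (\<forall>x\<in>vars G. \<phi> x \<in> signed_homog A (var_deg x) (var_sym x))"

definition eval_poly ::
    "('f::field, 'a, 'g) gs_algebra \<Rightarrow> ('g var \<Rightarrow> 'a) \<Rightarrow> ('g, 'f) ncpoly \<Rightarrow> 'a" where
  "eval_poly A \<phi> p =
     finsum A (\<lambda>w. Poly_Mapping.lookup p w \<odot>\<^bsub>A\<^esub> foldr (\<lambda>x a. \<phi> x \<otimes>\<^bsub>A\<^esub> a) w \<one>\<^bsub>A\<^esub>) (Poly_Mapping.keys p)"

definition Id_sharp ::
    "('g, 'm) monoid_scheme \<Rightarrow> ('f::field, 'a, 'g) gs_algebra \<Rightarrow> ('g, 'f) ncpoly set" where
  "Id_sharp G A = {p \<in> carrier (free_gs_algebra G). \<forall>\<phi>. admissible G A \<phi> \<longrightarrow> eval_poly A \<phi> p = \<zero>\<^bsub>A\<^esub>}"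

definition gs_endomorphism ::
    "('g, 'm) monoid_scheme \<Rightarrow> ('f::field, 'a, 'g) gs_algebra \<Rightarrow> ('a \<Rightarrow> 'a) \<Rightarrow> bool" where
  "gs_endomorphism G A \<phi> \<longleftrightarrow>
     \<phi> \<in> Ring.ring_hom A A \<and>
     (\<forall>c. \<forall>a\<in>carrier A. \<phi> (c \<odot>\<^bsub>A\<^esub> a) = c \<odot>\<^bsub>A\<^esub> \<phi> a) \<and>
     (\<forall>s\<in>carrier G. \<phi> ` homog A s \<subseteq> homog A s) \<and>
     (\<forall>a\<in>carrier A. \<phi> (star A a) = star A (\<phi> a))"

text \<open>Closure under scalars is automatic for ideals of a unital algebra. The generated ideal
  is \<open>T_ideal G hull S\<close>, the intersection of all those containing \<open>S\<close>.\<close>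

definition T_ideal :: "('g, 'm) monoid_scheme \<Rightarrow> ('g, 'f::field) ncpoly set \<Rightarrow> bool" where
  "T_ideal G I \<longleftrightarrow>
     ideal I (free_gs_algebra G) \<and>
     (\<forall>\<phi>. gs_endomorphism G (free_gs_algebra G) \<phi> \<longrightarrow> \<phi> ` I \<subseteq> I) \<and>
     free_star ` I \<subseteq> I"


section \<open>Dimensions and traces on quotient spaces\<close>

text \<open>\<open>B\<close> is a set of representatives of a finite basis of \<open>V/(V \<inter> W)\<close>: every
  \<open>v \<in> V\<close> is congruent modulo \<open>W\<close> to exactly one linear combination of \<open>B\<close>.\<close>

definition quot_basis :: "('k \<Rightarrow>\<^sub>0 'f::field) set \<Rightarrow> ('k \<Rightarrow>\<^sub>0 'f) set \<Rightarrow> ('k \<Rightarrow>\<^sub>0 'f) set \<Rightarrow> bool" where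
  "quot_basis V W B \<longleftrightarrow> finite B \<and> B \<subseteq> V \<and>
     (\<forall>v\<in>V. \<exists>!c. c \<in> (B \<rightarrow>\<^sub>E UNIV) \<and> v - (\<Sum>b\<in>B. pm_scale (c b) b) \<in> W)"

definition quot_coords :: "('k \<Rightarrow>\<^sub>0 'f::field) set \<Rightarrow> ('k \<Rightarrow>\<^sub>0 'f) set \<Rightarrow> ('k \<Rightarrow>\<^sub>0 'f) \<Rightarrow> ('k \<Rightarrow>\<^sub>0 'f) \<Rightarrow> 'f" where
  "quot_coords W B v = (THE c. c \<in> (B \<rightarrow>\<^sub>E UNIV) \<and> v - (\<Sum>b\<in>B. pm_scale (c b) b) \<in> W)"

definition quot_dim :: "('k \<Rightarrow>\<^sub>0 'f::field) set \<Rightarrow> ('k \<Rightarrow>\<^sub>0 'f) set \<Rightarrow> nat" where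
  "quot_dim V W = card (SOME B. quot_basis V W B)"

text \<open>The trace of the map induced on \<open>V/(V \<inter> W)\<close> by \<open>f\<close>, which must preserve \<open>V\<close> and
  \<open>V \<inter> W\<close>; it does not depend on the basis chosen.\<close>

definition quot_trace ::
    "('k \<Rightarrow>\<^sub>0 'f::field) set \<Rightarrow> ('k \<Rightarrow>\<^sub>0 'f) set \<Rightarrow> (('k \<Rightarrow>\<^sub>0 'f) \<Rightarrow> ('k \<Rightarrow>\<^sub>0 'f)) \<Rightarrow> 'f" where
  "quot_trace V W f = (let B = SOME B. quot_basis V W B in \<Sum>b\<in>B. quot_coords W B (f b) b)"

definition pm_rename :: "('k \<Rightarrow> 'l) \<Rightarrow> ('k \<Rightarrow>\<^sub>0 'f::field) \<Rightarrow> ('l \<Rightarrow>\<^sub>0 'f)" where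
  "pm_rename h p = (\<Sum>k\<in>Poly_Mapping.keys p. Poly_Mapping.single (h k) (Poly_Mapping.lookup p k))"


section \<open>Codimensions\<close>

definition P_sharp :: "('g, 'm) monoid_scheme \<Rightarrow> nat \<Rightarrow> ('g, 'f::field) ncpoly set" where
  "P_sharp G n = pm.span {Poly_Mapping.single (map (\<lambda>k. w (\<sigma> k)) [1..<n + 1]) 1 | \<sigma> w.
     \<sigma> permutes {1..n} \<and> (\<forall>i\<in>{1..n}. \<exists>s\<in>carrier G. \<exists>e. w i = Var i s e)}"

definition codim :: "('g, 'm) monoid_scheme \<Rightarrow> ('f::field, 'a, 'g) gs_algebra \<Rightarrow> nat \<Rightarrow> nat" where
  "codim G A n = quot_dim (P_sharp G n) (P_sharp G n \<inter> Id_sharp G A)"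


section \<open>Cocharacters\<close>

text \<open>Instead of listing the $2t$ pairs of a degree and a sign, the families
  $\langle n\rangle = (n_1,\dots,n_{2t})$ are indexed by these pairs.\<close>

definition var_types :: "('g, 'm) monoid_scheme \<Rightarrow> ('g \<times> symmetry) set" where
  "var_types G = carrier G \<times> UNIV"

definition compositions :: "('g, 'm) monoid_scheme \<Rightarrow> nat \<Rightarrow> ('g \<times> symmetry \<Rightarrow> nat) set" where
  "compositions G n = {\<nu>. (\<forall>t. t \<notin> var_types G \<longrightarrow> \<nu> t = 0) \<and> (\<Sum>t\<in>var_types G. \<nu> t) = n}"

text \<open>The variables of type \<open>(s, e)\<close> occurring in \<open>P_multi G \<nu>\<close> are \<open>Var i s e\<close> with
  \<open>1 \<le> i \<le> \<nu> (s, e)\<close>, so that the corresponding factor \<open>sym_group (\<nu> (s, e))\<close>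
  of the Young subgroup acts on the indices.\<close>

definition P_multi ::
    "('g, 'm) monoid_scheme \<Rightarrow> ('g \<times> symmetry \<Rightarrow> nat) \<Rightarrow> ('g, 'f::field) ncpoly set" where
  "P_multi G \<nu> = pm.span {Poly_Mapping.single w 1 | w.
     distinct w \<and> set w = {Var i s e | i s e. s \<in> carrier G \<and> 1 \<le> i \<and> i \<le> \<nu> (s, e)}}"

definition young_group ::
    "('g, 'm) monoid_scheme \<Rightarrow> ('g \<times> symmetry \<Rightarrow> nat) \<Rightarrow> ('g \<times> symmetry \<Rightarrow> nat \<Rightarrow> nat) monoid" where
  "young_group G \<nu> = product_group (var_types G) (\<lambda>t. sym_group (\<nu> t))"

fun var_act :: "('g \<times> symmetry \<Rightarrow> nat \<Rightarrow> nat) \<Rightarrow> 'g var \<Rightarrow> 'g var" where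
  "var_act \<pi> (Var i s e) = Var (\<pi> (s, e) i) s e"

definition cocharacter ::
    "('g, 'm) monoid_scheme \<Rightarrow> ('f::field, 'a, 'g) gs_algebra \<Rightarrow> ('g \<times> symmetry \<Rightarrow> nat) \<Rightarrow>
     ('g \<times> symmetry \<Rightarrow> nat \<Rightarrow> nat) \<Rightarrow> 'f" where
  "cocharacter G A \<nu> = (\<lambda>\<pi>\<in>carrier (young_group G \<nu>).
     quot_trace (P_multi G \<nu>) (P_multi G \<nu> \<inter> Id_sharp G A) (pm_rename (map (var_act \<pi>))))"

text \<open>Each character is paired with its \<open>\<nu>\<close>, which determines the group it belongs to.\<close>

definition nonzero_cocharacters ::
    "('g, 'm) monoid_scheme \<Rightarrow> ('f::field, 'a, 'g) gs_algebra \<Rightarrow> nat \<Rightarrow>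
     (('g \<times> symmetry \<Rightarrow> nat) \<times> (('g \<times> symmetry \<Rightarrow> nat \<Rightarrow> nat) \<Rightarrow> 'f)) set" where
  "nonzero_cocharacters G A n = {(\<nu>, cocharacter G A \<nu>) | \<nu>. \<nu> \<in> compositions G n \<and>
     (\<exists>\<pi>\<in>carrier (young_group G \<nu>). cocharacter G A \<nu> \<pi> \<noteq> 0)}"


section \<open>Irreducible characters of symmetric groups and of Young subgroups\<close>

text \<open>A partition is a weakly decreasing list; trailing zeros do not matter. The tableau
  used is the one whose rows are filled consecutively with $1,\dots,n$; rows and columns
  are counted from \<open>0\<close>.\<close>

definition tableau_entry :: "nat list \<Rightarrow> nat \<Rightarrow> nat \<Rightarrow> nat" where
  "tableau_entry \<kappa> i j = sum_list (take i \<kappa>) + j + 1"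

definition tableau_row :: "nat list \<Rightarrow> nat \<Rightarrow> nat set" where
  "tableau_row \<kappa> i = {tableau_entry \<kappa> i j | j. i < length \<kappa> \<and> j < \<kappa> ! i}"

definition tableau_col :: "nat list \<Rightarrow> nat \<Rightarrow> nat set" where
  "tableau_col \<kappa> j = {tableau_entry \<kappa> i j | i. i < length \<kappa> \<and> j < \<kappa> ! i}"

definition row_stabilizer :: "nat list \<Rightarrow> (nat \<Rightarrow> nat) set" where
  "row_stabilizer \<kappa> = {\<sigma>. \<sigma> permutes {1..sum_list \<kappa>} \<and> (\<forall>i. \<sigma> ` tableau_row \<kappa> i = tableau_row \<kappa> i)}"

definition col_stabilizer :: "nat list \<Rightarrow> (nat \<Rightarrow> nat) set" where
  "col_stabilizer \<kappa> = {\<sigma>. \<sigma> permutes {1..sum_list \<kappa>} \<and> (\<forall>j. \<sigma> ` tableau_col \<kappa> j = tableau_col \<kappa> j)}"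

text \<open>The group algebra $FS_n$ is realised on finitely supported functions on permutations; left
  multiplication by \<open>\<sigma>\<close> is \<open>pm_rename ((\<circ>) \<sigma>)\<close>. The irreducible character of \<open>\<kappa>\<close> is that of
  the minimal left ideal generated by the Young symmetrizer.\<close>

definition young_symmetrizer :: "nat list \<Rightarrow> (nat \<Rightarrow> nat) \<Rightarrow>\<^sub>0 'f::field" where
  "young_symmetrizer \<kappa> = (\<Sum>\<sigma>\<in>row_stabilizer \<kappa>. \<Sum>\<tau>\<in>col_stabilizer \<kappa>.
     Poly_Mapping.single (\<sigma> \<circ> \<tau>) (of_int (sign \<tau>)))"

definition specht_module :: "nat list \<Rightarrow> ((nat \<Rightarrow> nat) \<Rightarrow>\<^sub>0 'f::field) set" where
  "specht_module \<kappa> =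
     pm.span {pm_rename ((\<circ>) \<sigma>) (young_symmetrizer \<kappa>) | \<sigma>. \<sigma> permutes {1..sum_list \<kappa>}}"

definition sym_char :: "nat list \<Rightarrow> (nat \<Rightarrow> nat) \<Rightarrow> 'f::field" where
  "sym_char \<kappa> \<sigma> = quot_trace (specht_module \<kappa>) {0} (pm_rename ((\<circ>) \<sigma>))"

text \<open>A family \<open>\<Lambda>\<close> of partitions, one for each type of variables, stands for the character
  $\chi_{(\Lambda(s,e)_{s^e})_{s,e}}$ of the outer tensor product; it is returned together with its
  \<open>\<nu>\<close>, as in \<open>nonzero_cocharacters\<close>.\<close>

definition outer_char ::
    "('g, 'm) monoid_scheme \<Rightarrow> ('g \<times> symmetry \<Rightarrow> nat list) \<Rightarrow>
     ('g \<times> symmetry \<Rightarrow> nat) \<times> (('g \<times> symmetry \<Rightarrow> nat \<Rightarrow> nat) \<Rightarrow> 'f::field)" where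
  "outer_char G \<Lambda> =
     (let \<nu> = (\<lambda>t. sum_list (\<Lambda> t)) in
        (\<nu>, \<lambda>\<pi>\<in>carrier (young_group G \<nu>). \<Prod>t\<in>var_types G. sym_char (\<Lambda> t) (\<pi> t)))"

abbreviation no_parts :: "'g \<times> symmetry \<Rightarrow> nat list" where
  "no_parts \<equiv> (\<lambda>_. [])"


section \<open>Colengths\<close>

definition mat_trace :: "'f::field mat \<Rightarrow> 'f" where
  "mat_trace M = (\<Sum>i<dim_row M. M $$ (i, i))"

definition irreducible_rep :: "('h, 'm) monoid_scheme \<Rightarrow> nat \<Rightarrow> ('h \<Rightarrow> 'f::field mat) \<Rightarrow> bool" where
  "irreducible_rep H d \<rho> \<longleftrightarrow>
     0 < d \<and> \<rho> \<in> hom H (units_of (ring_mat TYPE('f) d ())) \<and>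
     (\<forall>U. U \<subseteq> carrier_vec d \<and> 0\<^sub>v d \<in> U \<and> (\<forall>u\<in>U. \<forall>v\<in>U. u + v \<in> U) \<and> (\<forall>c. \<forall>u\<in>U. c \<cdot>\<^sub>v u \<in> U) \<and>
          (\<forall>x\<in>carrier H. \<forall>u\<in>U. \<rho> x *\<^sub>v u \<in> U)
        \<longrightarrow> U = {0\<^sub>v d} \<or> U = carrier_vec d)"

definition irreducible_characters :: "('h, 'm) monoid_scheme \<Rightarrow> ('h \<Rightarrow> 'f::field) set" where
  "irreducible_characters H = {\<lambda>x\<in>carrier H. mat_trace (\<rho> x) | \<rho>. \<exists>d. irreducible_rep H d \<rho>}"

text \<open>The number of irreducible constituents counted with multiplicity. It is well defined for
  characters of finite groups in characteristic zero, where the irreducible characters are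
  linearly independent.\<close>

definition num_constituents :: "('h, 'm) monoid_scheme \<Rightarrow> ('h \<Rightarrow> 'f::field) \<Rightarrow> nat" where
  "num_constituents H \<chi> = (THE k. \<exists>\<psi>s. length \<psi>s = k \<and> set \<psi>s \<subseteq> irreducible_characters H \<and>
     (\<forall>x\<in>carrier H. \<chi> x = (\<Sum>\<psi>\<leftarrow>\<psi>s. \<psi> x)))"

definition colength :: "('g, 'm) monoid_scheme \<Rightarrow> ('f::field, 'a, 'g) gs_algebra \<Rightarrow> nat \<Rightarrow> nat" where
  "colength G A n = (\<Sum>\<nu>\<in>compositions G n. num_constituents (young_group G \<nu>) (cocharacter G A \<nu>))"


section \<open>The algebras \<open>C\<^sub>3\<^sup>g\<close> and \<open>C\<^sub>3\<^sub>,\<^sub>*\<^sup>g\<close>\<close>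

text \<open>Matrix indices start at \<open>0\<close>.\<close>

definition E1 :: "'f::field mat" where
  "E1 = mat 3 3 (\<lambda>(i, j). if (i, j) = (0, 1) \<or> (i, j) = (1, 2) then 1 else 0)"

definition c3 :: "'f::field \<Rightarrow> 'f \<Rightarrow> 'f \<Rightarrow> 'f mat" where
  "c3 \<alpha> \<alpha>1 \<alpha>2 = \<alpha> \<cdot>\<^sub>m 1\<^sub>m 3 + \<alpha>1 \<cdot>\<^sub>m E1 + \<alpha>2 \<cdot>\<^sub>m (E1 * E1)"

definition C3_homog :: "('g, 'm) monoid_scheme \<Rightarrow> 'g \<Rightarrow> 'g \<Rightarrow> 'f::field mat set" where
  "C3_homog G g s =
     (if s = \<one>\<^bsub>G\<^esub> then {c3 \<alpha> 0 0 | \<alpha>. True}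
      else if s = g then {c3 0 \<alpha> 0 | \<alpha>. True}
      else if s = g \<otimes>\<^bsub>G\<^esub> g then {c3 0 0 \<alpha> | \<alpha>. True}
      else {c3 0 0 0})"

definition C3_with :: "('f::field mat \<Rightarrow> 'f mat) \<Rightarrow> ('g, 'm) monoid_scheme \<Rightarrow> 'g \<Rightarrow>
    ('f, 'f mat, 'g) gs_algebra" where
  "C3_with st G g = \<lparr>
     carrier = {c3 \<alpha> \<alpha>1 \<alpha>2 | \<alpha> \<alpha>1 \<alpha>2. True},
     monoid.mult = (*), one = 1\<^sub>m 3, zero = 0\<^sub>m 3 3, add = (+), smult = (\<cdot>\<^sub>m),
     homog = C3_homog G g, star = st\<rparr>"

definition C3 :: "('g, 'm) monoid_scheme \<Rightarrow> 'g \<Rightarrow> ('f::field, 'f mat, 'g) gs_algebra" where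
  "C3 = C3_with (\<lambda>M. M)"

text \<open>The entries \<open>(0,0)\<close>, \<open>(0,1)\<close>, \<open>(0,2)\<close> of \<open>c3 \<alpha> \<alpha>1 \<alpha>2\<close> are \<open>\<alpha>\<close>, \<open>\<alpha>1\<close>, \<open>\<alpha>2\<close>.\<close>

definition C3_star :: "('g, 'm) monoid_scheme \<Rightarrow> 'g \<Rightarrow> ('f::field, 'f mat, 'g) gs_algebra" where
  "C3_star = C3_with (\<lambda>M. c3 (M $$ (0, 0)) (- (M $$ (0, 1))) (M $$ (0, 2)))"

lemma c3_entries: "c3 a b c = mat 3 3 (\<lambda>(i, j).
    if i = j then a else if (i, j) = (0, 1) \<or> (i, j) = (1, 2) then b else if (i, j) = (0, 2) then c else 0)"
  by (rule eq_matI)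
    (auto simp: c3_def E1_def scalar_prod_def sum.atLeast0_lessThan_Suc numeral_3_eq_3 less_Suc_eq)

lemma c3_carrier [simp]: "c3 a b c \<in> carrier_mat 3 3"
  by (simp add: c3_entries)

lemma c3_inject [simp]: "c3 a b c = c3 a' b' c' \<longleftrightarrow> a = a' \<and> b = b' \<and> c = c'"
proof
  assume eq: "c3 a b c = c3 a' b' c'"
  have "c3 a b c $$ (0, j) = c3 a' b' c' $$ (0, j)" for j using eq by simp
  from this[of 0] this[of 1] this[of 2] show "a = a' \<and> b = b' \<and> c = c'"
    by (simp add: c3_entries)
qed simp

lemma c3_ops:
  "c3 a b c + c3 a' b' c' = c3 (a + a') (b + b') (c + c')"
  "k \<cdot>\<^sub>m c3 a b c = c3 (k * a) (k * b) (k * c)"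
  "c3 a b c * c3 a' b' c' = c3 (a * a') (a * b' + b * a') (a * c' + b * b' + c * a')"
  "1\<^sub>m 3 = c3 1 0 0" "0\<^sub>m 3 3 = c3 0 0 0"
  by (auto intro!: eq_matI simp: c3_entries scalar_prod_def sum.atLeast0_lessThan_Suc numeral_3_eq_3 less_Suc_eq)

lemma c3_index [simp]: "c3 a b c $$ (0, 0) = a" "c3 a b c $$ (0, 1) = b" "c3 a b c $$ (0, Suc 0) = b" "c3 a b c $$ (0, 2) = c"
  by (simp_all add: c3_entries)

lemma C3_with_simps [simp]:
  "carrier (C3_with st G g) = {c3 a b c | a b c. True}"
  "monoid.mult (C3_with st G g) = (*)" "one (C3_with st G g) = c3 1 0 0"
  "zero (C3_with st G g) = c3 0 0 0" "add (C3_with st G g) = (+)"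
  "smult (C3_with st G g) = (\<cdot>\<^sub>m)" "homog (C3_with st G g) = C3_homog G g"
  "star (C3_with st G g) = st"
  by (simp_all add: C3_with_def c3_ops)

lemma ring_C3: "ring (C3_with st G g)"
proof (rule ringI)
  show "abelian_group (C3_with st G g)"
  proof (rule abelian_groupI)
    fix x assume "x \<in> carrier (C3_with st G g)"
    then obtain a b c where x: "x = c3 a b c" by auto
    show "\<exists>y\<in>carrier (C3_with st G g). y \<oplus>\<^bsub>C3_with st G g\<^esub> x = \<zero>\<^bsub>C3_with st G g\<^esub>"
      by (rule bexI[of _ "c3 (- a) (- b) (- c)"]) (auto simp: x c3_ops)
  qed (auto simp: c3_ops algebra_simps)
  show "Group.monoid (C3_with st G g)"
    by (rule monoidI) (auto simp: c3_ops algebra_simps)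
qed (auto simp: c3_ops algebra_simps)

lemma module_C3: "module scalars (C3_with st G g)"
proof (rule moduleI)
  show "cring (scalars :: 'f::field ring)"
  proof (rule cringI)
    show "abelian_group (scalars :: 'f ring)"
    proof (rule abelian_groupI)
      fix x :: 'f
      show "\<exists>y\<in>carrier scalars. y \<oplus>\<^bsub>scalars\<^esub> x = \<zero>\<^bsub>scalars\<^esub>"
        by (rule bexI[of _ "- x"]) (auto simp: scalars_def)
    qed (auto simp: scalars_def)
    show "comm_monoid (scalars :: 'f ring)"
      by (rule comm_monoidI) (auto simp: scalars_def)
  qed (auto simp: scalars_def algebra_simps)
  show "abelian_group (C3_with st G g)" using ring_C3 by (rule ring.is_abelian_group)
qed (auto simp: scalars_def c3_ops algebra_simps)

lemma C3_minus: "\<ominus>\<^bsub>C3_with st G g\<^esub> c3 a b c = c3 (- a) (- b) (- c)"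
  by (rule abelian_group.minus_equality[OF ring.is_abelian_group[OF ring_C3]]) (auto simp: c3_ops)

lemma finsum_C3: "finite S \<Longrightarrow> finsum (C3_with st G g) (\<lambda>s. c3 (a s) (b s) (c s)) S
   = c3 (sum a S) (sum b S) (sum c S)"
proof (induction S rule: finite_induct)
  case empty
  interpret ring "C3_with st G g" by (rule ring_C3)
  show ?case by simp
next
  case (insert x F)
  interpret ring "C3_with st G g" by (rule ring_C3)
  have "(\<lambda>s. c3 (a s) (b s) (c s)) \<in> F \<rightarrow> carrier (C3_with st G g)" by auto
  with insert show ?case
    by (subst finsum_insert) (auto simp: c3_ops)
qed

lemma C3_with_gs_algebra:
  fixes \<epsilon> :: "'f::field"
  assumes "comm_group G" "finite (carrier G)" "g \<in> carrier G" "group.ord G g > 2"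
    and \<epsilon>: "\<epsilon> * \<epsilon> = 1"
    and st: "\<And>a b c. st (c3 a b c) = c3 a (\<epsilon> * b) c"
  shows "is_gs_algebra G (C3_with st G g)"
proof -
  interpret G: comm_group G by fact
  interpret A: ring "C3_with st G g" by (rule ring_C3)
  let ?A = "C3_with st G g"
  let ?h = "g \<otimes>\<^bsub>G\<^esub> g"
  have g1: "g \<noteq> \<one>\<^bsub>G\<^esub>" using assms(4) G.ord_eq_1[OF assms(3)] by auto
  have "g [^]\<^bsub>G\<^esub> (2::nat) \<noteq> \<one>\<^bsub>G\<^esub>"
    using assms(3,4) G.pow_eq_id[OF assms(3), of 2] by (auto dest: dvd_imp_le)
  then have h1: "?h \<noteq> \<one>\<^bsub>G\<^esub>" by (simp add: numeral_2_eq_2 assms(3))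
  have hg: "?h \<noteq> g" using g1 assms(3) by (metis G.l_cancel_one)
  note distinct = g1 h1 hg g1[symmetric] h1[symmetric] hg[symmetric]
  have 4: "submodule (C3_homog G g s) scalars ?A" for s
    by (rule module.submoduleI[OF module_C3])
       (auto simp: C3_homog_def c3_ops scalars_def C3_minus split: if_splits)
  have 5: "\<exists>!c. c \<in> (\<Pi>\<^sub>E s\<in>carrier G. C3_homog G g s) \<and> x = finsum ?A c (carrier G)"
    if xA: "x \<in> carrier ?A" for x
  proof -
    obtain a b d where x: "x = c3 a b d" using xA by auto
    have fs: "finsum ?A (\<lambda>s. c3 (if s = \<one>\<^bsub>G\<^esub> then p s else 0) (if s = g then p s else 0) (if s = ?h then p s else 0)) (carrier G)
       = c3 (p \<one>\<^bsub>G\<^esub>) (p g) (p ?h)" for p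
      using assms by (subst finsum_C3) (auto simp: sum.delta')
    have elt: "y \<in> C3_homog G g s \<longleftrightarrow> 
       (\<exists>q. y = c3 (if s = \<one>\<^bsub>G\<^esub> then q else 0) (if s = g then q else 0) (if s = ?h then q else 0))" for s and y :: "'f mat"
      using distinct by (auto simp: C3_homog_def)
    let ?p = "\<lambda>s. if s = \<one>\<^bsub>G\<^esub> then a else if s = g then b else d"
    let ?w = "\<lambda>p s. c3 (if s = \<one>\<^bsub>G\<^esub> then p s else 0) (if s = g then p s else 0) (if s = ?h then p s else (0::'f))"
    let ?c = "restrict (?w ?p) (carrier G)"
    show ?thesis
    proof (rule ex1I[of _ ?c], intro conjI)
      show "?c \<in> (\<Pi>\<^sub>E s\<in>carrier G. C3_homog G g s)"
        using elt by fastforce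
      have "finsum ?A ?c (carrier G) = finsum ?A (?w ?p) (carrier G)"
        by (rule A.finsum_cong') auto
      also have "\<dots> = x" unfolding fs using distinct by (simp add: x)
      finally show "x = finsum ?A ?c (carrier G)" by simp
    next
      fix c assume c: "c \<in> (\<Pi>\<^sub>E s\<in>carrier G. C3_homog G g s) \<and> x = finsum ?A c (carrier G)"
      then have "\<forall>s\<in>carrier G. \<exists>q. c s = c3 (if s = \<one>\<^bsub>G\<^esub> then q else 0) (if s = g then q else 0) (if s = ?h then q else 0)"
        using elt by blast
      then obtain p where p: "\<forall>s\<in>carrier G. c s = ?w p s" by metis
      have "x = finsum ?A (?w p) (carrier G)"
        using c p by (auto intro!: A.finsum_cong')
      then have "x = c3 (p \<one>\<^bsub>G\<^esub>) (p g) (p ?h)" unfolding fs .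
      then have pp: "p \<one>\<^bsub>G\<^esub> = a" "p g = b" "p ?h = d" using x by auto
      have "c s = ?c s" for s
      proof (cases "s \<in> carrier G")
        case True
        then show ?thesis using p pp distinct by auto
      next
        case False
        then show ?thesis using c by auto
      qed
      then show "c = ?c" ..
    qed
  qed
  have 6: "x * y \<in> C3_homog G g (s \<otimes>\<^bsub>G\<^esub> t)"
    if "s \<in> carrier G" "t \<in> carrier G" "x \<in> C3_homog G g s" "y \<in> C3_homog G g t" for s t x y
    using that distinct assms(3)
    by (auto simp: C3_homog_def c3_ops split: if_splits)
  have e2: "\<epsilon> * (\<epsilon> * b) = b" for b using \<epsilon> by (simp flip: mult.assoc)
  have e3: "(\<epsilon> * x) * (\<epsilon> * y) = x * y" for x y using \<epsilon> e2 by (simp add: mult.left_commute)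
  have 10: "st ` C3_homog G g s = C3_homog G g s" for s
  proof -
    have sub: "st x \<in> C3_homog G g s" if "x \<in> C3_homog G g s" for x
      using that by (auto simp: C3_homog_def st split: if_splits)
    moreover have "x = st (st x)" if "x \<in> C3_homog G g s" for x
      using that e2 by (auto simp: C3_homog_def st split: if_splits)
    ultimately show ?thesis by blast
  qed
  show ?thesis
    unfolding is_gs_algebra_def
    using 4 5 6 10
    by (intro conjI ring_C3 module_C3) 
       (auto simp: c3_ops st e2 e3 \<epsilon> algebra_simps)
qed

corollary C3_gs_algebras:
  assumes "comm_group G" "finite (carrier G)" "g \<in> carrier G" "group.ord G g > 2"
  shows "is_gs_algebra G (C3 G g)" "is_gs_algebra G (C3_star G g)"
  unfolding C3_def C3_star_def
  using C3_with_gs_algebra[OF assms, of 1 "\<lambda>M. M"]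
    C3_with_gs_algebra[OF assms, of "-1" "\<lambda>M. c3 (M $$ (0, 0)) (- (M $$ (0, 1))) (M $$ (0, 2))"]
  by simp_all

end

theory Submission
  imports Defs
begin

text \<open>Both algebras are \<open>F[t]/(t\<^sup>3)\<close> with \<open>t\<close> of degree \<open>g\<close>, so a variable takes values in
  \<open>F t\<^sup>k\<close> for some \<open>k \<le> 2\<close>, its weight, or vanishes (weight 3). A polynomial is then an identity
  iff for every multiset of variables of total weight at most 2 the coefficients of the words with
  these letters add up to zero, because distinct commutative monomials are linearly independent
  functions. Modulo the listed generators all variables commute: a commutator of two surviving
  variables has the sign that vanishes in its degree. Words of weight at least 3 lie in the ideal as
  well, so the ideal contains every identity.

  Hence every space of multilinear polynomials with prescribed letters has quotient of dimension 1
  (total weight at most 2) or 0, on which permutations of the variables act trivially. Cocharacters,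
  codimensions and colengths are read off by counting the families of letters of weight at most 2.\<close>


section \<open>Additive maps on finitely supported functions\<close>

text \<open>The two algebras are treated at once: the sign \<open>e\<close> of the surviving
  variables of degree \<open>g\<close> fixes the involution t -> \<open>eps\<close> t, with
  \<open>eps\<close> equal to 1 or -1. A word of weight k <= 2 has degree g^k and sign
  \<open>eps\<close>^k, so degree and sign together tell which power of t an element can reach. This
  controls both the commutators and the values of homogeneous elements. That the identities form a
  T-ideal cannot be seen from the weights of words: \<open>g\<close> may have order 3, and then an
  endomorphism may send a variable of degree 1 to words of weight 3. Invariance is therefore proved
  after evaluation, where an endomorphism only changes the scalars assigned to the variables.
  Products of three letters of weight 1 are reached by splitting a product of two letters into half
  an anticommutator, which is an element of degree g^2, and half a commutator. Dimensions and traces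
  of quotients are defined through an arbitrarily chosen basis, so they are computed for every
  basis, by means of functionals that detect the subspace.\<close>

definition pm_extend :: "('k \<Rightarrow> 'c::zero \<Rightarrow> 'r::comm_monoid_add) \<Rightarrow> ('k \<Rightarrow>\<^sub>0 'c) \<Rightarrow> 'r" where
  "pm_extend h p = (\<Sum>k\<in>Poly_Mapping.keys p. h k (Poly_Mapping.lookup p k))"

lemma pm_extend_superset:
  assumes "finite K" "Poly_Mapping.keys p \<subseteq> K" "\<And>k. h k 0 = 0"
  shows "pm_extend h p = (\<Sum>k\<in>K. h k (Poly_Mapping.lookup p k))"
  unfolding pm_extend_def
  by (rule sum.mono_neutral_left) (use assms in \<open>auto simp: in_keys_iff\<close>)

text \<open>Renaming, \<open>free_star\<close>, evaluation and coefficient sums are all of this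
  form. Since \<open>h\<close> receives the coefficient itself, the target needs no scalar
  action.\<close>

lemma additive_pm_extend:
  fixes h :: "'k \<Rightarrow> 'c::ab_group_add \<Rightarrow> 'r::ab_group_add"
  assumes "\<And>k. Modules.additive (h k)"
  shows "Modules.additive (pm_extend h)"
proof
  fix p q :: "'k \<Rightarrow>\<^sub>0 'c"
  let ?K = "Poly_Mapping.keys p \<union> Poly_Mapping.keys q"
  have 0: "h k 0 = 0" for k using assms by (rule additive.zero)
  have "pm_extend h r = (\<Sum>k\<in>?K. h k (Poly_Mapping.lookup r k))" if "r \<in> {p, q, p + q}" for r
    by (rule pm_extend_superset) (use that 0 keys_add[of p q] in auto)
  then show "pm_extend h (p + q) = pm_extend h p + pm_extend h q"
    by (simp add: lookup_add additive.add[OF assms] sum.distrib)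
qed

lemma pm_extend_single:
  "h k 0 = 0 \<Longrightarrow> pm_extend h (Poly_Mapping.single k c) = h k c"
  by (simp add: pm_extend_def)

lemma pm_sum_single: "p = (\<Sum>k\<in>Poly_Mapping.keys p. Poly_Mapping.single k (Poly_Mapping.lookup p k))"
  by (rule poly_mapping_eqI)
    (auto simp: lookup_sum lookup_single when_def sum.delta' in_keys_iff)

text \<open>The induction principle for polynomials: additive maps are compared on single words.
  Only the keys of \<open>p\<close> are tested, since some equalities hold just for words over
  \<open>vars G\<close> or for multilinear words.\<close>

lemma additive_pm_eq:
  fixes f f' :: "('k \<Rightarrow>\<^sub>0 'c::ab_group_add) \<Rightarrow> 'r::ab_group_add"
  assumes "Modules.additive f" "Modules.additive f'"
    and "\<And>k c. k \<in> Poly_Mapping.keys p \<Longrightarrow> f (Poly_Mapping.single k c) = f' (Poly_Mapping.single k c)"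
  shows "f p = f' p"
  by (subst (1 2) pm_sum_single[of p])
    (simp add: additive.sum[OF assms(1)] additive.sum[OF assms(2)] assms(3))

lemma pm_scale_single: "pm_scale c (Poly_Mapping.single k d) = Poly_Mapping.single k (c * d)"
  by (rule poly_mapping_eqI) (simp add: lookup_single when_def)

lemma pm_rename_pm_extend: "pm_rename h = pm_extend (\<lambda>k. Poly_Mapping.single (h k))"
  by (simp add: fun_eq_iff pm_rename_def pm_extend_def)

lemma additive_pm_rename: "Modules.additive (pm_rename h)"
  unfolding pm_rename_pm_extend by (intro additive_pm_extend) (simp add: additive_def single_add)

lemma pm_rename_single [simp]:
  "pm_rename h (Poly_Mapping.single k c) = Poly_Mapping.single (h k) c"
  by (simp add: pm_rename_pm_extend pm_extend_single)

lemma pm_rename_scale: "pm_rename h (pm_scale c p) = pm_scale c (pm_rename h p)"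
proof (rule additive_pm_eq[of "\<lambda>p. pm_rename h (pm_scale c p)" "\<lambda>p. pm_scale c (pm_rename h p)"])
qed (auto simp: additive_def additive.add[OF additive_pm_rename]
       pm.scale_right_distrib pm_scale_single)


section \<open>Dimensions and traces on quotients, by dual functionals\<close>

text \<open>On \<open>V\<close> the common kernel of the \<open>l i\<close> is \<open>W\<close>, and
  the \<open>v i\<close> are dual to them, so the quotient is F^I. The functionals are linear on the
  whole space, which spares membership conditions in computations.\<close>

locale dual_functionals =
  fixes V W :: "('k \<Rightarrow>\<^sub>0 'f::field) set" and I :: "'i set"
    and l :: "'i \<Rightarrow> ('k \<Rightarrow>\<^sub>0 'f) \<Rightarrow> 'f" and v :: "'i \<Rightarrow> ('k \<Rightarrow>\<^sub>0 'f)"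
  assumes subspace_V: "pm.subspace V" and finite_I: "finite I"
    and l_add: "l i (p + q) = l i p + l i q"
    and l_scale: "l i (pm_scale c p) = c * l i p"
    and v_in_V: "i \<in> I \<Longrightarrow> v i \<in> V"
    and l_v: "i \<in> I \<Longrightarrow> j \<in> I \<Longrightarrow> l i (v j) = (if i = j then 1 else 0)"
    and W_iff: "p \<in> V \<Longrightarrow> p \<in> W \<longleftrightarrow> (\<forall>i\<in>I. l i p = 0)"
begin

lemma l_diff: "l i (p - q) = l i p - l i q"
  using l_add[of i "p - q" q] by simp

lemma l_sum: "l i (sum f S) = (\<Sum>s\<in>S. l i (f s))"
proof (induction S rule: infinite_finite_induct)
qed (use l_scale[of i 0] in \<open>auto simp: l_add\<close>)

text \<open>The representative in the span of the \<open>v i\<close>. Congruence modulo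
  \<open>W\<close> becomes equality of projections, so ordinary linear algebra applies to an unknown
  quotient basis.\<close>

definition proj :: "('k \<Rightarrow>\<^sub>0 'f) \<Rightarrow> ('k \<Rightarrow>\<^sub>0 'f)" where
  "proj p = (\<Sum>i\<in>I. pm_scale (l i p) (v i))"

lemma l_proj: "i \<in> I \<Longrightarrow> l i (proj p) = l i p"
  by (simp add: proj_def l_sum l_scale l_v finite_I if_distrib[of "(*) _"] cong: if_cong)

lemma sum_in_V: "B \<subseteq> V \<Longrightarrow> (\<Sum>b\<in>B. pm_scale (c b) b) \<in> V"
  by (intro pm.subspace_sum pm.subspace_scale subspace_V) auto

lemma inj_v: "inj_on v I"
proof (rule inj_onI)
  fix i j assume "i \<in> I" "j \<in> I" "v i = v j"
  then show "i = j" using l_v[of i i] l_v[of i j] by (auto split: if_splits)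
qed

lemma diff_in_W_iff:
  "p \<in> V \<Longrightarrow> q \<in> V \<Longrightarrow> p - q \<in> W \<longleftrightarrow> (\<forall>i\<in>I. l i p = l i q)"
  by (simp add: W_iff pm.subspace_diff[OF subspace_V] l_diff)

lemma diff_in_W_iff_proj:
  "p \<in> V \<Longrightarrow> q \<in> V \<Longrightarrow> p - q \<in> W \<longleftrightarrow> proj p = proj q"
proof -
  assume "p \<in> V" "q \<in> V"
  moreover have "proj p = proj q" if "\<forall>i\<in>I. l i p = l i q"
    unfolding proj_def using that by (intro sum.cong) auto
  moreover have "\<forall>i\<in>I. l i p = l i q" if "proj p = proj q"
    using l_proj[of _ p] l_proj[of _ q] that by simp
  ultimately show ?thesis by (auto simp: diff_in_W_iff)
qed

lemma quot_basis_v: "quot_basis V W (v ` I)"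
  unfolding quot_basis_def
proof (intro conjI ballI)
  show "finite (v ` I)" "v ` I \<subseteq> V" using finite_I v_in_V by auto
  fix p assume p: "p \<in> V"
  have l_comb: "l i (\<Sum>b\<in>v ` I. pm_scale (c b) b) = c (v i)" if "i \<in> I" for i c
    using that by (simp add: l_sum l_scale sum.reindex[OF inj_v] l_v finite_I if_distrib[of "(*) _"] cong: if_cong)
  \<comment> \<open>Coordinates are indexed by basis vectors, so the functional belonging to
    \<open>b\<close> is found by inverting \<open>v\<close>.\<close>
  let ?c = "restrict (\<lambda>b. l (the_inv_into I v b) p) (v ` I)"
  have c: "?c (v i) = l i p" if "i \<in> I" for i
    using that by (simp add: the_inv_into_f_f[OF inj_v])
  show "\<exists>!c. c \<in> (v ` I \<rightarrow>\<^sub>E UNIV) \<and> p - (\<Sum>b\<in>v ` I. pm_scale (c b) b) \<in> W"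
  proof (rule ex1I[of _ ?c])
    show "?c \<in> (v ` I \<rightarrow>\<^sub>E UNIV) \<and> p - (\<Sum>b\<in>v ` I. pm_scale (?c b) b) \<in> W"
      using p v_in_V by (subst diff_in_W_iff) (auto intro!: sum_in_V simp: l_comb c simp del: restrict_apply)
  next
    fix d assume d: "d \<in> (v ` I \<rightarrow>\<^sub>E UNIV) \<and> p - (\<Sum>b\<in>v ` I. pm_scale (d b) b) \<in> W"
    then have "\<forall>i\<in>I. l i p = d (v i)"
      using p v_in_V by (subst (asm) diff_in_W_iff) (auto intro!: sum_in_V simp: l_comb)
    then show "d = ?c"
      using d c by (intro PiE_ext[of d "v ` I" "\<lambda>_. UNIV"]) auto
  qed
qed

lemma proj_comb: "proj (\<Sum>b\<in>B. pm_scale (c b) b) = (\<Sum>b\<in>B. pm_scale (c b) (proj b))"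
proof -
  have "proj (\<Sum>b\<in>B. pm_scale (c b) b) = (\<Sum>i\<in>I. \<Sum>b\<in>B. pm_scale (c b * l i b) (v i))"
    by (simp add: proj_def l_sum l_scale pm.scale_sum_left)
  also have "\<dots> = (\<Sum>b\<in>B. \<Sum>i\<in>I. pm_scale (c b * l i b) (v i))"
    by (rule sum.swap)
  finally show ?thesis by (simp add: proj_def pm.scale_sum_right)
qed

lemma proj_v: "i \<in> I \<Longrightarrow> proj (v i) = v i"
proof -
  assume "i \<in> I"
  then have "proj (v i) = (\<Sum>j\<in>I. if j = i then v j else 0)"
    unfolding proj_def by (intro sum.cong) (auto simp: l_v)
  then show ?thesis using \<open>i \<in> I\<close> finite_I by simp
qed

lemma independent_v: "pm.independent (v ` I)"
proof -
  have "c b = 0" if 0: "(\<Sum>b\<in>v ` I. pm_scale (c b) b) = 0" and b: "b \<in> v ` I" for c b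
  proof -
    obtain i where i: "i \<in> I" "b = v i" using b by auto
    have "l i (\<Sum>b\<in>v ` I. pm_scale (c b) b) = c b"
      using i by (simp add: l_sum l_scale sum.reindex[OF inj_v] l_v finite_I if_distrib[of "(*) _"] cong: if_cong)
    then show ?thesis using 0 l_scale[of i 0] by simp
  qed
  then show ?thesis
    unfolding pm.dependent_finite[OF finite_imageI[OF finite_I]] by blast
qed

text \<open>\<open>proj\<close> maps \<open>B\<close> bijectively onto a basis of the span of the
  \<open>v i\<close>: uniqueness of coordinates gives injectivity and independence, their existence
  gives spanning.\<close>

lemma card_quot_basis:
  assumes B: "quot_basis V W B"
  shows "card B = card I"
proof -
  have fin: "finite B" and BV: "B \<subseteq> V"
    and ex1: "\<And>p. p \<in> V \<Longrightarrow> \<exists>!c. c \<in> (B \<rightarrow>\<^sub>E UNIV) \<and> p - (\<Sum>b\<in>B. pm_scale (c b) b) \<in> W"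
    using B by (auto simp: quot_basis_def)
  have zero: "c b = 0" if "(\<Sum>b\<in>B. pm_scale (c b) (proj b)) = 0" "b \<in> B" for c b
  proof -
    have proj0: "proj 0 = 0" using proj_comb[of "\<lambda>_. 0" "{}"] by simp
    let ?P = "\<lambda>c. c \<in> (B \<rightarrow>\<^sub>E UNIV) \<and> 0 - (\<Sum>b\<in>B. pm_scale (c b) b) \<in> W"
    have P: "?P (restrict d B)" if "(\<Sum>b\<in>B. pm_scale (d b) (proj b)) = 0" for d
      using that BV by (subst diff_in_W_iff_proj)
        (auto simp: proj0 proj_comb pm.subspace_0[OF subspace_V] intro!: sum_in_V)
    \<comment> \<open>Both functions are coordinates of the vector 0, hence equal by
      uniqueness.\<close>
    have "restrict c B = restrict (\<lambda>_. 0) B"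
    proof (rule ex1E[OF ex1[OF pm.subspace_0[OF subspace_V]]])
      fix d assume "\<forall>d'. ?P d' \<longrightarrow> d' = d"
      then have "restrict c B = d" "restrict (\<lambda>_. 0) B = d"
        using P[OF that(1)] P[of "\<lambda>_. 0"] by simp_all
      then show ?thesis by simp
    qed
    then show ?thesis using that(2) by (metis restrict_apply')
  qed
  have inj: "inj_on proj B"
  proof (rule inj_onI, rule ccontr)
    fix b b' assume b: "b \<in> B" "b' \<in> B" "proj b = proj b'" "b \<noteq> b'"
    \<comment> \<open>Coefficients 1 at \<open>b\<close> and -1 at \<open>b'\<close> give a relation
      between the projections, against \<open>zero\<close>.\<close>
    have "(\<Sum>x\<in>B. pm_scale ((if x = b then 1 else 0) - (if x = b' then 1 else 0)) (proj x))
        = (\<Sum>x\<in>B. (if x = b then proj x else 0) - (if x = b' then proj x else 0))"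
      by (intro sum.cong) auto
    also have "\<dots> = 0" using b fin by (simp add: sum_subtractf)
    finally show False using zero[of _ b] b by fastforce
  qed
  have "pm.independent (proj ` B)"
  proof -
    have "c b = 0" if "(\<Sum>b\<in>proj ` B. pm_scale (c b) b) = 0" "b \<in> proj ` B" for c b
      using that zero[of "c \<circ> proj"] by (auto simp: sum.reindex[OF inj])
    then show ?thesis unfolding pm.dependent_finite[OF finite_imageI[OF fin]] by blast
  qed
  moreover have "pm.span (v ` I) \<subseteq> pm.span (proj ` B)"
  proof (rule pm.span_minimal)
    show "v ` I \<subseteq> pm.span (proj ` B)"
    proof
      fix p assume "p \<in> v ` I"
      then obtain i where i: "i \<in> I" "p = v i" by auto
      then obtain c where "p - (\<Sum>b\<in>B. pm_scale (c b) b) \<in> W"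
        using ex1 v_in_V by meson
      then have "p = (\<Sum>b\<in>B. pm_scale (c b) (proj b))"
        using i BV v_in_V by (subst (asm) diff_in_W_iff_proj) (auto intro!: sum_in_V simp: proj_comb proj_v)
      also have "\<dots> \<in> pm.span (proj ` B)"
        by (intro pm.span_sum pm.span_scale pm.span_base) auto
      finally show "p \<in> pm.span (proj ` B)" .
    qed
  qed auto
  moreover have "pm.span (proj ` B) \<subseteq> pm.span (v ` I)"

  proof (rule pm.span_minimal)
    have "proj p \<in> pm.span (v ` I)" for p
      unfolding proj_def by (intro pm.span_sum pm.span_scale pm.span_base) auto
    then show "proj ` B \<subseteq> pm.span (v ` I)" by auto
  qed auto
  ultimately have "card (proj ` B) = card (v ` I)"
    using independent_v by (metis pm.dim_eq_card_independent pm.dim_span set_eq_subset)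
  then show ?thesis by (simp add: card_image inj inj_v)
qed

lemma quot_dim_eq: "quot_dim V W = card I"
  unfolding quot_dim_def by (rule card_quot_basis, rule someI, rule quot_basis_v)

text \<open>Such an \<open>f\<close> induces the identity on the quotient: the coordinates of
  \<open>f b\<close> are those of \<open>b\<close>, so each basis vector contributes 1 to the
  trace.\<close>

lemma quot_trace_eq:
  assumes "\<And>p. p \<in> V \<Longrightarrow> f p \<in> V" "\<And>p i. p \<in> V \<Longrightarrow> i \<in> I \<Longrightarrow> l i (f p) = l i p"
  shows "quot_trace V W f = of_nat (card I)"
proof -
  define B where "B = (SOME B. quot_basis V W B)"
  have B: "quot_basis V W B" unfolding B_def using quot_basis_v by (rule someI)
  then have BV: "B \<subseteq> V" and fin: "finite B" by (auto simp: quot_basis_def)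
  have "quot_coords W B (f b) b = 1" if b: "b \<in> B" for b
  proof -
    let ?c = "restrict (\<lambda>x. if x = b then 1 else 0) B"
    let ?P = "\<lambda>c. c \<in> (B \<rightarrow>\<^sub>E UNIV) \<and> f b - (\<Sum>b\<in>B. pm_scale (c b) b) \<in> W"
    have "\<exists>!c. ?P c"
      using B assms(1) b BV unfolding quot_basis_def by blast
    moreover have "?P ?c"
    proof -
      have "(\<Sum>x\<in>B. pm_scale (?c x) x) = (\<Sum>x\<in>B. if x = b then x else 0)"
        by (intro sum.cong) auto
      also have "\<dots> = b" using b fin by simp
      finally show ?thesis using b BV assms by (auto simp: diff_in_W_iff)
    qed
    ultimately have "quot_coords W B (f b) = ?c"
      unfolding quot_coords_def by (rule the1_equality[where P = ?P])
    then show ?thesis using b by simp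
  qed
  then have "quot_trace V W f = of_nat (card B)"
    by (simp add: quot_trace_def Let_def flip: B_def)
  then show ?thesis using card_quot_basis[OF B] by simp
qed

end


section \<open>One-row shapes and trivial characters\<close>

lemma tableau_row_single: "tableau_row [n] i = (if i = 0 then {1..n} else {})"
proof (cases i)
  case 0
  have "\<exists>j. x = Suc j \<and> j < n" if "1 \<le> x" "x \<le> n" for x
    using that by (intro exI[of _ "x - 1"]) auto
  then show ?thesis using 0 by (auto simp: tableau_row_def tableau_entry_def)
qed (auto simp: tableau_row_def)

lemma tableau_col_single: "tableau_col [n] j = (if j < n then {Suc j} else {})"
  by (auto simp: tableau_col_def tableau_entry_def)

lemma row_stabilizer_single: "row_stabilizer [n] = {\<sigma>. \<sigma> permutes {1..n}}"
  by (simp add: row_stabilizer_def tableau_row_single permutes_image cong: conj_cong)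

text \<open>Every column of a one-row tableau has a single cell.\<close>

lemma col_stabilizer_single: "col_stabilizer [n] = {id}"
proof -
  have "\<sigma> = id" if \<sigma>: "\<sigma> permutes {1..n}" "\<forall>j. \<sigma> ` tableau_col [n] j = tableau_col [n] j" for \<sigma>
  proof
    fix x
    show "\<sigma> x = id x"
    proof (cases "x \<in> {1..n}")
      case True
      \<comment> \<open>Columns are counted from 0, so the entry \<open>x\<close> stands in column
        \<open>x - 1\<close>.\<close>
      then show ?thesis using \<sigma>(2)[rule_format, of "x - 1"] by (auto simp: tableau_col_single split: if_splits)
    qed (use \<sigma>(1) in \<open>auto simp: permutes_def\<close>)
  qed
  then show ?thesis by (auto simp: col_stabilizer_def permutes_id)
qed

lemma young_symmetrizer_single:
  "young_symmetrizer [n] = (\<Sum>\<sigma> | \<sigma> permutes {1..n}. Poly_Mapping.single \<sigma> 1)"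
  by (simp add: young_symmetrizer_def row_stabilizer_single col_stabilizer_single)

text \<open>The symmetrizer of one row is the sum of the whole symmetric group, whose terms are
  merely permuted by left multiplication.\<close>

lemma pm_rename_young_symmetrizer:
  assumes "\<sigma> permutes {1..n}"
  shows "pm_rename ((\<circ>) \<sigma>) (young_symmetrizer [n]) = young_symmetrizer [n]"
proof -
  have bij: "bij_betw ((\<circ>) \<sigma>) {\<tau>. \<tau> permutes {1..n}} {\<tau>. \<tau> permutes {1..n}}"

    by (rule bij_betwI[of _ _ _ "(\<circ>) (inv_into UNIV \<sigma>)"])
      (use assms in \<open>auto intro!: permutes_compose permutes_inv simp: o_assoc permutes_inv_o\<close>)
  show ?thesis
    unfolding young_symmetrizer_single additive.sum[OF additive_pm_rename] pm_rename_single
    by (rule sum.reindex_bij_betw[OF bij])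
qed

lemma specht_module_single:
  "specht_module [n] = (pm.span {young_symmetrizer [n]} :: (_ \<Rightarrow>\<^sub>0 'f::field) set)"
proof -
  have "{pm_rename ((\<circ>) \<sigma>) (young_symmetrizer [n] :: _ \<Rightarrow>\<^sub>0 'f) | \<sigma>. \<sigma> permutes {1..n}} = {young_symmetrizer [n]}"
    by (auto simp: pm_rename_young_symmetrizer
      intro!: exI[of _ id] permutes_id pm_rename_young_symmetrizer[OF permutes_id, symmetric])
  then show ?thesis by (simp add: specht_module_def del: One_nat_def)
qed

lemma sym_char_single:
  assumes "\<sigma> permutes {1..n}"
  shows "sym_char [n] \<sigma> = (1::'f::field)"
proof -
  let ?y = "young_symmetrizer [n] :: (nat \<Rightarrow> nat) \<Rightarrow>\<^sub>0 'f"
  have y: "Poly_Mapping.lookup ?y id = 1"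
    by (simp add: young_symmetrizer_single lookup_sum lookup_single when_def finite_permutations permutes_id)
  have V: "specht_module [n] = {pm_scale c ?y | c. True}"
    by (auto simp: specht_module_single pm.span_singleton)
  have "?y \<noteq> 0" using y by auto
  \<comment> \<open>The module is a line; the coefficient at \<open>id\<close> is a coordinate on it
    because it equals 1 on the generator.\<close>
  interpret dual_functionals "specht_module [n]" "{0}" "{()}" "\<lambda>_ p. Poly_Mapping.lookup p id" "\<lambda>_. ?y"
  proof
    show "pm.subspace (specht_module [n])" by (simp add: specht_module_single)
    show "?y \<in> specht_module [n]" by (simp add: specht_module_single pm.span_base)
  qed (use \<open>?y \<noteq> 0\<close> in \<open>auto simp: lookup_add y V\<close>)
  have "quot_trace (specht_module [n]) {0} (pm_rename ((\<circ>) \<sigma>)) = (of_nat (card {()}) :: 'f)"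
    by (rule quot_trace_eq) (auto simp: V pm_rename_scale pm_rename_young_symmetrizer[OF assms])
  then show ?thesis by (simp add: sym_char_def)
qed

text \<open>Types without variables carry the empty list in \<open>no_parts\<close>, where
  \<open>sym_char_single\<close> would have \<open>[0]\<close>; both give the same empty
  tableau.\<close>

lemma sym_char_Nil:
  assumes "\<sigma> permutes {}"
  shows "sym_char [] \<sigma> = (1::'f::field)"
proof -
  have "tableau_row [] = tableau_row [0]" "tableau_col [] = tableau_col [0]"
    by (auto simp: tableau_row_def tableau_col_def fun_eq_iff)
  then have "row_stabilizer [] = row_stabilizer [0]" "col_stabilizer [] = col_stabilizer [0]"
    by (auto simp: row_stabilizer_def col_stabilizer_def)
  then have "specht_module [] = (specht_module [0] :: ((nat \<Rightarrow> nat) \<Rightarrow>\<^sub>0 'f) set)"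
    by (simp add: specht_module_def young_symmetrizer_def)
  then have "sym_char [] \<sigma> = (sym_char [0] \<sigma> :: 'f)" by (simp add: sym_char_def)
  then show ?thesis using assms sym_char_single[of \<sigma> 0] by simp
qed

section \<open>Irreducible characters and their values at the unit\<close>

lemma irreducible_character_one:
  assumes "group H" "\<psi> \<in> irreducible_characters H"
  shows "\<exists>d>0. \<psi> \<one>\<^bsub>H\<^esub> = (of_nat d :: 'f::field)"
proof -
  obtain d and \<rho> :: "_ \<Rightarrow> 'f mat" where \<rho>: "irreducible_rep H d \<rho>" "\<psi> = (\<lambda>x\<in>carrier H. mat_trace (\<rho> x))"
    using assms(2) by (auto simp: irreducible_characters_def)
  interpret H: group H by fact
  interpret R: ring "ring_mat TYPE('f) d ()" by (rule ring_mat)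
  have "\<rho> \<in> hom H (units_of (ring_mat TYPE('f) d ()))" using \<rho>(1) by (simp add: irreducible_rep_def)
  then have "\<rho> \<one>\<^bsub>H\<^esub> = \<one>\<^bsub>units_of (ring_mat TYPE('f) d ())\<^esub>"
    by (rule hom_one) (simp_all add: assms(1) R.units_group)
  then have "\<rho> \<one>\<^bsub>H\<^esub> = 1\<^sub>m d" by (simp add: units_of_one ring_mat_def)
  then have "\<psi> \<one>\<^bsub>H\<^esub> = of_nat d" using \<rho>(2) by (simp add: mat_trace_def)
  then show ?thesis using \<rho>(1) by (auto simp: irreducible_rep_def)
qed

text \<open>Degree 1 forces irreducibility: a nonzero vector of F^1 spans the whole space.\<close>

lemma trivial_irreducible_character:
  assumes "group H"
  shows "(\<lambda>x\<in>carrier H. 1) \<in> (irreducible_characters H :: ('h \<Rightarrow> 'f::field) set)"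
proof -
  let ?\<rho> = "\<lambda>_. 1\<^sub>m 1 :: 'f mat"
  interpret R: ring "ring_mat TYPE('f) 1 ()" by (rule ring_mat)
  have one: "\<one>\<^bsub>ring_mat TYPE('f) 1 ()\<^esub> = 1\<^sub>m 1" by (simp add: ring_mat_def)
  have "irreducible_rep H 1 ?\<rho>"
    unfolding irreducible_rep_def
  proof (intro conjI allI impI)
    show "?\<rho> \<in> hom H (units_of (ring_mat TYPE('f) 1 ()))"
      using R.Units_one_closed R.l_one[OF R.one_closed] one
      by (intro homI) (simp_all add: units_of_carrier units_of_mult)
    fix U :: "'f vec set"
    assume U: "U \<subseteq> carrier_vec 1 \<and> 0\<^sub>v 1 \<in> U \<and> (\<forall>u\<in>U. \<forall>v\<in>U. u + v \<in> U) \<and>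
      (\<forall>c. \<forall>u\<in>U. c \<cdot>\<^sub>v u \<in> U) \<and> (\<forall>x\<in>carrier H. \<forall>u\<in>U. 1\<^sub>m 1 *\<^sub>v u \<in> U)"
    show "U = {0\<^sub>v 1} \<or> U = carrier_vec 1"
    proof (cases "U \<subseteq> {0\<^sub>v 1}")
      case False
      then obtain u where u: "u \<in> U" "u \<noteq> 0\<^sub>v 1" by auto
      then have d: "dim_vec u = 1" using U by auto
      then have "u $ 0 \<noteq> 0" using u(2) by (auto simp: vec_eq_iff)
      have "w \<in> U" if "w \<in> carrier_vec 1" for w
      proof -
        have "w = (w $ 0 / u $ 0) \<cdot>\<^sub>v u"
          using that d \<open>u $ 0 \<noteq> 0\<close> by (auto simp: vec_eq_iff)
        then show ?thesis using U u(1) by metis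
      qed
      then show ?thesis using U by auto
    qed (use U in auto)
  qed simp
  moreover have "mat_trace (1\<^sub>m 1 :: 'f mat) = 1" by (simp add: mat_trace_def)
  ultimately show ?thesis
    unfolding irreducible_characters_def mem_Collect_eq by (intro exI[of _ ?\<rho>] conjI) auto
qed

text \<open>\<open>m\<close> is the sum of the degrees, each of them at least 1, so it bounds the
  number of constituents.\<close>

lemma sum_list_irreducible_characters_one:
  assumes "group H" "set \<psi>s \<subseteq> (irreducible_characters H :: ('h \<Rightarrow> 'f::field) set)"
  shows "\<exists>m\<ge>length \<psi>s. (m = 0 \<longleftrightarrow> \<psi>s = []) \<and> (\<Sum>\<psi>\<leftarrow>\<psi>s. \<psi> \<one>\<^bsub>H\<^esub>) = of_nat m"
  using assms(2)
proof (induction \<psi>s)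
  case (Cons \<psi> \<psi>s)
  then obtain m where "m \<ge> length \<psi>s" "(\<Sum>\<psi>\<leftarrow>\<psi>s. \<psi> \<one>\<^bsub>H\<^esub>) = of_nat m" by auto
  moreover obtain d where "d > 0" "\<psi> \<one>\<^bsub>H\<^esub> = of_nat d"
    using irreducible_character_one[OF assms(1)] Cons.prems by auto
  ultimately show ?case by (intro exI[of _ "d + m"]) auto
qed auto

text \<open>Comparing values at the unit suffices here: there the irreducible characters take the
  values \<open>1, 2, \<dots>\<close>.\<close>

lemma num_constituents_trivial:
  fixes \<chi> :: "'h \<Rightarrow> 'f::field_char_0"
  assumes H: "group H" and \<chi>: "\<forall>x\<in>carrier H. \<chi> x = of_nat m" and "m \<le> 1"
  shows "num_constituents H \<chi> = m"
  unfolding num_constituents_def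
proof (rule the_equality)
  interpret H: group H by fact
  show "\<exists>\<psi>s. length \<psi>s = m \<and> set \<psi>s \<subseteq> irreducible_characters H \<and>
     (\<forall>x\<in>carrier H. \<chi> x = (\<Sum>\<psi>\<leftarrow>\<psi>s. \<psi> x))"
    using \<chi> trivial_irreducible_character[OF H, where ?'f = 'f] \<open>m \<le> 1\<close>
    by (intro exI[of _ "replicate m (\<lambda>x\<in>carrier H. 1)"]) (auto simp: sum_list_replicate)
  fix k assume "\<exists>\<psi>s. length \<psi>s = k \<and> set \<psi>s \<subseteq> irreducible_characters H \<and>
     (\<forall>x\<in>carrier H. \<chi> x = (\<Sum>\<psi>\<leftarrow>\<psi>s. \<psi> x))"
  then obtain \<psi>s where \<psi>s: "length \<psi>s = k" "set \<psi>s \<subseteq> irreducible_characters H"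
     "\<forall>x\<in>carrier H. \<chi> x = (\<Sum>\<psi>\<leftarrow>\<psi>s. \<psi> x)" by auto
  obtain m' where m': "m' \<ge> length \<psi>s" "m' = 0 \<longleftrightarrow> \<psi>s = []" "(\<Sum>\<psi>\<leftarrow>\<psi>s. \<psi> \<one>\<^bsub>H\<^esub>) = of_nat m'"
    using sum_list_irreducible_characters_one[OF H \<psi>s(2)] by blast
  have "of_nat m = (of_nat m' :: 'f)" using \<psi>s(3) \<chi> m'(3) by (metis H.one_closed)
  then have "m = m'" by simp
  then show "k = m" using m'(1,2) \<psi>s(1) \<open>m \<le> 1\<close> by (cases m; cases \<psi>s) auto
qed


section \<open>Independence of monomial functions\<close>

text \<open>Dedekind's argument for the independence of multiplicative functions, here indexed by
  \<open>i\<close>: a relation is shortened by eliminating one index.\<close>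

lemma characters_independent:
  fixes \<chi> :: "'i \<Rightarrow> 'x \<Rightarrow> 'f::idom"
  assumes "finite S"
    and mult: "\<And>i x y. \<chi> i (m x y) = \<chi> i x * \<chi> i y"
    and nz: "\<And>i. \<exists>x. \<chi> i x \<noteq> 0"
    and inj: "\<And>i j. i \<noteq> j \<Longrightarrow> \<exists>x. \<chi> i x \<noteq> \<chi> j x"
    and zero: "\<And>x. (\<Sum>i\<in>S. c i * \<chi> i x) = 0" and "i \<in> S"
  shows "c i = 0"
  using \<open>finite S\<close> zero \<open>i \<in> S\<close>
proof (induction S arbitrary: c i rule: finite_induct)
  case (insert j S)
  have "c k = 0" if k: "k \<in> S" for k
  proof -
    obtain y where y: "\<chi> k y \<noteq> \<chi> j y" using inj[of k j] k insert.hyps by auto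
    \<comment> \<open>The relation at \<open>m x y\<close> minus \<open>\<chi> j y\<close> times the
      relation at \<open>x\<close>. The term of \<open>j\<close> cancels, while the coefficient at
      \<open>k\<close> is multiplied by the nonzero \<open>\<chi> k y - \<chi> j y\<close>.\<close>
    have "(\<Sum>i\<in>S. (c i * (\<chi> i y - \<chi> j y)) * \<chi> i x) = 0" for x
    proof -
      have "(\<Sum>i\<in>S. (c i * (\<chi> i y - \<chi> j y)) * \<chi> i x) =
        (\<Sum>i\<in>insert j S. c i * \<chi> i (m x y)) - \<chi> j y * (\<Sum>i\<in>insert j S. c i * \<chi> i x)"
        using insert.hyps by (simp add: mult algebra_simps sum_subtractf sum_distrib_left)
      then show ?thesis by (simp only: insert.prems(1)) simp
    qed
    from insert.IH[OF this k] show ?thesis using y by simp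
  qed
  moreover obtain x where "\<chi> j x \<noteq> 0" using nz by auto
  ultimately have "c j = 0"
    using insert.hyps insert.prems(1)[of x] by simp
  then show ?case using \<open>\<And>k. k \<in> S \<Longrightarrow> c k = 0\<close> insert.prems(2) by auto
qed simp

lemma prod_mset_indicator_power:
  "prod_mset (image_mset (\<lambda>y. if y = x then a else 1) M) = (a::'f::comm_monoid_mult) ^ count M x"
  by (induction M) auto

text \<open>A monomial is multiplicative in the assignment \<open>a\<close> under pointwise
  products. Two monomials are separated by giving the value 2 to a variable where their exponents
  differ, since the powers of 2 are distinct in characteristic zero.\<close>

lemma monomials_independent:
  fixes c :: "'x multiset \<Rightarrow> 'f::field_char_0"
  assumes "finite S" "\<And>a. (\<Sum>M\<in>S. c M * prod_mset (image_mset a M)) = 0" "M \<in> S"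
  shows "c M = 0"
proof (rule characters_independent[where S = S and c = c and i = M
      and \<chi> = "\<lambda>M a. prod_mset (image_mset a M)" and m = "\<lambda>a b x. a x * b x"])
  fix M N :: "'x multiset"
  show "\<exists>a. prod_mset (image_mset a M) \<noteq> (0::'f)"
    by (rule exI[of _ "\<lambda>_. 1"]) simp
  show "\<exists>a. prod_mset (image_mset a M) \<noteq> (prod_mset (image_mset a N) :: 'f)" if neq: "M \<noteq> N"
  proof -
    obtain x where x: "count M x \<noteq> count N x" using neq by (auto simp: multiset_eq_iff)
    have "(2::'f) ^ m = 2 ^ n \<longleftrightarrow> m = n" for m n
      using of_nat_eq_iff[of "2 ^ m" "2 ^ n", where 'a = 'f] by (simp del: of_nat_eq_iff)
    then show ?thesis
      using x by (intro exI[of _ "\<lambda>y. if y = x then 2 else 1"]) (simp add: prod_mset_indicator_power)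
  qed
qed (use assms in \<open>simp_all add: prod_mset.distrib\<close>)


section \<open>The ring \<open>F[t]/(t\<^sup>3)\<close>\<close>

text \<open>\<open>Trunc a b c\<close> is \<open>a + b t + c t\<^sup>2\<close>; the algebras of the theorem are this ring in matrix
  disguise.\<close>

datatype 'a trunc = Trunc (tr0: 'a) (tr1: 'a) (tr2: 'a)

instantiation trunc :: (comm_ring_1) comm_ring_1
begin
definition "zero_trunc = Trunc 0 0 0"
definition "one_trunc = Trunc 1 0 0"
definition "plus_trunc x y = Trunc (tr0 x + tr0 y) (tr1 x + tr1 y) (tr2 x + tr2 y)"
definition "minus_trunc x y = Trunc (tr0 x - tr0 y) (tr1 x - tr1 y) (tr2 x - tr2 y)"
definition "uminus_trunc x = Trunc (- tr0 x) (- tr1 x) (- tr2 x)"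
definition "times_trunc x y = Trunc (tr0 x * tr0 y) (tr0 x * tr1 y + tr1 x * tr0 y)
  (tr0 x * tr2 y + tr1 x * tr1 y + tr2 x * tr0 y)"
instance
  by standard (simp_all add: zero_trunc_def one_trunc_def plus_trunc_def minus_trunc_def
      uminus_trunc_def times_trunc_def algebra_simps)
end

lemmas trunc_defs = zero_trunc_def one_trunc_def plus_trunc_def minus_trunc_def
  uminus_trunc_def times_trunc_def

text \<open>This is a t^k, every exponent above 2 giving 0; the unrestricted exponent makes
  \<open>tmon_mult\<close> hold in all cases.\<close>

definition tmon :: "nat \<Rightarrow> 'a \<Rightarrow> 'a::comm_ring_1 trunc" where
  "tmon k a = Trunc (if k = 0 then a else 0) (if k = 1 then a else 0) (if k = 2 then a else 0)"

lemma tmon_mult: "tmon k a * tmon l b = tmon (k + l) (a * b)"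
proof (cases "k + l \<le> 2")
  case True
  then have "k \<in> {0, 1, 2}" "l \<in> {0, 1, 2}" by auto
  then show ?thesis by (auto simp: tmon_def trunc_defs)
qed (auto simp: tmon_def trunc_defs)

lemma tmon_add: "tmon k (a + b) = tmon k a + tmon k b"
  by (simp add: tmon_def trunc_defs)

lemma tmon_0 [simp]: "tmon k 0 = 0"
  by (simp add: tmon_def trunc_defs)

lemma tmon_eq_0_iff: "tmon k a = 0 \<longleftrightarrow> a = 0 \<or> k > 2"
  by (auto simp: tmon_def trunc_defs)

lemma tmon_0_1 [simp]: "tmon 0 1 = 1"
  by (simp add: tmon_def trunc_defs)

lemma additive_tmon: "Modules.additive (tmon k)"
  by (simp add: additive_def tmon_add)

lemma tmon_sum: "tmon k (sum f S) = (\<Sum>s\<in>S. tmon k (f s))"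
  by (rule additive.sum[OF additive_tmon])

definition tcoef :: "nat \<Rightarrow> 'a::comm_ring_1 trunc \<Rightarrow> 'a" where
  "tcoef k x = (if k = 0 then tr0 x else if k = 1 then tr1 x else tr2 x)"

lemma tcoef_tmon: "k \<le> 2 \<Longrightarrow> tcoef k (tmon l a) = (if l = k then a else 0)"
  by (auto simp: tcoef_def tmon_def)

lemma tcoef_sum: "tcoef k (sum f S) = (\<Sum>s\<in>S. tcoef k (f s))"
  by (rule additive.sum) (simp add: additive_def tcoef_def plus_trunc_def)

text \<open>The involution t -> \<open>\<epsilon>\<close> t: the identity for
  \<open>\<epsilon> = 1\<close>, that of \<open>C3_star\<close> for
  \<open>\<epsilon> = - 1\<close>.\<close>

definition twist :: "'a \<Rightarrow> 'a::comm_ring_1 trunc \<Rightarrow> 'a trunc" where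
  "twist \<epsilon> x = Trunc (tr0 x) (\<epsilon> * tr1 x) (tr2 x)"

lemma twist_tmon: "\<epsilon> * \<epsilon> = 1 \<Longrightarrow> twist \<epsilon> (tmon k a) = tmon k (\<epsilon> ^ k * a)"
  by (auto simp: twist_def tmon_def power2_eq_square)

lemma additive_twist: "Modules.additive (twist \<epsilon>)"
  by (simp add: additive_def twist_def plus_trunc_def algebra_simps)

definition trunc_mat :: "'a::field trunc \<Rightarrow> 'a mat" where
  "trunc_mat x = c3 (tr0 x) (tr1 x) (tr2 x)"

lemma trunc_mat_mult: "trunc_mat x * trunc_mat y = trunc_mat (x * y)"
  by (simp add: trunc_mat_def c3_ops times_trunc_def)

lemma trunc_mat_smult: "c \<cdot>\<^sub>m trunc_mat x = trunc_mat (tmon 0 c * x)"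
  by (simp add: trunc_mat_def c3_ops times_trunc_def tmon_def)

lemma trunc_mat_eq_iff [simp]: "trunc_mat x = trunc_mat y \<longleftrightarrow> x = y"
  by (cases x; cases y) (simp add: trunc_mat_def)

lemma finsum_trunc_mat:
  assumes "finite S"
  shows "finsum (C3_with st G g) (\<lambda>s. trunc_mat (f s)) S = trunc_mat (sum f S)"
proof -
  have "tr0 (sum f S) = (\<Sum>s\<in>S. tr0 (f s))" "tr1 (sum f S) = (\<Sum>s\<in>S. tr1 (f s))"
    "tr2 (sum f S) = (\<Sum>s\<in>S. tr2 (f s))"
    using tcoef_sum[of 0 f S] tcoef_sum[of 1 f S] tcoef_sum[of 2 f S] by (simp_all add: tcoef_def)
  then show ?thesis by (simp add: trunc_mat_def finsum_C3[OF assms])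
qed


section \<open>Evaluation of noncommutative polynomials\<close>

lemma single_mult_single:
  "Poly_Mapping.single u c * Poly_Mapping.single v d = Poly_Mapping.single (u @ v) (c * d)"
  by (simp add: mult_single plus_list_def)

lemma one_pm_list: "(1 :: 'a list \<Rightarrow>\<^sub>0 'f::field) = Poly_Mapping.single [] 1"
  by (metis single_one zero_list_def)

text \<open>Used twice: with values in the truncated ring for evaluations, and with values in a free
  algebra for substitutions (\<open>subst_poly\<close>).\<close>

definition pm_eval :: "('f::field \<Rightarrow> 'r::ring_1) \<Rightarrow> ('x \<Rightarrow> 'r) \<Rightarrow> ('x list \<Rightarrow>\<^sub>0 'f) \<Rightarrow> 'r" where
  "pm_eval \<iota> \<theta> = pm_extend (\<lambda>w c. \<iota> c * prod_list (map \<theta> w))"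

locale central_embedding =
  fixes \<iota> :: "'f::field \<Rightarrow> 'r::ring_1"
  assumes emb_add: "\<iota> (c + d) = \<iota> c + \<iota> d" and emb_1: "\<iota> 1 = 1"
    and emb_mult: "\<iota> (c * d) = \<iota> c * \<iota> d" and emb_central: "\<iota> c * r = r * \<iota> c"
begin

lemma emb_0 [simp]: "\<iota> 0 = 0"
  using emb_add[of 0 0] by simp

lemma additive_pm_eval: "Modules.additive (pm_eval \<iota> \<theta>)"
  unfolding pm_eval_def by (intro additive_pm_extend) (simp add: additive_def emb_add distrib_right)

lemma pm_eval_single: "pm_eval \<iota> \<theta> (Poly_Mapping.single w c) = \<iota> c * prod_list (map \<theta> w)"
  by (simp add: pm_eval_def pm_extend_single)

lemma pm_eval_1: "pm_eval \<iota> \<theta> 1 = 1"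
  by (simp add: one_pm_list pm_eval_single emb_1)

text \<open>Words multiply by concatenation; centrality of the embedded scalars lets the coefficient
  of the second factor pass the first word.\<close>

lemma pm_eval_mult:
  fixes p q :: "'b list \<Rightarrow>\<^sub>0 'f"
  shows "pm_eval \<iota> \<theta> (p * q) = pm_eval \<iota> \<theta> p * pm_eval \<iota> \<theta> q"
proof (rule additive_pm_eq[of "\<lambda>p. pm_eval \<iota> \<theta> (p * q)" "\<lambda>p. pm_eval \<iota> \<theta> p * pm_eval \<iota> \<theta> q"])
  note add = additive.add[OF additive_pm_eval]
  fix u :: "'b list" and c :: 'f
  let ?s = "Poly_Mapping.single u c"
  show "pm_eval \<iota> \<theta> (?s * q) = pm_eval \<iota> \<theta> ?s * pm_eval \<iota> \<theta> q"
  proof (rule additive_pm_eq[of "\<lambda>q. pm_eval \<iota> \<theta> (?s * q)" "\<lambda>q. pm_eval \<iota> \<theta> ?s * pm_eval \<iota> \<theta> q"])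
    fix v d
    show "pm_eval \<iota> \<theta> (?s * Poly_Mapping.single v d) = pm_eval \<iota> \<theta> ?s * pm_eval \<iota> \<theta> (Poly_Mapping.single v d)"
    proof -
      let ?U = "prod_list (map \<theta> u)" and ?V = "prod_list (map \<theta> v)"
      have "pm_eval \<iota> \<theta> (?s * Poly_Mapping.single v d) = \<iota> c * (\<iota> d * ?U) * ?V"
        by (simp add: single_mult_single pm_eval_single emb_mult mult.assoc)
      also have "\<dots> = \<iota> c * (?U * \<iota> d) * ?V" by (subst emb_central[of d]) (rule refl)
      finally show ?thesis by (simp add: pm_eval_single mult.assoc)
    qed
  qed (simp_all add: additive_def add algebra_simps)
qed (simp_all add: additive_def additive.add[OF additive_pm_eval] algebra_simps)

end

interpretation tmon_embedding: central_embedding "tmon 0 :: 'f::field \<Rightarrow> 'f trunc"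
  by standard (simp_all add: tmon_add tmon_mult mult.commute)

lemma single_Nil_mult: "Poly_Mapping.single [] c * p = pm_scale c (p :: 'x list \<Rightarrow>\<^sub>0 'f::field)"
  by (rule additive_pm_eq[of "\<lambda>p. Poly_Mapping.single [] c * p" "pm_scale c"])
    (simp_all add: additive_def algebra_simps pm.scale_right_distrib single_mult_single pm_scale_single)

lemma mult_single_Nil: "p * Poly_Mapping.single [] c = pm_scale c (p :: 'x list \<Rightarrow>\<^sub>0 'f::field)"
  by (rule additive_pm_eq[of "\<lambda>p. p * Poly_Mapping.single [] c" "pm_scale c"])
    (simp_all add: additive_def algebra_simps pm.scale_right_distrib single_mult_single pm_scale_single
      mult.commute)

interpretation single_embedding:
  central_embedding "Poly_Mapping.single [] :: 'f::field \<Rightarrow> 'x list \<Rightarrow>\<^sub>0 'f"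
  by standard (simp_all add: single_add one_pm_list single_Nil_mult mult_single_Nil pm_scale_single mult.commute)

lemma pm_scale_mult_scale:
  "pm_scale a p * pm_scale b q = pm_scale (a * b) (p * q :: 'x list \<Rightarrow>\<^sub>0 'f::field)"
proof -
  let ?s = "Poly_Mapping.single []"
  have "pm_scale a p * pm_scale b q = (?s a * p) * (?s b * q)"
    by (simp only: single_Nil_mult)
  also have "\<dots> = ?s a * (p * ?s b) * q"
    by (simp only: mult.assoc)
  also have "\<dots> = ?s a * (?s b * p) * q"
    by (simp only: single_Nil_mult mult_single_Nil)
  also have "\<dots> = ?s (a * b) * (p * q)"
    by (simp only: mult.assoc[symmetric] single_mult_single append_Nil)
  finally show ?thesis by (simp only: single_Nil_mult)
qed

definition subst_poly :: "('x \<Rightarrow> 'y list \<Rightarrow>\<^sub>0 'f::field) \<Rightarrow> ('x list \<Rightarrow>\<^sub>0 'f) \<Rightarrow> ('y list \<Rightarrow>\<^sub>0 'f)" where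
  "subst_poly = pm_eval (Poly_Mapping.single [])"

lemmas additive_subst_poly = single_embedding.additive_pm_eval[folded subst_poly_def]
lemmas subst_poly_single = single_embedding.pm_eval_single[folded subst_poly_def]
lemmas subst_poly_1 = single_embedding.pm_eval_1[folded subst_poly_def]
lemmas subst_poly_mult = single_embedding.pm_eval_mult[folded subst_poly_def]

lemma subst_poly_scale: "subst_poly \<theta> (pm_scale c p) = pm_scale c (subst_poly \<theta> p)"
  by (simp add: subst_poly_mult subst_poly_single flip: single_Nil_mult)


section \<open>The free algebra\<close>

lemma free_gs_algebra_simps [simp]:
  "carrier (free_gs_algebra G) = {p. \<forall>w\<in>Poly_Mapping.keys p. set w \<subseteq> vars G}"
  "monoid.mult (free_gs_algebra G) = (*)" "one (free_gs_algebra G) = 1"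
  "zero (free_gs_algebra G) = 0" "add (free_gs_algebra G) = (+)"
  "smult (free_gs_algebra G) = pm_scale"
  "homog (free_gs_algebra G) = (\<lambda>s. {p. \<forall>w\<in>Poly_Mapping.keys p. set w \<subseteq> vars G \<and> word_deg G w = s})"
  "star (free_gs_algebra G) = free_star"
  by (simp_all add: free_gs_algebra_def)

lemma keys_pm_scale_subset: "Poly_Mapping.keys (pm_scale c p) \<subseteq> Poly_Mapping.keys p"
  by (auto simp: in_keys_iff)

lemma keys_uminus: "Poly_Mapping.keys (- p) = Poly_Mapping.keys (p :: _ \<Rightarrow>\<^sub>0 'f::field)"
  by (auto simp: in_keys_iff)

lemma in_keys_mult_words:
  assumes "w \<in> Poly_Mapping.keys (p * q)"
  obtains u v where "w = u @ v" "u \<in> Poly_Mapping.keys p" "v \<in> Poly_Mapping.keys q"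
  using assms keys_mult[of p q] by (auto simp: plus_list_def)

lemma free_carrier_mult:
  "p \<in> carrier (free_gs_algebra G) \<Longrightarrow> q \<in> carrier (free_gs_algebra G) \<Longrightarrow> p * q \<in> carrier (free_gs_algebra G)"
  by (fastforce elim!: in_keys_mult_words)

lemma free_carrier_add:
  "p \<in> carrier (free_gs_algebra G) \<Longrightarrow> q \<in> carrier (free_gs_algebra G) \<Longrightarrow> p + q \<in> carrier (free_gs_algebra G)"
  using keys_add[of p q] by auto

lemma free_carrier_sum:
  "(\<And>i. i \<in> S \<Longrightarrow> f i \<in> carrier (free_gs_algebra G)) \<Longrightarrow> sum f S \<in> carrier (free_gs_algebra G)"
  by (induction S rule: infinite_finite_induct)
    (use free_carrier_add[where G = G] in \<open>auto simp del: free_gs_algebra_simps(1)\<close>, auto)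

lemma free_carrier_single:
  "set w \<subseteq> vars G \<Longrightarrow> Poly_Mapping.single w c \<in> carrier (free_gs_algebra G)"
  by auto

lemma free_homog_subset: "homog (free_gs_algebra G) s \<subseteq> carrier (free_gs_algebra G)"
  by auto

lemma ring_free: "ring (free_gs_algebra G :: ('f::field, ('g, 'f) ncpoly, 'g) gs_algebra)"
proof (rule ringI)
  let ?R = "free_gs_algebra G :: ('f, ('g, 'f) ncpoly, 'g) gs_algebra"
  show "abelian_group ?R"
  proof (rule abelian_groupI)
    fix x assume "x \<in> carrier ?R"
    then show "\<exists>y\<in>carrier ?R. y \<oplus>\<^bsub>?R\<^esub> x = \<zero>\<^bsub>?R\<^esub>"
      by (intro bexI[of _ "- x"]) (auto simp: keys_uminus)
  next
    fix x y assume "x \<in> carrier ?R" "y \<in> carrier ?R"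
    then show "x \<oplus>\<^bsub>?R\<^esub> y \<in> carrier ?R" using free_carrier_add by simp
  qed (simp_all add: algebra_simps)
  show "Group.monoid ?R"
  proof (rule monoidI)
    fix x y assume "x \<in> carrier ?R" "y \<in> carrier ?R"
    then show "x \<otimes>\<^bsub>?R\<^esub> y \<in> carrier ?R" using free_carrier_mult by simp
  qed (simp_all add: mult.assoc zero_list_def)
qed (simp_all add: algebra_simps)

lemma free_minus:
  assumes "p \<in> carrier (free_gs_algebra G)"
  shows "\<ominus>\<^bsub>free_gs_algebra G\<^esub> p = - (p :: ('g, 'f::field) ncpoly)"
  by (rule abelian_group.minus_equality[OF ring.is_abelian_group[OF ring_free]])
    (use assms in \<open>auto simp: keys_uminus\<close>)

lemma signed_homog_free:
  "signed_homog (free_gs_algebra G) s d =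
    {p \<in> homog (free_gs_algebra G) s. free_star p = (if d = Sym then p else - (p :: ('g, 'f::field) ncpoly))}"
proof (cases d)
  case Skew
  have "\<ominus>\<^bsub>free_gs_algebra G\<^esub> p = - p" if "p \<in> homog (free_gs_algebra G) s" for p :: "('g, 'f) ncpoly"
    using that free_homog_subset by (intro free_minus) auto
  then show ?thesis using Skew by auto
qed auto

lemma free_star_pm_extend:
  "free_star = pm_extend (\<lambda>w c. Poly_Mapping.single (rev w) (word_sign w * c))"
  by (simp add: fun_eq_iff free_star_def pm_extend_def)

lemma additive_free_star: "Modules.additive (free_star :: ('g, 'f::field) ncpoly \<Rightarrow> _)"
  unfolding free_star_pm_extend
  by (intro additive_pm_extend) (simp add: additive_def single_add distrib_left)

lemma free_star_single [simp]:
  "free_star (Poly_Mapping.single w c) = Poly_Mapping.single (rev w) (word_sign w * c)"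
  by (simp add: free_star_pm_extend pm_extend_single)

lemma word_sign_append: "word_sign (u @ v) = word_sign u * word_sign v"
  by (simp add: word_sign_def)

lemma free_star_mult:
  fixes p q :: "('g, 'f::field) ncpoly"
  shows "free_star (p * q) = free_star q * free_star p"
proof (rule additive_pm_eq[of "\<lambda>p. free_star (p * q)" "\<lambda>p. free_star q * free_star p"])
  note add = additive.add[OF additive_free_star]
  fix u :: "'g var list" and c :: 'f
  let ?s = "Poly_Mapping.single u c"
  show "free_star (?s * q) = free_star q * free_star ?s"
    by (rule additive_pm_eq[of "\<lambda>q. free_star (?s * q)" "\<lambda>q. free_star q * free_star ?s"])
      (simp_all add: additive_def add algebra_simps single_mult_single word_sign_append)
qed (simp_all add: additive_def additive.add[OF additive_free_star] algebra_simps)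

lemma free_star_scale: "free_star (pm_scale c p) = pm_scale c (free_star p)"
  by (simp add: free_star_mult mult_single_Nil word_sign_def flip: single_Nil_mult)

lemma free_star_carrier:
  "p \<in> carrier (free_gs_algebra G) \<Longrightarrow> free_star p \<in> carrier (free_gs_algebra G)"
  unfolding free_star_def by (rule free_carrier_sum) (auto split: if_splits)

section \<open>Graded substitutions as endomorphisms of the free algebra\<close>

context comm_group
begin

lemma var_deg_closed: "x \<in> vars G \<Longrightarrow> var_deg x \<in> carrier G"
  by (auto simp: vars_def)

lemma word_deg_simps [simp]:
  "word_deg G [] = \<one>" "word_deg G (x # w) = var_deg x \<otimes> word_deg G w"
  by (simp_all add: word_deg_def)

lemma word_deg_closed: "set w \<subseteq> vars G \<Longrightarrow> word_deg G w \<in> carrier G"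
  by (induction w) (auto intro: var_deg_closed)

lemma word_deg_append:
  "set u \<subseteq> vars G \<Longrightarrow> set v \<subseteq> vars G \<Longrightarrow> word_deg G (u @ v) = word_deg G u \<otimes> word_deg G v"
  by (induction u) (simp_all add: var_deg_closed word_deg_closed m_assoc)

lemma free_homog_mult:
  assumes "p \<in> homog (free_gs_algebra G) s" "q \<in> homog (free_gs_algebra G) t"
  shows "p * q \<in> homog (free_gs_algebra G) (s \<otimes> t)"
proof -
  have "set w \<subseteq> vars G \<and> word_deg G w = s \<otimes> t" if w: "w \<in> Poly_Mapping.keys (p * q)" for w
  proof -
    obtain u v where "w = u @ v" "u \<in> Poly_Mapping.keys p" "v \<in> Poly_Mapping.keys q"
      using w by (rule in_keys_mult_words)
    then show ?thesis using assms by (simp add: word_deg_append)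
  qed
  then show ?thesis by simp
qed

lemma free_homog_add:
  "p \<in> homog (free_gs_algebra G) s \<Longrightarrow> q \<in> homog (free_gs_algebra G) s \<Longrightarrow> p + q \<in> homog (free_gs_algebra G) s"
  using keys_add[of p q] by auto

lemma free_homog_scale:
  "p \<in> homog (free_gs_algebra G) s \<Longrightarrow> pm_scale c p \<in> homog (free_gs_algebra G) s"
  using keys_pm_scale_subset[of c p] by auto

lemma free_homog_sum:
  "(\<And>i. i \<in> S \<Longrightarrow> f i \<in> homog (free_gs_algebra G) s) \<Longrightarrow> sum f S \<in> homog (free_gs_algebra G) s"
  by (induction S rule: infinite_finite_induct)
    (use free_homog_add in \<open>auto simp del: free_gs_algebra_simps(7)\<close>, auto)

definition graded_subst :: "('a var \<Rightarrow> ('a, 'f::field) ncpoly) \<Rightarrow> bool" where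
  "graded_subst \<theta> \<longleftrightarrow> (\<forall>x\<in>vars G. \<theta> x \<in> signed_homog (free_gs_algebra G) (var_deg x) (var_sym x))"

lemma subst_word_homog:
  assumes "graded_subst \<theta>" "set w \<subseteq> vars G"
  shows "prod_list (map \<theta> w) \<in> homog (free_gs_algebra G) (word_deg G w)"
  using assms(2)
proof (induction w)
  case (Cons x w)
  then have "\<theta> x \<in> homog (free_gs_algebra G) (var_deg x)"
    using assms(1) by (simp add: graded_subst_def signed_homog_free del: free_gs_algebra_simps)
  from free_homog_mult[OF this Cons.IH] show ?case using Cons.prems by (simp del: free_gs_algebra_simps)
qed (simp add: zero_list_def)

text \<open>Under \<open>free_star\<close> each \<open>\<theta> x\<close> is multiplied by the sign
  of \<open>x\<close>; the product of these signs is \<open>word_sign w\<close>.\<close>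

lemma subst_word_star:
  assumes "graded_subst \<theta>" "set w \<subseteq> vars G"
  shows "free_star (prod_list (map \<theta> w)) = pm_scale (word_sign w) (prod_list (map \<theta> (rev w)))"
  using assms(2)
proof (induction w)
  case Nil
  show ?case by (simp add: word_sign_def one_pm_list)
next
  case (Cons x w)
  have "free_star (\<theta> x) = pm_scale (case var_sym x of Sym \<Rightarrow> 1 | Skew \<Rightarrow> - 1) (\<theta> x)"
    using assms(1) Cons.prems by (auto simp: graded_subst_def signed_homog_free split: symmetry.split)
  with Cons show ?case
    by (simp add: free_star_mult pm_scale_mult_scale word_sign_def mult.commute del: free_gs_algebra_simps)
qed

text \<open>The universal property of the free algebra: it lets closure of a T-ideal under
  endomorphisms be used as closure under substitutions.\<close>

lemma gs_endomorphism_subst: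
  assumes "graded_subst (\<theta> :: 'a var \<Rightarrow> ('a, 'f::field) ncpoly)"
  shows "gs_endomorphism G (free_gs_algebra G) (subst_poly \<theta>)"
proof -
  let ?F = "free_gs_algebra G :: ('f, ('a, 'f) ncpoly, 'a) gs_algebra"
  have expand: "subst_poly \<theta> p = (\<Sum>w\<in>Poly_Mapping.keys p. pm_scale (Poly_Mapping.lookup p w) (prod_list (map \<theta> w)))" for p
    by (simp add: subst_poly_def pm_eval_def pm_extend_def single_Nil_mult)
  have homog: "subst_poly \<theta> p \<in> homog ?F s" if "p \<in> homog ?F s" for p s
    unfolding expand
  proof (intro free_homog_sum free_homog_scale)
    fix w assume "w \<in> Poly_Mapping.keys p"
    then have "set w \<subseteq> vars G" "word_deg G w = s" using that by auto
    then show "prod_list (map \<theta> w) \<in> homog ?F s" using subst_word_homog[OF assms] by blast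
  qed
  have closed: "subst_poly \<theta> p \<in> carrier ?F" if "p \<in> carrier ?F" for p
    unfolding expand
  proof (intro free_carrier_sum)
    fix w assume "w \<in> Poly_Mapping.keys p"
    then have "set w \<subseteq> vars G" using that by auto
    then show "pm_scale (Poly_Mapping.lookup p w) (prod_list (map \<theta> w)) \<in> carrier ?F"
      by (rule subsetD[OF free_homog_subset free_homog_scale[OF subst_word_homog[OF assms]]])
  qed
  have star: "subst_poly \<theta> (free_star p) = free_star (subst_poly \<theta> p)" if "p \<in> carrier ?F" for p
  proof (rule additive_pm_eq[of "\<lambda>p. subst_poly \<theta> (free_star p)" "\<lambda>p. free_star (subst_poly \<theta> p)"])
    fix w c assume "w \<in> Poly_Mapping.keys p"
    then have "set w \<subseteq> vars G" using that by auto
    then show "subst_poly \<theta> (free_star (Poly_Mapping.single w c)) = free_star (subst_poly \<theta> (Poly_Mapping.single w c))"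
      by (simp add: subst_poly_single single_Nil_mult free_star_scale subst_word_star[OF assms] mult.commute
          del: rev_map)
  qed (simp_all add: additive_def additive.add[OF additive_free_star] additive.add[OF additive_subst_poly])
  show ?thesis
    unfolding gs_endomorphism_def
  proof (intro conjI)
    show "subst_poly \<theta> \<in> Ring.ring_hom ?F ?F"
      by (rule ring_hom_memI) (simp_all add: closed subst_poly_mult subst_poly_1
        additive.add[OF additive_subst_poly] del: free_gs_algebra_simps(1))
    show "\<forall>s\<in>carrier G. subst_poly \<theta> ` homog ?F s \<subseteq> homog ?F s" using homog by blast
  qed (simp_all add: star subst_poly_scale del: free_gs_algebra_simps(1))
qed

end

section \<open>Coefficient sums over words with given letters\<close>

lemma eq_uminus_self_iff [simp]:
  fixes a :: "'f::field_char_0"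
  shows "a = - a \<longleftrightarrow> a = 0" "- a = a \<longleftrightarrow> a = 0"
proof -
  have "a = - a \<longleftrightarrow> 2 * a = 0" by (metis add_eq_0_iff2 mult_2)
  then show "a = - a \<longleftrightarrow> a = 0" "- a = a \<longleftrightarrow> a = 0" by auto
qed

text \<open>The coefficient of the monomial \<open>M\<close> after all variables are made to
  commute.\<close>

definition msum :: "'x multiset \<Rightarrow> ('x list \<Rightarrow>\<^sub>0 'f::field) \<Rightarrow> 'f" where
  "msum M = pm_extend (\<lambda>w c. if mset w = M then c else 0)"

lemma additive_msum: "Modules.additive (msum M)"
  unfolding msum_def by (intro additive_pm_extend) (simp add: additive_def)

lemma msum_single: "msum M (Poly_Mapping.single w c) = (if mset w = M then c else 0)"
  by (simp add: msum_def pm_extend_single)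

lemma msum_eq: "msum M p = (\<Sum>w\<in>{w \<in> Poly_Mapping.keys p. mset w = M}. Poly_Mapping.lookup p w)"
  by (simp add: msum_def pm_extend_def sum.inter_filter)

lemma msum_scale: "msum M (pm_scale c p) = c * msum M p"
  by (rule additive_pm_eq[of "\<lambda>p. msum M (pm_scale c p)" "\<lambda>p. c * msum M p"])
    (simp_all add: additive_def additive.add[OF additive_msum] pm.scale_right_distrib algebra_simps
      pm_scale_single msum_single)

lemma Var_in_vars_iff: "Var i s d \<in> vars G \<longleftrightarrow> 1 \<le> i \<and> s \<in> carrier G"
  by (auto simp: vars_def)

lemma (in comm_group) X_homog:
  "x \<in> vars G \<Longrightarrow> Poly_Mapping.single [x] 1 \<in> signed_homog (free_gs_algebra G) (var_deg x) (var_sym x)"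
  unfolding signed_homog_free
  by (cases "var_sym x") (auto simp: word_sign_def var_deg_closed simp flip: single_uminus)


section \<open>Weights\<close>

text \<open>\<open>e\<close> is the sign of the variables of degree \<open>g\<close> that survive: \<open>Sym\<close> for \<open>C3\<close> and \<open>Skew\<close> for
  \<open>C3_star\<close>. A variable of weight \<open>k \<le> 2\<close> takes values in \<open>F t\<^sup>k\<close>, and one of weight 3 vanishes.\<close>

locale c3_grading = comm_group G for G :: "('g, 'm) monoid_scheme" (structure) +
  fixes g :: 'g and e :: symmetry
  assumes g_closed: "g \<in> carrier G" and ord_g: "ord g > 2"
begin

lemma degrees_distinct:
  "g \<noteq> \<one>" "g \<otimes> g \<noteq> \<one>" "g \<otimes> g \<noteq> g" "\<one> \<noteq> g" "\<one> \<noteq> g \<otimes> g" "g \<noteq> g \<otimes> g"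
proof -
  show 1: "g \<noteq> \<one>" using ord_g ord_eq_1[OF g_closed] by auto
  have "g [^] (2::nat) \<noteq> \<one>"
    using ord_g pow_eq_id[OF g_closed, of 2] by (auto dest: dvd_imp_le)
  then show 2: "g \<otimes> g \<noteq> \<one>" by (simp add: numeral_2_eq_2 g_closed)
  show 3: "g \<otimes> g \<noteq> g" using 1 g_closed by (metis l_cancel_one)
  show "\<one> \<noteq> g" "\<one> \<noteq> g \<otimes> g" "g \<noteq> g \<otimes> g" using 1 2 3 by auto
qed

definition wt :: "'g \<Rightarrow> symmetry \<Rightarrow> nat" where
  "wt s d = (if s = \<one> \<and> d = Sym then 0 else if s = g \<and> d = e then 1
     else if s = g \<otimes> g \<and> d = Sym then 2 else 3)"

lemma wt_eq_iff:
  "wt s d = 0 \<longleftrightarrow> s = \<one> \<and> d = Sym" "wt s d = Suc 0 \<longleftrightarrow> s = g \<and> d = e"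
  "wt s d = 2 \<longleftrightarrow> s = g \<otimes> g \<and> d = Sym"
  using degrees_distinct by (auto simp: wt_def)

definition vwt :: "'g var \<Rightarrow> nat" where
  "vwt x = wt (var_deg x) (var_sym x)"

lemmas vwt_eq_iff = wt_eq_iff[of "var_deg x" "var_sym x" for x, folded vwt_def]

definition mwt :: "'g var multiset \<Rightarrow> nat" where
  "mwt M = sum_mset (image_mset vwt M)"

lemma mwt_simps [simp]: "mwt {#} = 0" "mwt (add_mset x M) = vwt x + mwt M" "mwt (M + N) = mwt M + mwt N"
  by (simp_all add: mwt_def)

text \<open>The factor by which the involution acts on t, that is, the sign of the surviving
  variables of degree \<open>g\<close>.\<close>

definition eps :: "'f::field" where
  "eps = (if e = Sym then 1 else - 1)"

lemma eps_square: "eps * eps = 1"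
  by (simp add: eps_def)

text \<open>The hypothesis rules out letters of weight 3, and a letter of weight k <= 2 has sign
  \<open>eps\<close>^k: weights 0 and 2 are symmetric, weight 1 has the sign \<open>e\<close>. By
  \<open>word_deg_eq\<close> the weight determines the degree as well.\<close>

lemma word_sign_eq:
  "mwt (mset w) \<le> 2 \<Longrightarrow> (word_sign w :: 'f::field) = eps ^ mwt (mset w)"
proof (induction w)
  case (Cons x w)
  have x: "vwt x \<in> {0, 1, 2}" using Cons.prems by auto
  have "(case var_sym x of Sym \<Rightarrow> 1 | Skew \<Rightarrow> - 1) = (eps ^ vwt x :: 'f)"
  proof -
    from x consider "vwt x = 0" | "vwt x = Suc 0" | "vwt x = 2" by auto
    then show ?thesis
      by cases (use vwt_eq_iff[of x] in \<open>auto simp: eps_def split: symmetry.split\<close>)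
  qed
  then show ?case using Cons by (simp add: word_sign_def power_add)
qed (simp add: word_sign_def)

lemma word_deg_eq:
  "mwt (mset w) \<le> 2 \<Longrightarrow> word_deg G w = g [^] mwt (mset w)"
proof (induction w)
  case (Cons x w)
  have x: "vwt x \<in> {0, 1, 2}" using Cons.prems by auto
  then consider "vwt x = 0" | "vwt x = Suc 0" | "vwt x = 2" by auto
  then have "var_deg x = g [^] vwt x"
    by cases (use vwt_eq_iff[of x] in \<open>auto simp: numeral_2_eq_2 g_closed\<close>)
  then show ?case using Cons by (simp add: nat_pow_mult g_closed)
qed simp

text \<open>The general form of an admissible evaluation, with one free scalar \<open>a x\<close>
  per variable; variables of weight 3 go to 0 whatever the scalar.\<close>

definition tev :: "('g var \<Rightarrow> 'f::field) \<Rightarrow> ('g, 'f) ncpoly \<Rightarrow> 'f trunc" where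
  "tev a = pm_eval (tmon 0) (\<lambda>x. tmon (vwt x) (a x))"

lemmas additive_tev = tmon_embedding.additive_pm_eval[of "\<lambda>x. tmon (vwt x) (a x)" for a, folded tev_def]
lemmas tev_mult = tmon_embedding.pm_eval_mult[of "\<lambda>x. tmon (vwt x) (a x)" for a, folded tev_def]
lemmas tev_add = additive.add[OF additive_tev]

lemma tmon_word:
  "prod_list (map (\<lambda>x. tmon (vwt x) (a x)) w) = tmon (mwt (mset w)) (prod_mset (image_mset a (mset w)))"
  by (induction w) (simp_all add: tmon_mult)

lemma tev_single:
  "tev a (Poly_Mapping.single w c) = tmon (mwt (mset w)) (c * prod_mset (image_mset a (mset w)))"
  by (simp add: tev_def tmon_embedding.pm_eval_single tmon_word tmon_mult)

lemma tev_1: "tev a 1 = 1"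
  by (simp add: tev_def tmon_embedding.pm_eval_1)

lemma tev_scale: "tev a (pm_scale c p) = tmon 0 c * tev a p"
  by (simp add: tev_mult tev_single flip: single_Nil_mult)

text \<open>In a commutative ring the reversal is invisible, and the sign \<open>eps\<close>^k of a
  word of weight k <= 2 is how t -> \<open>eps\<close> t acts on t^k. Heavier words vanish on both
  sides.\<close>

lemma tev_star: "tev a (free_star p) = twist eps (tev a p)"
proof (rule additive_pm_eq[of "\<lambda>p. tev a (free_star p)" "\<lambda>p. twist eps (tev a p)"])
  fix w c
  show "tev a (free_star (Poly_Mapping.single w c)) = twist eps (tev a (Poly_Mapping.single w c))"
  proof (cases "mwt (mset w) \<le> 2")
    case True
    then show ?thesis by (simp add: tev_single twist_tmon eps_square word_sign_eq mult.assoc)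
  next
    case False
    then have "tmon (mwt (mset w)) b = 0" for b :: 'a by (simp add: tmon_eq_0_iff)
    then show ?thesis by (simp add: tev_single twist_def trunc_defs)
  qed
qed (simp_all add: additive_def tev_add additive.add[OF additive_free_star] additive.add[OF additive_twist])

definition ids :: "('g, 'f::field) ncpoly set" where
  "ids = {p \<in> carrier (free_gs_algebra G). \<forall>a. tev a p = 0}"

lemma tev_by_monomials:
  "tev a p = (\<Sum>M\<in>mset ` Poly_Mapping.keys p. tmon (mwt M) (msum M p * prod_mset (image_mset a M)))"
proof -
  let ?h = "\<lambda>w. tmon (mwt (mset w)) (Poly_Mapping.lookup p w * prod_mset (image_mset a (mset w)))"
  have "tev a p = (\<Sum>w\<in>Poly_Mapping.keys p. ?h w)"
    by (simp add: tev_def pm_eval_def pm_extend_def tmon_word tmon_mult)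
  also have "\<dots> = (\<Sum>M\<in>mset ` Poly_Mapping.keys p. \<Sum>w\<in>{w \<in> Poly_Mapping.keys p. mset w = M}. ?h w)"
    by (rule sum.image_gen) simp
  also have "\<dots> = (\<Sum>M\<in>mset ` Poly_Mapping.keys p. tmon (mwt M) (msum M p * prod_mset (image_mset a M)))"
    by (intro sum.cong refl) (auto simp: msum_eq sum_distrib_right tmon_sum intro!: sum.cong)
  finally show ?thesis .
qed

text \<open>Extracting the coefficient of t^k with k = \<open>mwt M\<close> leaves a combination of
  the monomial functions of weight k, which are independent.\<close>

lemma msum_eq_0:
  fixes p :: "('g, 'f::field_char_0) ncpoly"
  assumes "\<And>a. tev a p = 0" "mwt M \<le> 2"
  shows "msum M p = 0"
proof (cases "M \<in> mset ` Poly_Mapping.keys p")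
  case True
  let ?c = "\<lambda>N. if mwt N = mwt M then msum N p else 0"
  have "(\<Sum>N\<in>mset ` Poly_Mapping.keys p. ?c N * prod_mset (image_mset a N)) = tcoef (mwt M) (tev a p)" for a
    unfolding tev_by_monomials tcoef_sum using assms(2)
    by (intro sum.cong) (auto simp: tcoef_tmon)
  then have "(\<Sum>N\<in>mset ` Poly_Mapping.keys p. ?c N * prod_mset (image_mset a N)) = 0" for a
    using assms(1) by (simp add: tcoef_def zero_trunc_def)
  then have "?c M = 0" using True by (rule monomials_independent[rotated]) simp
  then show ?thesis by simp
qed (auto simp: msum_eq intro!: sum.neutral)

lemma ids_iff:
  fixes p :: "('g, 'f::field_char_0) ncpoly"
  shows "p \<in> ids \<longleftrightarrow> p \<in> carrier (free_gs_algebra G) \<and> (\<forall>M. mwt M \<le> 2 \<longrightarrow> msum M p = 0)"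
proof -
  have "tev a p = 0" if "\<forall>M. mwt M \<le> 2 \<longrightarrow> msum M p = 0" for a
    unfolding tev_by_monomials
  proof (intro sum.neutral ballI)
    fix M
    show "tmon (mwt M) (msum M p * prod_mset (image_mset a M)) = 0"
      using that by (cases "mwt M \<le> 2") (auto simp: tmon_eq_0_iff)
  qed
  then show ?thesis unfolding ids_def using msum_eq_0 by blast
qed


section \<open>The identities of the two algebras\<close>

text \<open>For k <= 2 an element a t^k meets the star condition iff \<open>eps\<close>^k a is a or
  -a, according to \<open>d\<close>. For one sign this always holds, for the other it forces a = 0,
  which weight 3 encodes.\<close>

lemma signed_homog_C3:
  fixes st :: "'f::field_char_0 mat \<Rightarrow> 'f mat"
  assumes st: "\<And>x. st (trunc_mat x) = trunc_mat (twist eps x)"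
  shows "signed_homog (C3_with st G g) s d = range (\<lambda>a. trunc_mat (tmon (wt s d) a))"
proof -
  let ?A = "C3_with st G g"
  \<comment> \<open>The power of t in degree \<open>s\<close>, before the sign is taken into
    account.\<close>
  define k where "k = (if s = \<one> then 0 else if s = g then 1 else if s = g \<otimes> g then 2 else (3::nat))"
  define \<delta> :: 'f where "\<delta> = (if d = Sym then 1 else - 1)"
  have homog: "homog ?A s = range (\<lambda>a. trunc_mat (tmon k a))"
    using degrees_distinct by (auto simp: C3_homog_def k_def trunc_mat_def tmon_def)
  have minus: "\<ominus>\<^bsub>?A\<^esub> trunc_mat x = trunc_mat (- x)" for x
    by (simp add: trunc_mat_def C3_minus uminus_trunc_def)
  have "tmon k (eps ^ k * a) = tmon k (\<delta> * a) \<longleftrightarrow> tmon k a = tmon (wt s d) a" for a :: 'f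
  proof (cases "k = 1")
    case True
    then have "wt s d = (if d = e then 1 else 3)" "s = g"
      using degrees_distinct by (auto simp: k_def wt_def split: if_splits)
    then show ?thesis using True unfolding \<delta>_def eps_def by (cases d; cases e) (auto simp: tmon_def)
  next
    case False
    then have "wt s d = (if d = Sym then k else 3)" and k: "k \<in> {0, 2, 3}"
      using degrees_distinct by (auto simp: k_def wt_def)
    moreover have "tmon k (eps ^ k * a) = tmon k a"
      using k by (auto simp: power2_eq_square eps_square tmon_def)
    ultimately show ?thesis by (cases d) (auto simp: \<delta>_def tmon_def)
  qed
  moreover have "y \<in> signed_homog ?A s d \<longleftrightarrow> y \<in> homog ?A s \<and> star ?A y = (if d = Sym then y else \<ominus>\<^bsub>?A\<^esub> y)" for y
    by (cases d) simp_all
  then have "y \<in> signed_homog ?A s d \<longleftrightarrow>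
      (\<exists>a. y = trunc_mat (tmon k a) \<and> tmon k (eps ^ k * a) = tmon k (\<delta> * a))" for y
    unfolding homog
    by (auto simp: st twist_tmon[OF eps_square] minus \<delta>_def additive.minus[OF additive_tmon])
  ultimately have *: "y \<in> signed_homog ?A s d \<longleftrightarrow>
      (\<exists>a. y = trunc_mat (tmon k a) \<and> tmon k a = tmon (wt s d) a)" for y by simp
  have "wt s d = k \<or> wt s d = 3"
    using degrees_distinct by (auto simp: k_def wt_def)
  \<comment> \<open>For the converse inclusion: in weight 3 the value is 0, which has the form a t^k
    with a = 0.\<close>
  then have **: "\<exists>b. tmon (wt s d) a = tmon k b \<and> tmon k b = tmon (wt s d) b" for a :: 'f
  proof
    assume "wt s d = 3"
    then show ?thesis by (intro exI[of _ 0]) (simp add: tmon_eq_0_iff)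
  qed auto
  show ?thesis
  proof (intro Set.equalityI Set.subsetI)
    fix y :: "'f mat" assume "y \<in> signed_homog ?A s d"
    then show "y \<in> range (\<lambda>a. trunc_mat (tmon (wt s d) a))" unfolding * by auto
  next
    fix y :: "'f mat" assume "y \<in> range (\<lambda>a. trunc_mat (tmon (wt s d) a))"
    then obtain a where y: "y = trunc_mat (tmon (wt s d) a)" by auto
    then show "y \<in> signed_homog ?A s d" unfolding * using **[of a] by auto
  qed
qed

lemma eval_poly_C3:
  fixes p :: "('g, 'f::field) ncpoly"
  assumes "\<And>x. x \<in> vars G \<Longrightarrow> \<phi> x = trunc_mat (f x)" "p \<in> carrier (free_gs_algebra G)"
  shows "eval_poly (C3_with st G g) \<phi> p = trunc_mat (pm_eval (tmon 0) f p)"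
proof -
  let ?A = "C3_with st G g"
  interpret A: ring ?A by (rule ring_C3)
  have word: "foldr (\<lambda>x a. \<phi> x * a) w (c3 1 0 0) = trunc_mat (prod_list (map f w))"
    if "set w \<subseteq> vars G" for w
    using that
    by (induction w) (simp_all add: assms(1) trunc_mat_mult, simp add: trunc_mat_def one_trunc_def)
  have summand: "Poly_Mapping.lookup p w \<cdot>\<^sub>m foldr (\<lambda>x a. \<phi> x * a) w (c3 1 0 0)
      = trunc_mat (tmon 0 (Poly_Mapping.lookup p w) * prod_list (map f w))"
    if "w \<in> Poly_Mapping.keys p" for w
    using that assms(2) by (subst word) (auto simp: trunc_mat_smult)
  have "eval_poly ?A \<phi> p = finsum ?A (\<lambda>w. trunc_mat (tmon 0 (Poly_Mapping.lookup p w) * prod_list (map f w)))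
      (Poly_Mapping.keys p)"
    unfolding eval_poly_def using summand
    by (intro A.finsum_cong') (auto simp: trunc_mat_def)
  then show ?thesis
    by (simp add: finsum_trunc_mat pm_eval_def pm_extend_def)
qed

lemma Id_sharp_C3:
  fixes st :: "'f::field_char_0 mat \<Rightarrow> 'f mat"
  assumes st: "\<And>x. st (trunc_mat x) = trunc_mat (twist eps x)"
  shows "Id_sharp G (C3_with st G g) = ids"
proof -
  let ?A = "C3_with st G g"
  have zero: "\<zero>\<^bsub>?A\<^esub> = trunc_mat 0" by (simp add: trunc_mat_def zero_trunc_def)
  have adm: "admissible G ?A (\<lambda>x. trunc_mat (tmon (vwt x) (a x)))" for a
    by (simp add: admissible_def signed_homog_C3[OF st] vwt_def)
  have "eval_poly ?A \<phi> p = \<zero>\<^bsub>?A\<^esub>" if p: "p \<in> ids" and \<phi>: "admissible G ?A \<phi>" for p \<phi>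
  proof -
    have "\<exists>a. \<forall>x\<in>vars G. \<phi> x = trunc_mat (tmon (vwt x) (a x))"
      using \<phi> by (intro bchoice) (auto simp: admissible_def signed_homog_C3[OF st] vwt_def)
    then obtain a where "\<forall>x\<in>vars G. \<phi> x = trunc_mat (tmon (vwt x) (a x))" by blast
    then have "eval_poly ?A \<phi> p = trunc_mat (tev a p)"
      unfolding tev_def using p by (intro eval_poly_C3) (auto simp: ids_def)
    then show ?thesis using p zero by (simp add: ids_def)
  qed
  moreover have "tev a p = 0" if "p \<in> Id_sharp G ?A" for p a
  proof -
    have "trunc_mat (tev a p) = \<zero>\<^bsub>?A\<^esub>"
      unfolding tev_def using that adm[of a]
      by (subst eval_poly_C3[symmetric]) (auto simp: Id_sharp_def)
    then show ?thesis by (simp only: zero trunc_mat_eq_iff)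
  qed
  ultimately show ?thesis by (auto simp: Id_sharp_def ids_def)
qed

text \<open>A word of weight k <= 2 and degree \<open>s\<close> satisfies g^k = \<open>s\<close>, so
  at most one power of t survives; the star condition, carried over by \<open>tev_star\<close>,
  kills it when the sign is wrong.\<close>

lemma tev_signed_homog:
  fixes u :: "('g, 'f::field_char_0) ncpoly"
  assumes u: "u \<in> signed_homog (free_gs_algebra G) s d"
  shows "\<exists>b. tev a u = tmon (wt s d) b"
proof -
  have hom: "set w \<subseteq> vars G \<and> word_deg G w = s" if "w \<in> Poly_Mapping.keys u" for w
    using u that by (auto simp: signed_homog_free)
  have "tcoef k (tev a u) = 0" if k: "k \<le> 2" "g [^] k \<noteq> s" for k
    unfolding tev_by_monomials tcoef_sum
  proof (intro sum.neutral ballI)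
    fix M assume "M \<in> mset ` Poly_Mapping.keys u"
    then obtain w where "w \<in> Poly_Mapping.keys u" "M = mset w" by auto
    then have "mwt M \<noteq> k" using hom[of w] word_deg_eq[of w] k by auto
    then show "tcoef k (tmon (mwt M) (msum M u * prod_mset (image_mset a M))) = 0"
      using k by (simp add: tcoef_tmon)
  qed
  from this[of 0] this[of 1] this[of 2]
  have coefs: "s \<noteq> \<one> \<Longrightarrow> tr0 (tev a u) = 0" "s \<noteq> g \<Longrightarrow> tr1 (tev a u) = 0" "s \<noteq> g \<otimes> g \<Longrightarrow> tr2 (tev a u) = 0"
    by (auto simp: tcoef_def g_closed numeral_2_eq_2)
  have "twist eps (tev a u) = (if d = Sym then tev a u else - tev a u)"
    using u additive.minus[OF additive_tev, of a u]
    by (auto simp: signed_homog_free simp flip: tev_star)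
  moreover obtain b0 b1 b2 where b: "tev a u = Trunc b0 b1 b2" by (cases "tev a u")
  ultimately have "b0 = (if d = Sym then 1 else - 1) * b0" "eps * b1 = (if d = Sym then 1 else - 1) * b1"
    "b2 = (if d = Sym then 1 else - 1) * b2"
    by (cases "d = Sym"; simp add: twist_def uminus_trunc_def)+
  \<comment> \<open>At most one of the three coefficients is nonzero, so their sum is the wanted
    scalar.\<close>
  then have "Trunc b0 b1 b2 = tmon (wt s d) (b0 + b1 + b2)"
    using coefs[unfolded b] degrees_distinct unfolding eps_def wt_def tmon_def
    by (cases d; cases e) auto
  then show ?thesis using b by auto
qed

text \<open>The new assignment \<open>b\<close> is read off from the images of the variables: these
  keep degree and sign, so by \<open>tev_signed_homog\<close> their values are again scalars times
  t^k.\<close>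

lemma tev_endomorphism:
  fixes p :: "('g, 'f::field_char_0) ncpoly"
  assumes \<phi>: "gs_endomorphism G (free_gs_algebra G) \<phi>" and p: "p \<in> carrier (free_gs_algebra G)"
  shows "\<exists>b. tev a (\<phi> p) = tev b p"
proof -
  let ?F = "free_gs_algebra G :: ('f, ('g, 'f) ncpoly, 'g) gs_algebra"
  have hom: "\<phi> \<in> Ring.ring_hom ?F ?F" using \<phi> by (simp add: gs_endomorphism_def)
  have mult: "\<phi> (p * q) = \<phi> p * \<phi> q" if "p \<in> carrier ?F" "q \<in> carrier ?F" for p q
    using ring_hom_mult[OF hom that] by simp
  have add: "\<phi> (p + q) = \<phi> p + \<phi> q" if "p \<in> carrier ?F" "q \<in> carrier ?F" for p q
    using ring_hom_add[OF hom that] by simp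
  have one: "\<phi> 1 = 1" using ring_hom_one[OF hom] by simp
  have scale: "\<phi> (pm_scale c p) = pm_scale c (\<phi> p)" if "p \<in> carrier ?F" for c p
    using \<phi> that by (simp add: gs_endomorphism_def)
  have star: "\<phi> (free_star p) = free_star (\<phi> p)" if "p \<in> carrier ?F" for p
    using \<phi> that by (simp add: gs_endomorphism_def)
  have zero: "\<phi> 0 = 0" using scale[of 0 0] by simp
  have "\<exists>b. tev a (\<phi> (Poly_Mapping.single [x] 1)) = tmon (vwt x) b" if x: "x \<in> vars G" for x
  proof -
    let ?x = "Poly_Mapping.single [x] 1 :: ('g, 'f) ncpoly"
    have X: "?x \<in> signed_homog ?F (var_deg x) (var_sym x)" using x by (rule X_homog)
    have carr: "?x \<in> carrier ?F" using x by simp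
    have "\<phi> ?x \<in> homog ?F (var_deg x)"
      using \<phi> X var_deg_closed[OF x] unfolding gs_endomorphism_def signed_homog_free by blast
    moreover have "\<phi> (free_star ?x) = free_star (\<phi> ?x)"
      by (rule star[OF carr])
    moreover have "\<phi> (- ?x) = - \<phi> ?x" using scale[OF carr, of "- 1"] by simp
    ultimately have "\<phi> ?x \<in> signed_homog ?F (var_deg x) (var_sym x)"
      using X unfolding signed_homog_free by (auto simp del: free_gs_algebra_simps)
    then show ?thesis unfolding vwt_def by (rule tev_signed_homog)
  qed
  then obtain b where b: "\<And>x. x \<in> vars G \<Longrightarrow> tev a (\<phi> (Poly_Mapping.single [x] 1)) = tmon (vwt x) (b x)"
    by metis
  have word: "tev a (\<phi> (Poly_Mapping.single w 1)) = tmon (mwt (mset w)) (prod_mset (image_mset b (mset w)))"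
    if "set w \<subseteq> vars G" for w
    using that
  proof (induction w)
    case (Cons x w)
    then have "Poly_Mapping.single [x] 1 \<in> carrier ?F" "Poly_Mapping.single w 1 \<in> carrier ?F" by simp_all
    from mult[OF this] Cons show ?case by (simp add: single_mult_single tev_mult b tmon_mult)
  qed (simp add: one tev_1 flip: one_pm_list)
  \<comment> \<open>\<open>\<phi>\<close> is known to be a homomorphism on the carrier only, so
    \<open>additive_pm_eq\<close> does not apply and the sum is built up inside the carrier.\<close>
  have sum: "tev a (\<phi> (\<Sum>w\<in>K. Poly_Mapping.single w (c w))) = tev b (\<Sum>w\<in>K. Poly_Mapping.single w (c w))"
    if "finite K" "\<And>w. w \<in> K \<Longrightarrow> set w \<subseteq> vars G" for K c
    using that
  proof (induction K rule: finite_induct)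
    case (insert w K)
    have carr: "Poly_Mapping.single w (c w) \<in> carrier ?F" "(\<Sum>w\<in>K. Poly_Mapping.single w (c w)) \<in> carrier ?F"
      using insert.prems by (intro free_carrier_single free_carrier_sum; simp)+
    have "tev a (\<phi> (Poly_Mapping.single w (c w))) = tev b (Poly_Mapping.single w (c w))"
      using scale[of "Poly_Mapping.single w 1" "c w"] insert.prems[of w]
      by (simp add: pm_scale_single tev_scale word tev_single tmon_mult)
    then show ?case using insert add[OF carr] by (simp add: tev_add)
  qed (simp add: zero additive.zero[OF additive_tev])
  have "tev a (\<phi> p) = tev b p"
    using sum[of "Poly_Mapping.keys p" "Poly_Mapping.lookup p"] p by (simp flip: pm_sum_single)
  then show ?thesis by blast
qed

lemma T_ideal_ids: "T_ideal G (ids :: ('g, 'f::field_char_0) ncpoly set)"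
  unfolding T_ideal_def
proof (intro conjI allI impI)
  let ?F = "free_gs_algebra G :: ('f, ('g, 'f) ncpoly, 'g) gs_algebra"
  let ?I = "ids :: ('g, 'f) ncpoly set"
  show "ideal ids ?F"
  proof (rule idealI)
    show "subgroup ids (add_monoid ?F)"
    proof
      show "?I \<subseteq> carrier (add_monoid ?F)" by (auto simp: ids_def)
      show "\<one>\<^bsub>add_monoid ?F\<^esub> \<in> ?I" by (simp add: ids_def additive.zero[OF additive_tev])
      fix p assume p: "p \<in> ?I"
      then have "inv\<^bsub>add_monoid ?F\<^esub> p = - p"
        using free_minus[of p G] by (auto simp: a_inv_def ids_def)
      then show "inv\<^bsub>add_monoid ?F\<^esub> p \<in> ?I"
        using p by (simp add: ids_def keys_uminus additive.minus[OF additive_tev])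
      fix q assume "q \<in> ?I"
      then show "p \<otimes>\<^bsub>add_monoid ?F\<^esub> q \<in> ?I"
        using p free_carrier_add[of p G q] by (simp add: ids_def tev_add)
    qed
    fix p q assume "p \<in> ?I" "q \<in> carrier ?F"
    then show "q \<otimes>\<^bsub>?F\<^esub> p \<in> ?I" "p \<otimes>\<^bsub>?F\<^esub> q \<in> ?I"
      using free_carrier_mult[of p G q] free_carrier_mult[of q G p] by (simp_all add: ids_def tev_mult)
  qed (rule ring_free)
  show "free_star ` ?I \<subseteq> ?I"
  proof
    fix q assume "q \<in> free_star ` ?I"
    then obtain p where p: "p \<in> ?I" "q = free_star p" by auto
    then show "q \<in> ?I"
      using free_star_carrier[of p G] by (simp add: ids_def tev_star twist_def trunc_defs)
  qed
  fix \<phi> assume \<phi>: "gs_endomorphism G ?F \<phi>"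
  show "\<phi> ` ?I \<subseteq> ?I"
  proof
    fix q assume "q \<in> \<phi> ` ?I"
    then obtain p where p: "p \<in> ?I" "q = \<phi> p" by auto
    then have "p \<in> carrier ?F" by (simp add: ids_def)
    moreover have "\<phi> \<in> Ring.ring_hom ?F ?F" using \<phi> by (simp add: gs_endomorphism_def)
    ultimately have "\<phi> p \<in> carrier ?F" by (simp only: ring_hom_closed)
    moreover have "tev a (\<phi> p) = 0" for a
      using tev_endomorphism[OF \<phi> \<open>p \<in> carrier ?F\<close>, of a] p by (auto simp: ids_def)
    ultimately show "q \<in> ?I" using p by (simp add: ids_def)
  qed
qed

lemma tev_X: "tev a (X i s d) = tmon (wt s d) (a (Var i s d))"
  by (simp add: X_def tev_single vwt_def)

lemma X_closed: "1 \<le> i \<Longrightarrow> s \<in> carrier G \<Longrightarrow> X i s d \<in> carrier (free_gs_algebra G)"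
  by (simp add: X_def Var_in_vars_iff)

end


section \<open>The ideal generated by the listed polynomials\<close>

text \<open>\<open>I\<close> stands for any T-ideal containing the generators, the hull being the
  intersection of these. Written with \<open>e\<close>, the assumed elements take the same form for
  both algebras.\<close>

locale c3_T_ideal = c3_grading G g e for G :: "('g, 'm) monoid_scheme" (structure) and g e +
  fixes I :: "('g, 'f::field_char_0) ncpoly set"
  assumes T_ideal: "T_ideal G I"
    and heavy_vars: "s \<in> carrier G \<Longrightarrow> wt s d > 2 \<Longrightarrow> X 1 s d \<in> I"
    and prod_12: "X 1 g e * X 2 (g \<otimes> g) Sym \<in> I"
    and prod_22: "X 1 (g \<otimes> g) Sym * X 2 (g \<otimes> g) Sym \<in> I"
begin

abbreviation F :: "('f, ('g, 'f) ncpoly, 'g) gs_algebra" where "F \<equiv> free_gs_algebra G"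

abbreviation word :: "'g var list \<Rightarrow> ('g, 'f) ncpoly" where "word w \<equiv> Poly_Mapping.single w 1"

lemma ideal_I: "ideal I F"
  using T_ideal by (simp add: T_ideal_def)

lemma I_0: "0 \<in> I"
  using additive_subgroup.zero_closed[OF ideal.axioms(1)[OF ideal_I]] by simp

lemma I_add: "p \<in> I \<Longrightarrow> q \<in> I \<Longrightarrow> p + q \<in> I"
  using additive_subgroup.a_closed[OF ideal.axioms(1)[OF ideal_I]] by simp

lemma I_lmult: "p \<in> I \<Longrightarrow> q \<in> carrier F \<Longrightarrow> q * p \<in> I"
  using ideal.I_l_closed[OF ideal_I, of p q] by simp

lemma I_rmult: "p \<in> I \<Longrightarrow> q \<in> carrier F \<Longrightarrow> p * q \<in> I"
  using ideal.I_r_closed[OF ideal_I, of p q] by simp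

lemma I_scale: "p \<in> I \<Longrightarrow> pm_scale c p \<in> I"
  using I_lmult[of p "Poly_Mapping.single [] c"] by (simp add: single_Nil_mult)

lemma I_uminus: "p \<in> I \<Longrightarrow> - p \<in> I"
  using I_scale[of p "- 1"] by simp

lemma I_sum: "(\<And>i. i \<in> S \<Longrightarrow> f i \<in> I) \<Longrightarrow> sum f S \<in> I"
  by (induction S rule: infinite_finite_induct) (auto intro: I_0 I_add)

lemma I_star: "p \<in> I \<Longrightarrow> free_star p \<in> I"
  using T_ideal by (auto simp: T_ideal_def)

lemma I_subst: "p \<in> I \<Longrightarrow> graded_subst \<theta> \<Longrightarrow> subst_poly \<theta> p \<in> I"
  using T_ideal gs_endomorphism_subst[of \<theta>] by (auto simp: T_ideal_def)

lemma heavy_elements: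
  assumes "u \<in> signed_homog F s d" "s \<in> carrier G" "wt s d > 2"
  shows "u \<in> I"
proof -
  let ?\<theta> = "\<lambda>x. if x = Var 1 s d then u else word [x]"
  have "graded_subst ?\<theta>"
    using assms(1) X_homog by (auto simp: graded_subst_def)
  then have "subst_poly ?\<theta> (X 1 s d) \<in> I"
    using assms by (intro I_subst heavy_vars)
  then show ?thesis by (simp add: X_def subst_poly_single one_pm_list[symmetric])
qed

text \<open>The indices 1 and 2 keep the two variables distinct even if their types agree, so
  \<open>u\<close> and \<open>v\<close> can be substituted independently.\<close>

lemma subst_product:
  assumes "u \<in> signed_homog F s d" "v \<in> signed_homog F t d'" "X 1 s d * X 2 t d' \<in> I"
  shows "u * v \<in> I"
proof -
  let ?\<theta> = "\<lambda>x. if x = Var 1 s d then u else if x = Var 2 t d' then v else word [x]"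
  have "graded_subst ?\<theta>"
    using assms(1,2) X_homog by (auto simp: graded_subst_def)
  then have "subst_poly ?\<theta> (X 1 s d * X 2 t d') \<in> I"
    using assms(3) by (rule I_subst[rotated])
  then show ?thesis by (simp add: X_def subst_poly_mult subst_poly_single one_pm_list[symmetric])
qed

lemma heavy_letter: "x \<in> vars G \<Longrightarrow> vwt x > 2 \<Longrightarrow> word [x] \<in> I"
  by (rule heavy_elements[OF X_homog]) (auto simp: vwt_def var_deg_closed)

lemma heavy_pair_ordered:
  assumes "x \<in> vars G" "y \<in> vars G" "vwt x \<in> {1, 2}" "vwt y = 2"
  shows "word [x] * word [y] \<in> I"
proof (rule subst_product[OF X_homog X_homog])
  have "var_deg y = g \<otimes> g" "var_sym y = Sym" using assms by (auto simp: vwt_eq_iff)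
  moreover have "var_deg x = g \<and> var_sym x = e \<or> var_deg x = g \<otimes> g \<and> var_sym x = Sym"
    using assms by (auto simp: vwt_eq_iff)
  ultimately show "X 1 (var_deg x) (var_sym x) * X 2 (var_deg y) (var_sym y) \<in> I"
    using prod_12 prod_22 by auto
qed (use assms in auto)

text \<open>For weights 1 and 2 the generators give the order in which the letter of weight 2 comes
  last; \<open>free_star\<close> reverses the word and gives the other order.\<close>

lemma heavy_pair:
  assumes "x \<in> vars G" "y \<in> vars G" "vwt x + vwt y > 2"
  shows "word [x] * word [y] \<in> I"
proof -
  have carr: "word [x] \<in> carrier F" "word [y] \<in> carrier F" using assms by auto
  have le: "vwt z \<le> 3" for z by (simp add: vwt_def wt_def)
  consider "vwt x > 2" | "vwt y > 2" | "vwt x \<in> {1, 2} \<and> vwt y = 2" | "vwt x = 2 \<and> vwt y = 1"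
    using assms(3) le[of x] le[of y] by fastforce
  then show ?thesis
  proof cases
    case 1
    then show ?thesis using heavy_letter I_rmult carr assms by blast
  next
    case 2
    then show ?thesis using heavy_letter I_lmult carr assms by blast
  next
    case 3
    then show ?thesis using heavy_pair_ordered assms by blast
  next
    case 4
    then have "word [y] * word [x] \<in> I" using heavy_pair_ordered assms by auto
    then have "free_star (word [y] * word [x]) \<in> I" by (rule I_star)
    \<comment> \<open>The star of yx is xy up to a sign; a second factor of that sign, which squares
      to 1, removes it.\<close>
    then have "pm_scale (word_sign [x, y]) (free_star (word [y] * word [x])) \<in> I" by (rule I_scale)
    moreover have "word_sign [x, y] * word_sign [y, x] = (1 :: 'f)"
      by (auto simp: word_sign_def split: symmetry.split)
    ultimately show ?thesis by (simp add: single_mult_single pm_scale_single)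
  qed
qed

text \<open>The star sends xy + c yx to its sign times yx + c xy, which is c times that sign times
  the original because c is 1 or -1. Commutators and anticommutators are thus handled
  together.\<close>

lemma bracket_signed_homog:
  assumes "x \<in> vars G" "y \<in> vars G" "c \<in> {1, - 1}"
    and d: "d = (if c * word_sign [x, y] = (1 :: 'f) then Sym else Skew)"
  shows "word [x] * word [y] + pm_scale c (word [y] * word [x])
    \<in> signed_homog F (var_deg x \<otimes> var_deg y) d"
proof -
  let ?u = "word [x] * word [y] + pm_scale c (word [y] * word [x])"
  have X: "word [z] \<in> homog F (var_deg z)" if "z \<in> vars G" for z
    using X_homog[OF that, where ?'c = 'f] by (simp add: signed_homog_free)
  have comm: "var_deg y \<otimes> var_deg x = var_deg x \<otimes> var_deg y"
    using assms var_deg_closed by (auto intro: m_comm)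
  have "?u \<in> homog F (var_deg x \<otimes> var_deg y)"
    using free_homog_mult[OF X[OF assms(1)] X[OF assms(2)]]
      free_homog_scale[OF free_homog_mult[OF X[OF assms(2)] X[OF assms(1)]], of c, unfolded comm]
    by (rule free_homog_add)
  moreover have "free_star ?u = pm_scale (c * word_sign [x, y]) ?u"
  proof -
    have "word_sign [y, x] = (word_sign [x, y] :: 'f)" by (simp add: word_sign_def)
    then show ?thesis using assms(3)
      by (elim insertE emptyE) (simp_all add: additive.add[OF additive_free_star] free_star_scale
          single_mult_single pm_scale_single pm.scale_right_distrib add.commute)
  qed
  moreover have "c * word_sign [x, y] \<in> {1, - 1 :: 'f}"
    using assms(3) by (auto simp: word_sign_def split: symmetry.split)
  ultimately show ?thesis
    unfolding signed_homog_free d by (auto simp del: free_gs_algebra_simps)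
qed

text \<open>The commutator of two variables of total weight at most 2 has the sign opposite to that of
  the variables of its degree that survive.\<close>

lemma commuting_letters:
  assumes "x \<in> vars G" "y \<in> vars G"
  shows "word [x] * word [y] - word [y] * word [x] \<in> I"
proof (cases "vwt x + vwt y > 2")
  case True
  then have "word [x] * word [y] \<in> I" "word [y] * word [x] \<in> I"
    using heavy_pair[of x y] heavy_pair[of y x] assms by (auto simp: add.commute)
  then show ?thesis using I_add[OF _ I_uminus] by fastforce
next
  case False
  define d where "d = (if - 1 * word_sign [x, y] = (1 :: 'f) then Sym else Skew)"
  have "word_sign [x, y] = (eps ^ (vwt x + vwt y) :: 'f)" "word_deg G [x, y] = g [^] (vwt x + vwt y)"
    using word_sign_eq[of "[x, y]"] word_deg_eq[of "[x, y]"] False by simp_all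
  then have deg: "var_deg x \<otimes> var_deg y = g [^] (vwt x + vwt y)"
    and d': "d = (if eps ^ (vwt x + vwt y) = (1 :: 'f) then Skew else Sym)"
    using assms var_deg_closed by (auto simp: d_def eps_def uminus_power_if split: if_splits)
  have "wt (g [^] k) (if eps ^ k = (1 :: 'f) then Skew else Sym) > 2" if "k \<le> 2" for k :: nat
  proof -
    from that consider "k = 0" | "k = 1" | "k = 2" by linarith
    then show ?thesis
      by cases (use degrees_distinct g_closed in
        \<open>auto simp: wt_def eps_def numeral_2_eq_2 power_Suc split: if_splits\<close>)
  qed
  from this[of "vwt x + vwt y"] False have "wt (var_deg x \<otimes> var_deg y) d > 2"
    by (simp add: deg d')
  then have "word [x] * word [y] + pm_scale (- 1) (word [y] * word [x]) \<in> I"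
    using assms var_deg_closed by (intro heavy_elements[OF bracket_signed_homog]) (auto simp: d_def)
  then show ?thesis by simp
qed

text \<open>The difference telescopes: exchanging \<open>x\<close> with the first letter costs a
  commutator, then \<open>x\<close> is moved through the rest.\<close>

lemma move_letter:
  "set (a @ x # b) \<subseteq> vars G \<Longrightarrow> word (x # a @ b) - word (a @ x # b) \<in> I"
proof (induction a)
  case (Cons y a)
  have "word (x # (y # a) @ b) - word ((y # a) @ x # b) =
     (word [x] * word [y] - word [y] * word [x]) * word (a @ b) +
     word [y] * (word (x # a @ b) - word (a @ x # b))"
    by (simp add: algebra_simps single_mult_single)
  also have "\<dots> \<in> I"
    using Cons commuting_letters by (intro I_add I_lmult I_rmult) auto
  finally show ?case .
qed (simp add: I_0)

lemma permuted_words: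
  "mset w = mset w' \<Longrightarrow> set w \<subseteq> vars G \<Longrightarrow> word w - word w' \<in> I"
proof (induction w arbitrary: w')
  case (Cons x u)
  then have "x \<in> set w'" by (metis list.set_intros(1) set_mset_mset)
  then obtain a b where w': "w' = a @ x # b" by (meson split_list)
  have vars: "set w' \<subseteq> vars G" using Cons.prems by (metis mset_eq_setD)
  have "word (x # u) - word w' = word [x] * (word u - word (a @ b)) + (word (x # a @ b) - word w')"
    by (simp add: algebra_simps single_mult_single)
  also have "\<dots> \<in> I"
    using Cons vars w' by (intro I_add I_lmult move_letter[of a x b, folded w']) auto
  finally show ?case .
qed (simp add: I_0)

text \<open>x(yz) is half of x(yz + zy) plus half of x(yz - zy). The anticommutator is symmetric of
  degree g^2, so the first is an instance of \<open>prod_12\<close>; the second contains a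
  commutator of letters.\<close>

lemma heavy_triple:
  assumes "x \<in> vars G" "y \<in> vars G" "z \<in> vars G" "vwt x = 1" "vwt y = 1" "vwt z = 1"
  shows "word [x] * (word [y] * word [z]) \<in> I"
proof -
  let ?b = "word [y] * word [z]" and ?c = "word [z] * word [y]"
  have yz: "var_deg y = g" "var_sym y = e" "var_deg z = g" "var_sym z = e" "var_deg x = g" "var_sym x = e"
    using assms by (auto simp: vwt_eq_iff)
  \<comment> \<open>Equal signs multiply to 1 for either value of \<open>e\<close>.\<close>
  then have "word_sign [y, z] = (1 :: 'f)" by (simp add: word_sign_def split: symmetry.split)
  then have "?b + pm_scale 1 ?c \<in> signed_homog F (var_deg y \<otimes> var_deg z) Sym"
    using assms by (intro bracket_signed_homog) auto
  then have "?b + ?c \<in> signed_homog F (g \<otimes> g) Sym" by (simp only: yz pm.scale_one)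
  moreover have "word [x] \<in> signed_homog F g e"
    using X_homog[OF assms(1), where ?'c = 'f] by (simp only: yz)
  ultimately have "word [x] * (?b + ?c) \<in> I"
    by (intro subst_product[OF _ _ prod_12])
  moreover have "word [x] * (?b - ?c) \<in> I"
    by (intro I_lmult commuting_letters) (use assms in simp_all)
  ultimately have "word [x] * (?b + ?c) + word [x] * (?b - ?c) \<in> I" by (rule I_add)
  then have "pm_scale (1 / 2) (word [x] * (?b + ?c) + word [x] * (?b - ?c)) \<in> I" by (rule I_scale)
  moreover have "word [x] * (?b + ?c) + word [x] * (?b - ?c) = pm_scale 2 (word [x] * ?b)"
    by (simp add: single_mult_single distrib_left right_diff_distrib pm_scale_single flip: single_add)
  ultimately show ?thesis by (simp add: single_mult_single pm_scale_single)
qed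

text \<open>Without letters of weight 0 the excess already shows in at most the first three letters;
  what follows is a factor on the right.\<close>

lemma heavy_words_nonzero:
  assumes "\<forall>x\<in>set w. x \<in> vars G \<and> vwt x \<noteq> 0" "mwt (mset w) > 2"
  shows "word w \<in> I"
\<comment> \<open>\<open>remdups_adj.cases\<close> supplies the split into lists of length 0, 1 and
  at least 2.\<close>
proof (cases w rule: remdups_adj.cases)
  case (2 x)
  then show ?thesis using assms heavy_letter by simp
next
  case (3 x y r)
  have carr: "word r \<in> carrier F" "word [x] \<in> carrier F" using assms(1) 3 by auto
  have w: "word w = (word [x] * word [y]) * word r" by (simp add: 3 single_mult_single)
  show ?thesis
  proof (cases "vwt x + vwt y > 2")
    case True
    then have "word [x] * word [y] \<in> I" using assms(1) 3 by (intro heavy_pair) simp_all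
    then show ?thesis unfolding w using carr(1) by (rule I_rmult)
  next
    case False
    then have xy: "vwt x = 1" "vwt y = 1" using assms(1) 3 by simp_all
    \<comment> \<open>The first two letters have total weight 2 only, so there is a third
      one.\<close>
    then obtain z r' where r: "r = z # r'" using assms(2) 3 by (cases r) simp_all
    have carr': "word r' \<in> carrier F" using assms(1) 3 r by auto
    have w: "word w = (word [x] * (word [y] * word [z])) * word r'"
      by (simp add: 3 r single_mult_single)
    have "word [x] * (word [y] * word [z]) \<in> I"
    proof (cases "vwt z = 1")
      case True
      then show ?thesis using xy assms(1) 3 r by (intro heavy_triple) simp_all
    next
      case False
      then have "word [y] * word [z] \<in> I" using xy assms(1) 3 r by (intro heavy_pair) simp_all
      then show ?thesis using carr(2) by (rule I_lmult)
    qed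
    then show ?thesis unfolding w using carr' by (rule I_rmult)
  qed
qed (use assms in simp)

text \<open>Modulo \<open>I\<close> the letters of weight 0 can be moved to the right end, where
  they split off as a factor.\<close>

lemma heavy_words:
  assumes "set w \<subseteq> vars G" "mwt (mset w) > 2"
  shows "word w \<in> I"
proof -
  let ?L = "filter (\<lambda>x. vwt x \<noteq> 0) w" and ?R = "filter (\<lambda>x. vwt x = 0) w"
  have mset: "mset w = mset (?L @ ?R)" by (induction w) auto
  then have "mwt (mset w) = mwt (mset ?L) + mwt (mset ?R)" by (metis mset_append mwt_simps(3))
  moreover have "mwt (mset ?R) = 0" by (induction w) auto
  ultimately have "mwt (mset ?L) > 2" using assms(2) by linarith
  then have "word ?L \<in> I"
    by (rule heavy_words_nonzero[rotated]) (use assms(1) in auto)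
  moreover have "word ?R \<in> carrier F" using assms(1) by auto
  ultimately have "word ?L * word ?R \<in> I" by (rule I_rmult)
  then have "word (?L @ ?R) \<in> I" by (simp only: single_mult_single mult_1)
  from I_add[OF permuted_words[OF mset assms(1)] this] show ?thesis by simp
qed

text \<open>Modulo \<open>I\<close> all words with the same letters agree, so \<open>p\<close> is
  congruent to the sum of \<open>msum M p\<close> times one chosen word per multiset
  \<open>M\<close>. Light multisets have coefficient 0, heavy ones give words in
  \<open>I\<close>.\<close>

lemma ids_subset: "ids \<subseteq> I"
proof
  fix p :: "('g, 'f) ncpoly" assume "p \<in> ids"
  then have vars: "\<And>w. w \<in> Poly_Mapping.keys p \<Longrightarrow> set w \<subseteq> vars G"
    and msum: "\<And>M. mwt M \<le> 2 \<Longrightarrow> msum M p = 0"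
    by (auto simp: ids_iff)
  let ?K = "Poly_Mapping.keys p" and ?c = "Poly_Mapping.lookup p"
  define rep where "rep M = (SOME w. mset w = M)" for M :: "'g var multiset"
  have rep: "mset (rep M) = M" for M unfolding rep_def by (rule someI_ex) (rule ex_mset)
  have "p = (\<Sum>w\<in>?K. pm_scale (?c w) (word w))"
    by (subst pm_sum_single) (simp add: pm_scale_single)
  also have "\<dots> = (\<Sum>w\<in>?K. pm_scale (?c w) (word w - word (rep (mset w)))) +
     (\<Sum>w\<in>?K. pm_scale (?c w) (word (rep (mset w))))"
    by (simp add: pm.scale_right_diff_distrib flip: sum.distrib)
  also have "(\<Sum>w\<in>?K. pm_scale (?c w) (word (rep (mset w)))) =
      (\<Sum>M\<in>mset ` ?K. \<Sum>w\<in>{w \<in> ?K. mset w = M}. pm_scale (?c w) (word (rep (mset w))))"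
    by (rule sum.image_gen) simp
  also have "\<dots> = (\<Sum>M\<in>mset ` ?K. pm_scale (msum M p) (word (rep M)))"
    by (intro sum.cong refl) (simp add: msum_eq pm.scale_sum_left)
  also have "(\<Sum>w\<in>?K. pm_scale (?c w) (word w - word (rep (mset w)))) +
      (\<Sum>M\<in>mset ` ?K. pm_scale (msum M p) (word (rep M))) \<in> I"
  proof (intro I_add I_sum)
    fix w assume "w \<in> ?K"
    then show "pm_scale (?c w) (word w - word (rep (mset w))) \<in> I"
      using vars rep by (intro I_scale permuted_words) auto
  next
    fix M assume "M \<in> mset ` ?K"
    then obtain w where w: "w \<in> ?K" "mset w = M" by auto
    then have "set (rep M) \<subseteq> vars G" using vars[of w] rep[of M] by (metis mset_eq_setD)
    then show "pm_scale (msum M p) (word (rep M)) \<in> I"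
      using msum[of M] heavy_words[of "rep M"] rep[of M]
      by (cases "mwt M \<le> 2") (auto intro: I_0 I_scale)
  qed
  finally show "p \<in> I" .
qed

end

lemma (in c3_grading) ids_eq_hull:
  fixes S :: "('g, 'f::field_char_0) ncpoly set"
  assumes sub: "S \<subseteq> ids"
    and "\<And>s d. s \<in> carrier G \<Longrightarrow> wt s d > 2 \<Longrightarrow> X 1 s d \<in> S"
    and "X 1 g e * X 2 (g \<otimes> g) Sym \<in> S" "X 1 (g \<otimes> g) Sym * X 2 (g \<otimes> g) Sym \<in> S"
  shows "ids = T_ideal G hull S"
proof
  show "ids \<subseteq> T_ideal G hull S"
    unfolding hull_def
  proof (rule Inter_greatest)
    fix I assume "I \<in> {I. T_ideal G I \<and> S \<subseteq> I}"
    then have I: "T_ideal G I" "S \<subseteq> I" by auto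
    interpret c3_T_ideal G g e I
      by unfold_locales (fact I(1), (rule subsetD[OF I(2)], fact assms)+)
    show "ids \<subseteq> I" by (rule ids_subset)
  qed
  show "T_ideal G hull S \<subseteq> ids"
    unfolding hull_def using sub T_ideal_ids by blast
qed


section \<open>Multilinear polynomials\<close>

lemma subspace_keys: "pm.subspace {p :: 'k \<Rightarrow>\<^sub>0 'f::field. \<forall>w\<in>Poly_Mapping.keys p. P w}"
proof (rule pm.subspaceI)
  fix x y :: "'k \<Rightarrow>\<^sub>0 'f" and c
  assume x: "x \<in> {p. \<forall>w\<in>Poly_Mapping.keys p. P w}"
  then show "pm_scale c x \<in> {p. \<forall>w\<in>Poly_Mapping.keys p. P w}"
    using keys_pm_scale_subset[of c x] by auto
  assume "y \<in> {p. \<forall>w\<in>Poly_Mapping.keys p. P w}"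
  with x show "x + y \<in> {p. \<forall>w\<in>Poly_Mapping.keys p. P w}"
    using keys_add[of x y] by auto
qed simp

text \<open>Turns membership in the spaces of multilinear polynomials, which are defined as spans of
  words, into a condition on keys.\<close>

lemma span_singles:
  "pm.span {Poly_Mapping.single w 1 | w. P w} = {p :: 'k \<Rightarrow>\<^sub>0 'f::field. \<forall>w\<in>Poly_Mapping.keys p. P w}"
proof (intro Set.equalityI Set.subsetI)
  fix p :: "'k \<Rightarrow>\<^sub>0 'f" assume "p \<in> {p. \<forall>w\<in>Poly_Mapping.keys p. P w}"
  then have "(\<Sum>w\<in>Poly_Mapping.keys p. pm_scale (Poly_Mapping.lookup p w) (Poly_Mapping.single w 1))
      \<in> pm.span {Poly_Mapping.single w 1 | w. P w}"
    by (intro pm.span_sum pm.span_scale pm.span_base) auto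
  then show "p \<in> pm.span {Poly_Mapping.single w 1 | w. P w}"
    by (simp add: pm_scale_single flip: pm_sum_single)
next
  fix p :: "'k \<Rightarrow>\<^sub>0 'f" assume "p \<in> pm.span {Poly_Mapping.single w 1 | w. P w}"
  moreover have "pm.span {Poly_Mapping.single w 1 | w. P w} \<subseteq> {p :: 'k \<Rightarrow>\<^sub>0 'f. \<forall>w\<in>Poly_Mapping.keys p. P w}"
    by (intro pm.span_minimal subspace_keys) auto
  ultimately show "p \<in> {p. \<forall>w\<in>Poly_Mapping.keys p. P w}" by blast
qed

definition multi_vars :: "('g, 'm) monoid_scheme \<Rightarrow> ('g \<times> symmetry \<Rightarrow> nat) \<Rightarrow> 'g var set" where
  "multi_vars G \<nu> = {Var i s d | i s d. s \<in> carrier G \<and> 1 \<le> i \<and> i \<le> \<nu> (s, d)}"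

lemma P_multi_eq:
  "P_multi G \<nu> = {p :: ('g, 'f::field) ncpoly. \<forall>w\<in>Poly_Mapping.keys p. distinct w \<and> set w = multi_vars G \<nu>}"
  unfolding P_multi_def multi_vars_def[symmetric] by (rule span_singles)

lemma multi_vars_subset: "multi_vars G \<nu> \<subseteq> vars G"
  by (auto simp: multi_vars_def vars_def)

lemma finite_symmetry: "finite (UNIV :: symmetry set)"
proof -
  have "(UNIV :: symmetry set) = {Sym, Skew}" using symmetry.exhaust by blast
  then show ?thesis by (metis finite.emptyI finite.insertI)
qed

lemma finite_var_types: "finite (carrier G) \<Longrightarrow> finite (var_types G)"
  by (simp add: var_types_def finite_symmetry)

lemma multi_vars_image:
  "multi_vars G \<nu> = (\<lambda>(t, i). Var i (fst t) (snd t)) ` (SIGMA t:var_types G. {1..\<nu> t})"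
  by (force simp: multi_vars_def var_types_def)

lemma finite_multi_vars: "finite (carrier G) \<Longrightarrow> finite (multi_vars G \<nu>)"
  by (simp add: multi_vars_image finite_var_types)

lemma finite_compositions:
  assumes "finite (carrier G)"
  shows "finite (compositions G n)"
proof (rule finite_subset)
  show "compositions G n \<subseteq> {\<nu>. \<forall>t. (t \<in> var_types G \<longrightarrow> \<nu> t \<in> {..n}) \<and> (t \<notin> var_types G \<longrightarrow> \<nu> t = 0)}"
    using member_le_sum[OF _ _ finite_var_types[OF assms], where f = "\<nu> :: _ \<Rightarrow> nat" for \<nu>]
    by (auto simp: compositions_def)
  show "finite {\<nu>. \<forall>t. (t \<in> var_types G \<longrightarrow> \<nu> t \<in> {..n}) \<and> (t \<notin> var_types G \<longrightarrow> \<nu> t = 0)}"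
    by (rule finite_set_of_finite_funs) (simp_all add: finite_var_types assms)
qed

lemma group_young_group: "group (young_group G \<nu>)"
  unfolding young_group_def by (rule product_group) (rule sym_group_is_group)

lemma young_group_permutes:
  assumes "\<pi> \<in> carrier (young_group G \<nu>)" "t \<in> var_types G"
  shows "\<pi> t permutes {1..\<nu> t}"
  using assms by (auto simp: young_group_def sym_group_def PiE_def)

lemma var_act_image:
  assumes "finite (carrier G)" and \<pi>: "\<pi> \<in> carrier (young_group G \<nu>)"
  shows "inj_on (var_act \<pi>) (multi_vars G \<nu>)" "var_act \<pi> ` multi_vars G \<nu> = multi_vars G \<nu>"
proof -
  have perm: "\<pi> (s, d) permutes {1..\<nu> (s, d)}" if "s \<in> carrier G" for s d
    using young_group_permutes[OF \<pi>] that by (simp add: var_types_def)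
  show inj: "inj_on (var_act \<pi>) (multi_vars G \<nu>)"
  proof (rule inj_onI)
    fix x y assume "x \<in> multi_vars G \<nu>" "y \<in> multi_vars G \<nu>" "var_act \<pi> x = var_act \<pi> y"
    then obtain i j s d where x: "x = Var i s d" "y = Var j s d" "s \<in> carrier G" "\<pi> (s, d) i = \<pi> (s, d) j"
      by (auto simp: multi_vars_def)
    then show "x = y" using injD[OF permutes_inj[OF perm[of s d]]] by auto
  qed
  have "var_act \<pi> x \<in> multi_vars G \<nu>" if x: "x \<in> multi_vars G \<nu>" for x
  proof -
    obtain i s d where i: "x = Var i s d" "s \<in> carrier G" "i \<in> {1..\<nu> (s, d)}"
      using x by (auto simp: multi_vars_def)
    then have "\<pi> (s, d) i \<in> {1..\<nu> (s, d)}" using permutes_in_image[OF perm[of s d]] by blast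
    then show ?thesis using i by (auto simp: multi_vars_def)
  qed
  then show "var_act \<pi> ` multi_vars G \<nu> = multi_vars G \<nu>"
    using finite_multi_vars[OF assms(1)] inj by (intro endo_inj_surj) auto
qed

text \<open>Weight 3 excludes all other types, and \<open>\<nu> b + 2 * \<nu> c \<le> 2\<close> has
  exactly four solutions; \<open>\<nu> a\<close> is then fixed by the total
  \<open>n\<close>.\<close>

lemma light_compositions:
  fixes \<nu> W :: "'t \<Rightarrow> nat"
  assumes T: "finite T" "a \<in> T" "b \<in> T" "c \<in> T" and neq: "a \<noteq> b" "a \<noteq> c" "b \<noteq> c"
    and W: "W a = 0" "W b = 1" "W c = 2" "\<And>t. t \<notin> {a, b, c} \<Longrightarrow> W t = 3" and n: "n \<ge> 2"
  shows "(\<forall>t. t \<notin> T \<longrightarrow> \<nu> t = 0) \<and> sum \<nu> T = n \<and> (\<Sum>t\<in>T. \<nu> t * W t) \<le> 2 \<longleftrightarrow>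
    \<nu> \<in> {(\<lambda>_. 0)(a := n), (\<lambda>_. 0)(a := n - 1, b := 1), (\<lambda>_. 0)(a := n - 2, b := 2), (\<lambda>_. 0)(a := n - 1, c := 1)}"
    (is "?L \<longleftrightarrow> ?R")
proof -
  have sum: "sum f T = f a + f b + f c" if "\<And>t. t \<notin> {a, b, c} \<Longrightarrow> f t = 0" for f :: "'t \<Rightarrow> nat"
  proof -
    have "sum f T = sum f {a, b, c}"
      using T that by (intro sum.mono_neutral_right) auto
    then show ?thesis using neq by simp
  qed
  have sums: "sum \<nu> T = \<nu> a + \<nu> b + \<nu> c" "(\<Sum>t\<in>T. \<nu> t * W t) = \<nu> b + 2 * \<nu> c"
    if "\<And>t. t \<notin> {a, b, c} \<Longrightarrow> \<nu> t = 0"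
    using sum[of \<nu>] sum[of "\<lambda>t. \<nu> t * W t"] that W(1-3) by simp_all
  show ?thesis
  proof
    assume L: ?L
    have 0: "\<nu> t = 0" if t: "t \<notin> {a, b, c}" for t
    proof (cases "t \<in> T")
      case True
      have "\<nu> t * W t \<le> (\<Sum>t\<in>T. \<nu> t * W t)" by (rule member_le_sum[OF True _ T(1)]) simp
      then show ?thesis using L W(4)[OF t] by simp
    qed (use L in blast)
    have n: "\<nu> a + \<nu> b + \<nu> c = n" and "\<nu> b + 2 * \<nu> c \<le> 2" using L sums[OF 0] by simp_all
    then have "\<nu> c = 0 \<and> \<nu> b = 0 \<or> \<nu> c = 0 \<and> \<nu> b = 1 \<or> \<nu> c = 0 \<and> \<nu> b = 2 \<or> \<nu> c = 1 \<and> \<nu> b = 0"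
      by presburger
    with n consider "\<nu> b = 0" "\<nu> c = 0" "\<nu> a = n" | "\<nu> b = 1" "\<nu> c = 0" "\<nu> a = n - 1"
      | "\<nu> b = 2" "\<nu> c = 0" "\<nu> a = n - 2" | "\<nu> b = 0" "\<nu> c = 1" "\<nu> a = n - 1"
      by (elim disjE conjE) simp_all
    then show ?R
    proof cases
      case 1
      then have "\<nu> = (\<lambda>_. 0)(a := n)" using 0 neq by (intro ext) auto
      then show ?thesis by simp
    next
      case 2
      then have "\<nu> = (\<lambda>_. 0)(a := n - 1, b := 1)" using 0 neq by (intro ext) auto
      then show ?thesis by simp
    next
      case 3
      then have "\<nu> = (\<lambda>_. 0)(a := n - 2, b := 2)" using 0 neq by (intro ext) auto
      then show ?thesis by simp
    next
      case 4
      then have "\<nu> = (\<lambda>_. 0)(a := n - 1, c := 1)" using 0 neq by (intro ext) auto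
      then show ?thesis by simp
    qed
  next
    assume R: ?R
    then have 0: "\<nu> t = 0" if "t \<notin> {a, b, c}" for t using that by auto
    \<comment> \<open>\<open>n \<ge> 2\<close> makes the subtraction \<open>n - 2\<close>
      exact.\<close>
    have "\<nu> a + \<nu> b + \<nu> c = n" "\<nu> b + 2 * \<nu> c \<le> 2" using R neq n by auto
    moreover have "\<forall>t. t \<notin> T \<longrightarrow> \<nu> t = 0"
    proof (intro allI impI)
      fix t assume "t \<notin> T"
      then have "t \<notin> {a, b, c}" using T(2-4) by auto
      then show "\<nu> t = 0" by (rule 0)
    qed
    ultimately show ?L using sums[OF 0] by simp
  qed
qed

section \<open>Cocharacters and colengths\<close>

context c3_grading
begin

definition cwt :: "('g \<times> symmetry \<Rightarrow> nat) \<Rightarrow> nat" where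
  "cwt \<nu> = mwt (mset_set (multi_vars G \<nu>))"

lemma cwt_eq:
  assumes "finite (carrier G)"
  shows "cwt \<nu> = (\<Sum>t\<in>var_types G. \<nu> t * wt (fst t) (snd t))"
proof -
  have "cwt \<nu> = (\<Sum>x\<in>multi_vars G \<nu>. vwt x)"
    by (simp add: cwt_def mwt_def sum_unfold_sum_mset)
  also have "\<dots> = (\<Sum>(t, i)\<in>(SIGMA t:var_types G. {1..\<nu> t}). wt (fst t) (snd t))"
    unfolding multi_vars_image by (subst sum.reindex) (auto simp: inj_on_def vwt_def intro!: sum.cong)
  also have "\<dots> = (\<Sum>t\<in>var_types G. \<Sum>i\<in>{1..\<nu> t}. wt (fst t) (snd t))"
    by (rule sum.Sigma[symmetric]) (simp_all add: finite_var_types assms)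
  finally show ?thesis by simp
qed

text \<open>All words of \<open>P_multi\<close> have the same letters, so a single coefficient sum
  decides membership in \<open>ids\<close>; when the weight is too large everything is an identity
  and the index set is empty.\<close>

lemma dual_functionals_P_multi:
  assumes fin: "finite (carrier G)" and w: "distinct w" "set w = multi_vars G \<nu>"
  shows "dual_functionals (P_multi G \<nu> :: ('g, 'f::field_char_0) ncpoly set) (P_multi G \<nu> \<inter> ids)
    (if cwt \<nu> \<le> 2 then {()} else {}) (\<lambda>_. msum (mset_set (multi_vars G \<nu>))) (\<lambda>_. Poly_Mapping.single w 1)"
proof
  let ?M = "mset_set (multi_vars G \<nu>)"
  have mset: "mset u = ?M" if "distinct u" "set u = multi_vars G \<nu>" for u
    using that by (metis mset_set_set)
  show "pm.subspace (P_multi G \<nu>)" unfolding P_multi_eq by (rule subspace_keys)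
  show "msum ?M (p + q) = msum ?M p + msum ?M q" for p q :: "('g, 'f) ncpoly"
    by (rule additive.add[OF additive_msum])
  fix p :: "('g, 'f) ncpoly" assume p: "p \<in> P_multi G \<nu>"
  have other: "msum N p = 0" if "N \<noteq> ?M" for N
  proof -
    have "{w \<in> Poly_Mapping.keys p. mset w = N} = {}"
      using p mset that by (auto simp: P_multi_eq)
    then show ?thesis by (simp only: msum_eq sum.empty)
  qed
  have "(\<forall>M. mwt M \<le> 2 \<longrightarrow> msum M p = 0) \<longleftrightarrow> (cwt \<nu> \<le> 2 \<longrightarrow> msum ?M p = 0)"
    unfolding cwt_def using other by metis
  moreover have "p \<in> carrier (free_gs_algebra G)"
    using p multi_vars_subset[of G \<nu>] by (auto simp: P_multi_eq)
  ultimately have "p \<in> ids \<longleftrightarrow> (cwt \<nu> \<le> 2 \<longrightarrow> msum ?M p = 0)"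
    unfolding ids_iff by blast
  then show "p \<in> P_multi G \<nu> \<inter> ids \<longleftrightarrow> (\<forall>i\<in>if cwt \<nu> \<le> 2 then {()} else {}. msum ?M p = 0)"
    using p by simp
next
  show "Poly_Mapping.single w 1 \<in> P_multi G \<nu>" using w by (simp add: P_multi_eq)
qed (use w in \<open>simp_all add: msum_scale msum_single mset_set_set[symmetric]\<close>)

text \<open>An element of the Young subgroup permutes the letters among themselves, so it preserves
  the coefficient sum and acts trivially on a quotient of dimension 1 or 0.\<close>

lemma cocharacter_eq:
  fixes A :: "('f::field_char_0, 'a, 'g) gs_algebra"
  assumes fin: "finite (carrier G)" and A: "Id_sharp G A = ids"
  shows "cocharacter G A \<nu> = (\<lambda>\<pi>\<in>carrier (young_group G \<nu>). if cwt \<nu> \<le> 2 then 1 else 0)"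
proof -
  obtain w where w: "set w = multi_vars G \<nu>" "distinct w"
    using finite_distinct_list[OF finite_multi_vars[OF fin]] by blast
  let ?V = "P_multi G \<nu> :: ('g, 'f) ncpoly set"
  interpret dual_functionals ?V "?V \<inter> ids" "if cwt \<nu> \<le> 2 then {()} else {}"
    "\<lambda>_. msum (mset_set (multi_vars G \<nu>))" "\<lambda>_. Poly_Mapping.single w 1"
    using fin w(2,1) by (rule dual_functionals_P_multi)
  have "quot_trace ?V (?V \<inter> ids) (pm_rename (map (var_act \<pi>))) =
      of_nat (card (if cwt \<nu> \<le> 2 then {()} else {}))"
    if \<pi>: "\<pi> \<in> carrier (young_group G \<nu>)" for \<pi>
  proof (rule quot_trace_eq)
    fix p :: "('g, 'f) ncpoly" assume "p \<in> ?V"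
    then have p: "distinct w \<and> set w = multi_vars G \<nu>" if "w \<in> Poly_Mapping.keys p" for w
      using that by (simp add: P_multi_eq)
    have act: "distinct (map (var_act \<pi>) w) \<and> set (map (var_act \<pi>) w) = multi_vars G \<nu>"
      if "w \<in> Poly_Mapping.keys p" for w
      using p[OF that] var_act_image[OF fin \<pi>] by (simp add: distinct_map)
    show "pm_rename (map (var_act \<pi>)) p \<in> ?V"
      unfolding pm_rename_def
    proof (rule pm.subspace_sum[OF subspace_V])
      fix w assume "w \<in> Poly_Mapping.keys p"
      then show "Poly_Mapping.single (map (var_act \<pi>) w) (Poly_Mapping.lookup p w) \<in> ?V"
        using act by (simp add: P_multi_eq)
    qed
    show "msum (mset_set (multi_vars G \<nu>)) (pm_rename (map (var_act \<pi>)) p) = msum (mset_set (multi_vars G \<nu>)) p"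
    proof (rule additive_pm_eq[of "\<lambda>p. msum (mset_set (multi_vars G \<nu>)) (pm_rename (map (var_act \<pi>)) p)"
          "msum (mset_set (multi_vars G \<nu>))"])
      fix w c assume w: "w \<in> Poly_Mapping.keys p"
      have "mset w = mset_set (multi_vars G \<nu>)" "mset (map (var_act \<pi>) w) = mset_set (multi_vars G \<nu>)"
        using p[OF w] act[OF w] by (metis mset_set_set)+
      then show "msum (mset_set (multi_vars G \<nu>)) (pm_rename (map (var_act \<pi>)) (Poly_Mapping.single w c)) =
          msum (mset_set (multi_vars G \<nu>)) (Poly_Mapping.single w c)"
        by (simp only: pm_rename_single msum_single)
    qed (simp_all add: additive_def additive.add[OF additive_msum] additive.add[OF additive_pm_rename])
  qed
  then show ?thesis by (auto simp: cocharacter_def A fun_eq_iff)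
qed

definition shapes :: "nat \<Rightarrow> ('g \<times> symmetry \<Rightarrow> nat list) set" where
  "shapes n = {no_parts((\<one>, Sym) := [n]), no_parts((\<one>, Sym) := [n - 1], (g, e) := [1]),
     no_parts((\<one>, Sym) := [n - 2], (g, e) := [2]),
     no_parts((\<one>, Sym) := [n - 1], (g \<otimes> g, Sym) := [1])}"

lemma sum_list_upd:
  "(\<lambda>t. sum_list ((\<Lambda>(t' := \<kappa>)) t)) = (\<lambda>t. sum_list (\<Lambda> t))(t' := sum_list \<kappa>)"
  by auto

lemma shapes_compositions:
  assumes fin: "finite (carrier G)" and n: "n \<ge> 2"
  shows "{\<nu> \<in> compositions G n. cwt \<nu> \<le> 2} = (\<lambda>\<Lambda> t. sum_list (\<Lambda> t)) ` shapes n"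
proof -
  let ?T = "var_types G" and ?a = "(\<one>, Sym)" and ?b = "(g, e)" and ?c = "(g \<otimes> g, Sym)"
  have 1: "\<nu> \<in> compositions G n \<and> cwt \<nu> \<le> 2 \<longleftrightarrow>
      (\<forall>t. t \<notin> ?T \<longrightarrow> \<nu> t = 0) \<and> sum \<nu> ?T = n \<and> (\<Sum>t\<in>?T. \<nu> t * (\<lambda>(s, d). wt s d) t) \<le> 2" for \<nu>
    unfolding cwt_eq[OF fin] compositions_def mem_Collect_eq case_prod_unfold by (rule conj_assoc)
  have 2: "(\<forall>t. t \<notin> ?T \<longrightarrow> \<nu> t = 0) \<and> sum \<nu> ?T = n \<and> (\<Sum>t\<in>?T. \<nu> t * (\<lambda>(s, d). wt s d) t) \<le> 2 \<longleftrightarrow>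
      \<nu> \<in> {(\<lambda>_. 0)(?a := n), (\<lambda>_. 0)(?a := n - 1, ?b := 1), (\<lambda>_. 0)(?a := n - 2, ?b := 2),
       (\<lambda>_. 0)(?a := n - 1, ?c := 1)}" for \<nu>
  proof (rule light_compositions)
    show "(\<lambda>(s, d). wt s d) t = 3" if "t \<notin> {?a, ?b, ?c}" for t
      using that by (cases t) (auto simp: wt_def)
  qed (use degrees_distinct g_closed n in \<open>auto simp: wt_def var_types_def finite_symmetry fin\<close>)
  have 3: "(\<lambda>\<Lambda> t. sum_list (\<Lambda> t)) ` shapes n =
      {(\<lambda>_. 0)(?a := n), (\<lambda>_. 0)(?a := n - 1, ?b := 1), (\<lambda>_. 0)(?a := n - 2, ?b := 2),
       (\<lambda>_. 0)(?a := n - 1, ?c := 1)}"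
    by (simp only: shapes_def image_insert image_empty sum_list_upd sum_list.Nil sum_list.Cons add_0_right)
  show ?thesis by (intro Set.set_eqI) (simp only: mem_Collect_eq 1 2 3)
qed

lemma card_shapes_compositions:
  "card ((\<lambda>\<Lambda> t. sum_list (\<Lambda> t)) ` shapes n) = 4"
proof -
  \<comment> \<open>These two values already tell the four compositions apart.\<close>
  let ?h = "\<lambda>\<nu>. (\<nu> (g, e), \<nu> (g \<otimes> g, Sym)) :: nat \<times> nat"
  let ?S = "(\<lambda>\<Lambda> t. sum_list (\<Lambda> t)) ` shapes n"
  have "?h ` ?S = {(0, 0), (1, 0), (2, 0), (0, 1)}"
    using degrees_distinct by (auto simp: shapes_def)
  then have "card (?h ` ?S) = 4" by simp
  moreover have "card (?h ` ?S) \<le> card ?S" by (rule card_image_le) (simp add: shapes_def)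
  moreover have "card ?S \<le> card (shapes n)" by (rule card_image_le) (simp add: shapes_def)
  moreover have "card (shapes n) \<le> 4"
    by (auto simp: shapes_def card_insert_if)
  ultimately show ?thesis by linarith
qed

text \<open>Every partition in \<open>shapes\<close> has at most one row, so all factors of the
  product are trivial characters.\<close>

lemma outer_char_shapes:
  assumes "\<Lambda> \<in> shapes n"
  shows "outer_char G \<Lambda> = (\<lambda>t. sum_list (\<Lambda> t),
    \<lambda>\<pi>\<in>carrier (young_group G (\<lambda>t. sum_list (\<Lambda> t))). 1 :: 'f::field)"
proof -
  have row: "\<Lambda> t = [] \<or> (\<exists>k. \<Lambda> t = [k])" for t
  proof -
    have "length (\<Lambda> t) \<le> 1" using assms by (auto simp: shapes_def)
    then show ?thesis by (cases "\<Lambda> t") auto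
  qed
  have "(\<Prod>t\<in>var_types G. sym_char (\<Lambda> t) (\<pi> t)) = (1 :: 'f)"
    if \<pi>: "\<pi> \<in> carrier (young_group G (\<lambda>t. sum_list (\<Lambda> t)))" for \<pi>
  proof (rule prod.neutral, rule ballI)
    fix t assume "t \<in> var_types G"
    then have "\<pi> t permutes {1..sum_list (\<Lambda> t)}" by (rule young_group_permutes[OF \<pi>])
    then show "sym_char (\<Lambda> t) (\<pi> t) = (1 :: 'f)"
      using row[of t] sym_char_single[of "\<pi> t"] sym_char_Nil[of "\<pi> t"] by auto
  qed
  then show ?thesis by (simp add: outer_char_def Let_def cong: restrict_cong)
qed

lemma nonzero_cocharacters_eq:
  fixes A :: "('f::field_char_0, 'a, 'g) gs_algebra"
  assumes fin: "finite (carrier G)" and A: "Id_sharp G A = ids" and n: "n \<ge> 2"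
  shows "nonzero_cocharacters G A n = outer_char G ` shapes n"
proof -
  \<comment> \<open>The constant 1 counts as a nonzero character since the group contains its
    unit.\<close>
  have ne: "carrier (young_group G \<nu>) \<noteq> {}" for \<nu>
    using group.is_monoid[OF group_young_group] monoid.one_closed by fastforce
  have nonzero: "(\<exists>\<pi>\<in>carrier (young_group G \<nu>).
      (\<lambda>\<pi>\<in>carrier (young_group G \<nu>). if cwt \<nu> \<le> 2 then 1 else 0) \<pi> \<noteq> (0 :: 'f)) \<longleftrightarrow> cwt \<nu> \<le> 2" for \<nu>
    using ne[of \<nu>] by auto
  have "nonzero_cocharacters G A n =
      (\<lambda>\<nu>. (\<nu>, \<lambda>\<pi>\<in>carrier (young_group G \<nu>). 1 :: 'f)) ` {\<nu> \<in> compositions G n. cwt \<nu> \<le> 2}"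
    unfolding nonzero_cocharacters_def cocharacter_eq[OF fin A] nonzero setcompr_eq_image
    by (intro image_cong) (auto cong: restrict_cong)
  also have "\<dots> = outer_char G ` shapes n"
    unfolding shapes_compositions[OF fin n] image_image
    by (intro image_cong refl) (simp add: outer_char_shapes)
  finally show ?thesis .
qed

lemma colength_eq:
  fixes A :: "('f::field_char_0, 'a, 'g) gs_algebra"
  assumes fin: "finite (carrier G)" and A: "Id_sharp G A = ids" and n: "n \<ge> 2"
  shows "colength G A n = 4"
proof -
  have "num_constituents (young_group G \<nu>) (cocharacter G A \<nu>) = (if cwt \<nu> \<le> 2 then 1 else 0)" for \<nu>
    by (rule num_constituents_trivial) (simp_all add: group_young_group cocharacter_eq[OF fin A])
  then have "colength G A n = card {\<nu> \<in> compositions G n. cwt \<nu> \<le> 2}"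
    by (simp add: colength_def sum.If_cases finite_compositions fin Collect_conj_eq Int_commute)
  then show ?thesis by (simp add: shapes_compositions[OF fin n] card_shapes_compositions)
qed


section \<open>Codimensions\<close>

text \<open>A multilinear monomial of weight at most 2 is given, up to the order of its factors, by the
  sets of indices of its variables of degree \<open>g\<close> and of degree \<open>g\<^sup>2\<close>.\<close>

definition patterns :: "nat \<Rightarrow> (nat set \<times> nat set) set" where
  "patterns n = {(P, Q). P \<subseteq> {1..n} \<and> Q \<subseteq> {1..n} \<and> P \<inter> Q = {} \<and> card P + 2 * card Q \<le> 2}"

text \<open>Either \<open>Q\<close> is empty and \<open>P\<close> has at most two elements, or
  \<open>P\<close> is empty and \<open>Q\<close> is a singleton: 1 + n + (n choose 2) possibilities
  and n more.\<close>

lemma card_patterns: "card (patterns n) = 1 + 2 * n + (n choose 2)"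
proof -
  let ?S = "\<lambda>k. {P. P \<subseteq> {1..n} \<and> card P = k}"
  have fin: "finite (?S k)" for k by (rule finite_subset[of _ "Pow {1..n}"]) auto
  have card: "card (?S k) = n choose k" for k using n_subsets[of "{1..n}" k] by simp
  have "patterns n = (\<lambda>P. (P, {})) ` (?S 0 \<union> ?S 1 \<union> ?S 2) \<union> (\<lambda>Q. ({}, Q)) ` ?S 1"
  proof (intro Set.equalityI Set.subsetI)
    fix x assume "x \<in> patterns n"
    then obtain P Q where x: "x = (P, Q)" "P \<subseteq> {1..n}" "Q \<subseteq> {1..n}" "card P + 2 * card Q \<le> 2"
      by (auto simp: patterns_def)
    then have fin: "finite P" "finite Q" by (auto intro: finite_subset)
    consider "card Q = 0" "card P \<in> {0, 1, 2}" | "card Q = 1" "card P = 0" using x(4) by fastforce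
    then show "x \<in> (\<lambda>P. (P, {})) ` (?S 0 \<union> ?S 1 \<union> ?S 2) \<union> (\<lambda>Q. ({}, Q)) ` ?S 1"
      using x fin by cases (auto simp: image_iff)
  next
    fix x assume "x \<in> (\<lambda>P. (P, {})) ` (?S 0 \<union> ?S 1 \<union> ?S 2) \<union> (\<lambda>Q. ({}, Q)) ` ?S 1"
    then show "x \<in> patterns n" by (auto simp: patterns_def)
  qed
  moreover have "card ((\<lambda>P. (P, {} :: nat set)) ` (?S 0 \<union> ?S 1 \<union> ?S 2)) = card (?S 0 \<union> ?S 1 \<union> ?S 2)"
    by (rule card_image) (auto simp: inj_on_def)
  moreover have "?S 0 \<inter> ?S 1 = {}" "(?S 0 \<union> ?S 1) \<inter> ?S 2 = {}" by auto
  then have "card (?S 0 \<union> ?S 1 \<union> ?S 2) = card (?S 0) + card (?S 1) + card (?S 2)"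
    using card_Un_disjoint[OF fin[of 0] fin[of 1]] card_Un_disjoint[OF finite_UnI[OF fin[of 0] fin[of 1]] fin[of 2]]
    by (simp only:)
  moreover have "card ((\<lambda>Q. ({} :: nat set, Q)) ` ?S 1) = card (?S 1)"
    by (rule card_image) (auto simp: inj_on_def)
  moreover have "(\<lambda>P. (P, {})) ` (?S 0 \<union> ?S 1 \<union> ?S 2) \<inter> (\<lambda>Q. ({}, Q)) ` ?S 1 = {}" by auto
  then have "card ((\<lambda>P. (P, {})) ` (?S 0 \<union> ?S 1 \<union> ?S 2) \<union> (\<lambda>Q. ({}, Q)) ` ?S 1) =
      card ((\<lambda>P. (P, {} :: nat set)) ` (?S 0 \<union> ?S 1 \<union> ?S 2)) + card ((\<lambda>Q. ({} :: nat set, Q)) ` ?S 1)"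
    by (intro card_Un_disjoint finite_imageI finite_UnI fin)
  ultimately have "card (patterns n) = (n choose 0) + (n choose 1) + (n choose 2) + (n choose 1)"
    by (simp only: card)
  then show ?thesis by simp
qed

definition letter :: "nat set \<times> nat set \<Rightarrow> nat \<Rightarrow> 'g var" where
  "letter j i = (if i \<in> fst j then Var i g e else if i \<in> snd j then Var i (g \<otimes> g) Sym else Var i \<one> Sym)"

definition pattern_mset :: "nat \<Rightarrow> nat set \<times> nat set \<Rightarrow> 'g var multiset" where
  "pattern_mset n j = image_mset (letter j) (mset_set {1..n})"

lemma vwt_letter: "vwt (letter j i) = (if i \<in> fst j then 1 else if i \<in> snd j then 2 else 0)"
  using degrees_distinct by (auto simp: letter_def vwt_def wt_def)

lemma mwt_image: "mwt (image_mset f (mset_set S)) = (\<Sum>i\<in>S. vwt (f i))"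
  by (simp add: mwt_def sum_unfold_sum_mset multiset.map_comp comp_def)

lemma mwt_pattern:
  assumes "j \<in> patterns n"
  shows "mwt (pattern_mset n j) \<le> 2"
proof -
  obtain P Q where j: "j = (P, Q)" "P \<subseteq> {1..n}" "Q \<subseteq> {1..n}" "P \<inter> Q = {}" "card P + 2 * card Q \<le> 2"
    using assms by (auto simp: patterns_def)
  have "mwt (pattern_mset n j) = (\<Sum>i\<in>{1..n}. (if i \<in> P then 1 else 0) + (if i \<in> Q then 2 else 0))"
    unfolding pattern_mset_def mwt_image using j(1,4) by (intro sum.cong) (auto simp: vwt_letter)
  also have "\<dots> = card P + 2 * card Q"
    using j(2,3) by (simp add: sum.distrib Int_absorb1 flip: sum.inter_restrict)
  finally show ?thesis using j(5) by simp
qed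

text \<open>A variable carries its index, so the multiset shows which letter stands at each index;
  the weights 1 and 2 of the letters recover the two sets.\<close>

lemma pattern_mset_inject:
  assumes "i \<in> patterns n" "j \<in> patterns n" "pattern_mset n i = pattern_mset n j"
  shows "i = j"
proof -
  have "letter i k = letter j k" if k: "k \<in> {1..n}" for k
  proof -
    have "letter i k \<in># pattern_mset n j" using k unfolding assms(3)[symmetric] by (simp add: pattern_mset_def)
    then obtain l where "letter i k = letter j l" by (auto simp: pattern_mset_def)
    then show ?thesis by (auto simp: letter_def split: if_splits)
  qed
  then have eq: "vwt (letter i k) = vwt (letter j k)" if "k \<in> {1..n}" for k using that by simp
  obtain P Q where i: "i = (P, Q)" "P \<subseteq> {1..n}" "Q \<subseteq> {1..n}" "P \<inter> Q = {}"
    using assms(1) by (auto simp: patterns_def)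
  obtain P' Q' where j: "j = (P', Q')" "P' \<subseteq> {1..n}" "Q' \<subseteq> {1..n}" "P' \<inter> Q' = {}"
    using assms(2) by (auto simp: patterns_def)
  have "(k \<in> P \<longleftrightarrow> k \<in> P') \<and> (k \<in> Q \<longleftrightarrow> k \<in> Q')" if k: "k \<in> {1..n}" for k
  proof -
    have "\<not> (k \<in> P \<and> k \<in> Q)" "\<not> (k \<in> P' \<and> k \<in> Q')" using i(4) j(4) by auto
    with eq[OF k] show ?thesis unfolding vwt_letter i(1) j(1) fst_conv snd_conv
      by (simp split: if_splits)
  qed
  then have "P = P'" "Q = Q'" using i(2,3) j(2,3) by blast+
  then show ?thesis by (simp add: i(1) j(1))
qed

text \<open>The two sets collect the indices of the letters of weight 1 and 2. A total of at most 2
  leaves weight 0 for all other letters, and the weight determines a letter up to its index.\<close>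

lemma pattern_exhaust:
  assumes w: "\<forall>i\<in>{1..n}. \<exists>s\<in>carrier G. \<exists>d. w i = Var i s d"
    and wt: "mwt (image_mset w (mset_set {1..n})) \<le> 2"
  shows "\<exists>j\<in>patterns n. image_mset w (mset_set {1..n}) = pattern_mset n j"
proof -
  define P where "P = {i \<in> {1..n}. vwt (w i) = 1}"
  define Q where "Q = {i \<in> {1..n}. vwt (w i) = 2}"
  have sub: "P \<subseteq> {1..n}" "Q \<subseteq> {1..n}" by (auto simp: P_def Q_def)
  have sum: "(\<Sum>i\<in>{1..n}. vwt (w i)) \<le> 2" using wt by (simp add: mwt_image)
  have "card P + 2 * card Q = (\<Sum>i\<in>{1..n}. (if i \<in> P then 1 else 0) + (if i \<in> Q then 2 else 0))"
    using sub by (simp add: sum.distrib Int_absorb1 flip: sum.inter_restrict)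
  also have "\<dots> \<le> (\<Sum>i\<in>{1..n}. vwt (w i))"
    by (rule sum_mono) (auto simp: P_def Q_def)
  finally have "(P, Q) \<in> patterns n" using sum by (auto simp: patterns_def P_def Q_def)
  moreover have "w i = letter (P, Q) i" if i: "i \<in> {1..n}" for i
  proof -
    have "vwt (w i) \<le> (\<Sum>i\<in>{1..n}. vwt (w i))" by (rule member_le_sum[OF i]) auto
    then have "vwt (w i) = 0 \<or> vwt (w i) = Suc 0 \<or> vwt (w i) = 2" using sum by linarith
    moreover obtain s d where "w i = Var i s d" using w i by blast
    ultimately show ?thesis
      using i vwt_eq_iff[of "w i"] by (auto simp: letter_def P_def Q_def)
  qed
  then have "image_mset w (mset_set {1..n}) = pattern_mset n (P, Q)"
    unfolding pattern_mset_def by (intro image_mset_cong) simp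
  ultimately show ?thesis by blast
qed

lemma mset_map_upt: "mset (map f [1..<n + 1]) = image_mset f (mset_set {1..n})"
  by (simp add: mset_upt atLeastLessThanSuc_atLeastAtMost del: upt_Suc)

text \<open>The permutation in a word of \<open>P_sharp\<close> affects only the order of the
  letters, so modulo identities a word depends only on the type chosen for each index. The
  functionals are the coefficient sums of the patterns, dual to the words with increasing
  indices.\<close>

lemma codim_eq:
  fixes A :: "('f::field_char_0, 'a, 'g) gs_algebra"
  assumes A: "Id_sharp G A = ids"
  shows "codim G A n = 1 + 2 * n + (n choose 2)"
proof -
  define W where "W u \<longleftrightarrow> (\<exists>\<sigma> w. u = map (\<lambda>k. w (\<sigma> k)) [1..<n + 1] \<and> \<sigma> permutes {1..n} \<and>
    (\<forall>i\<in>{1..n}. \<exists>s\<in>carrier G. \<exists>d. w i = Var i s d))" for u :: "'g var list"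
  let ?V = "P_sharp G n :: ('g, 'f) ncpoly set"
  have "{Poly_Mapping.single (map (\<lambda>k. w (\<sigma> k)) [1..<n + 1]) 1 | \<sigma> w.
     \<sigma> permutes {1..n} \<and> (\<forall>i\<in>{1..n}. \<exists>s\<in>carrier G. \<exists>e. w i = Var i s e)} =
     {Poly_Mapping.single u (1 :: 'f) | u. W u}"
    unfolding W_def by blast
  then have V: "?V = {p. \<forall>u\<in>Poly_Mapping.keys p. W u}"
    unfolding P_sharp_def by (simp only: span_singles)
  have W: "\<exists>w. (\<forall>i\<in>{1..n}. \<exists>s\<in>carrier G. \<exists>d. w i = Var i s d) \<and> mset u = image_mset w (mset_set {1..n})"
    if Wu: "W u" for u
  proof -
    obtain \<sigma> w where u: "u = map (\<lambda>k. w (\<sigma> k)) [1..<n + 1]" "\<sigma> permutes {1..n}"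
      "\<forall>i\<in>{1..n}. \<exists>s\<in>carrier G. \<exists>d. w i = Var i s d"
      using Wu unfolding W_def by blast
    have "mset u = image_mset w (image_mset \<sigma> (mset_set {1..n}))"
      unfolding u(1) mset_map_upt by (simp add: multiset.map_comp comp_def)
    also have "image_mset \<sigma> (mset_set {1..n}) = mset_set {1..n}"
      using permutes_image[OF u(2)] image_mset_mset_set[OF permutes_inj_on[OF u(2)]] by metis
    finally show ?thesis using u(3) by blast
  qed
  interpret dual_functionals ?V "?V \<inter> ids" "patterns n" "\<lambda>j. msum (pattern_mset n j)"
    "\<lambda>j. Poly_Mapping.single (map (letter j) [1..<n + 1]) 1"
  proof
    show "pm.subspace ?V" unfolding V by (rule subspace_keys)
    show "finite (patterns n)"
      by (rule finite_subset[of _ "Pow {1..n} \<times> Pow {1..n}"]) (auto simp: patterns_def)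
    show "msum (pattern_mset n j) (p + q) = msum (pattern_mset n j) p + msum (pattern_mset n j) q"
      for j and p q :: "('g, 'f) ncpoly"
      by (rule additive.add[OF additive_msum])
    show "Poly_Mapping.single (map (letter j) [1..<n + 1]) 1 \<in> ?V" for j
    proof -
      have "W (map (letter j) [1..<n + 1])"
        unfolding W_def by (rule exI[of _ id], rule exI[of _ "letter j"])
          (use g_closed in \<open>auto simp: permutes_id letter_def\<close>)
      then show ?thesis by (simp add: V)
    qed
    show "msum (pattern_mset n i) (Poly_Mapping.single (map (letter j) [1..<n + 1]) (1 :: 'f)) =
        (if i = j then 1 else 0)" if "i \<in> patterns n" "j \<in> patterns n" for i j
      using pattern_mset_inject[OF that] unfolding msum_single mset_map_upt pattern_mset_def by auto
    fix p :: "('g, 'f) ncpoly" assume p: "p \<in> ?V"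
    then have keys: "W u" if "u \<in> Poly_Mapping.keys p" for u using that by (simp add: V)
    have "set u \<subseteq> vars G" if u: "u \<in> Poly_Mapping.keys p" for u
    proof -
      obtain w where w: "\<forall>i\<in>{1..n}. \<exists>s\<in>carrier G. \<exists>d. w i = Var i s d" "mset u = image_mset w (mset_set {1..n})"
        using W[OF keys[OF u]] by blast
      have "set u = w ` {1..n}" using arg_cong[OF w(2), of set_mset] by simp
      then show ?thesis using w(1) by (auto simp: vars_def)
    qed
    then have carr: "p \<in> carrier (free_gs_algebra G)" by simp
    have "msum M p = 0" if M: "mwt M \<le> 2" "M \<notin> pattern_mset n ` patterns n" for M
    proof -
      have "mset u \<noteq> M" if u: "u \<in> Poly_Mapping.keys p" for u
      proof
        assume uM: "mset u = M"
        obtain w where w: "\<forall>i\<in>{1..n}. \<exists>s\<in>carrier G. \<exists>d. w i = Var i s d" "M = image_mset w (mset_set {1..n})"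
          using W[OF keys[OF u]] unfolding uM by (elim exE conjE)
        show False using pattern_exhaust[OF w(1)] M w(2) by (metis imageI)
      qed
      then have "{u \<in> Poly_Mapping.keys p. mset u = M} = {}" by blast
      then show ?thesis by (simp only: msum_eq sum.empty)
    qed
    then have "p \<in> ids \<longleftrightarrow> (\<forall>j\<in>patterns n. msum (pattern_mset n j) p = 0)"
      unfolding ids_iff using carr mwt_pattern by blast
    then show "p \<in> ?V \<inter> ids \<longleftrightarrow> (\<forall>j\<in>patterns n. msum (pattern_mset n j) p = 0)" using p by blast
  qed (simp add: msum_scale)
  show ?thesis unfolding codim_def A quot_dim_eq by (rule card_patterns)
qed

end

theorem lemma4p7:
  fixes G :: "('g, 'm) monoid_scheme" (structure) and g :: 'g
    and A B :: "('f::field_char_0, 'f mat, 'g) gs_algebra"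
  assumes "comm_group G" and "finite (carrier G)"
    and "g \<in> carrier G" and "group.ord G g > 2"
    and A: "A = C3 G g" and B: "B = C3_star G g"
  shows
    "Id_sharp G A = T_ideal G hull
       ({X 1 h Skew | h. h \<in> {\<one>, g, g \<otimes> g}} \<union>
        {X 1 g Sym * X 2 g Sym * X 3 g Sym,
         X 1 g Sym * X 2 (g \<otimes> g) Sym,
         X 1 (g \<otimes> g) Sym * X 2 (g \<otimes> g) Sym} \<union>
        {X 1 r e | r e. r \<in> carrier G - {\<one>, g, g \<otimes> g}})
     \<and>
     Id_sharp G B = T_ideal G hull
       ({X 1 \<one> Skew, X 1 (g \<otimes> g) Skew, X 1 g Sym} \<union>
        {commutator (X 1 h e) (X 2 r e') | h r e e'.
           h \<in> {\<one>, g, g \<otimes> g} \<and> r \<in> carrier G - {\<one>, g, g \<otimes> g}} \<union>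
        {X 1 (g \<otimes> g) Sym * X 2 (g \<otimes> g) Sym,
         X 1 g Skew * X 2 (g \<otimes> g) Sym} \<union>
        {X 1 r e | r e. r \<in> carrier G - {\<one>, g, g \<otimes> g}})
     \<and>
     (\<forall>n\<ge>2.
        nonzero_cocharacters G A n =
          {outer_char G (no_parts((\<one>, Sym) := [n])),
           outer_char G (no_parts((\<one>, Sym) := [n - 1], (g, Sym) := [1])),
           outer_char G (no_parts((\<one>, Sym) := [n - 2], (g, Sym) := [2])),
           outer_char G (no_parts((\<one>, Sym) := [n - 1], (g \<otimes> g, Sym) := [1]))}
        \<and>
        nonzero_cocharacters G B n =
          {outer_char G (no_parts((\<one>, Sym) := [n])),
           outer_char G (no_parts((\<one>, Sym) := [n - 1], (g, Skew) := [1])),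
           outer_char G (no_parts((\<one>, Sym) := [n - 2], (g, Skew) := [2])),
           outer_char G (no_parts((\<one>, Sym) := [n - 1], (g \<otimes> g, Sym) := [1]))}
        \<and>
        codim G A n = 1 + 2 * n + (n choose 2) \<and> codim G B n = 1 + 2 * n + (n choose 2)
        \<and>
        colength G A n = 4 \<and> colength G B n = 4)"
proof -
  interpret comm_group G by fact
  interpret SA: c3_grading G g Sym
    by unfold_locales (fact assms)+
  interpret SB: c3_grading G g Skew
    by unfold_locales (fact assms)+
  \<comment> \<open>For \<open>e = Sym\<close> the factor \<open>eps\<close> is 1 and
    \<open>twist\<close> is the identity; for \<open>e = Skew\<close>, below, it changes the sign of
    t.\<close>
  have IdA: "Id_sharp G A = SA.ids"
    unfolding A C3_def
    by (rule SA.Id_sharp_C3) (simp add: trunc_mat_def twist_def SA.eps_def)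
  have IdB: "Id_sharp G B = SB.ids"
    unfolding B C3_star_def
    by (rule SB.Id_sharp_C3) (simp add: trunc_mat_def twist_def SB.eps_def)
  have distinct: "g \<noteq> \<one>" "g \<otimes> g \<noteq> \<one>" "g \<otimes> g \<noteq> g" "\<one> \<noteq> g" "\<one> \<noteq> g \<otimes> g" "g \<noteq> g \<otimes> g"
    by (rule SA.degrees_distinct)+
  have closed: "X (Suc i) s d \<in> carrier (free_gs_algebra G)" if "s \<in> carrier G" for i s d
    using that by (simp add: SA.X_closed del: free_gs_algebra_simps)
  have "Id_sharp G A = T_ideal G hull
       ({X 1 h Skew | h. h \<in> {\<one>, g, g \<otimes> g}} \<union>
        {X 1 g Sym * X 2 g Sym * X 3 g Sym,
         X 1 g Sym * X 2 (g \<otimes> g) Sym,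
         X 1 (g \<otimes> g) Sym * X 2 (g \<otimes> g) Sym} \<union>
        {X 1 r e | r e. r \<in> carrier G - {\<one>, g, g \<otimes> g}})" (is "_ = T_ideal G hull ?S")
    unfolding IdA
  proof (rule SA.ids_eq_hull)
    have "p \<in> carrier (free_gs_algebra G)" if "p \<in> ?S" for p
      using that assms(3) closed[of _ 0] closed[of _ 1] closed[of _ 2]
      by (auto intro!: free_carrier_mult simp: numeral_2_eq_2 numeral_3_eq_3 simp del: free_gs_algebra_simps)
    moreover have "SA.tev a p = 0" if "p \<in> ?S" for a and p :: "('g, 'f) ncpoly"
      using that distinct
      by (auto simp: SA.tev_mult SA.tev_X tmon_mult tmon_eq_0_iff SA.wt_def)
    ultimately show "?S \<subseteq> SA.ids" unfolding SA.ids_def by blast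
    \<comment> \<open>Inside the support weight 3 means skew; outside it every variable is
      listed.\<close>
    show "X 1 s d \<in> ?S" if "s \<in> carrier G" "SA.wt s d > 2" for s d
    proof (cases "s \<in> {\<one>, g, g \<otimes> g}")
      case True
      then have "d = Skew" using that(2) by (cases d) (auto simp: SA.wt_def split: if_splits)
      then show ?thesis using True by blast
    qed (use that in blast)
  qed simp_all
  moreover have "Id_sharp G B = T_ideal G hull
       ({X 1 \<one> Skew, X 1 (g \<otimes> g) Skew, X 1 g Sym} \<union>
        {commutator (X 1 h e) (X 2 r e') | h r e e'.
           h \<in> {\<one>, g, g \<otimes> g} \<and> r \<in> carrier G - {\<one>, g, g \<otimes> g}} \<union>
        {X 1 (g \<otimes> g) Sym * X 2 (g \<otimes> g) Sym,
         X 1 g Skew * X 2 (g \<otimes> g) Sym} \<union>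
        {X 1 r e | r e. r \<in> carrier G - {\<one>, g, g \<otimes> g}})" (is "_ = T_ideal G hull ?S")
    unfolding IdB
  proof (rule SB.ids_eq_hull)
    have diff: "p - q \<in> carrier (free_gs_algebra G)"
      if "p \<in> carrier (free_gs_algebra G)" "q \<in> carrier (free_gs_algebra G)" for p q :: "('g, 'f) ncpoly"
      using free_carrier_add[OF that(1), of "- q"] that(2) by (simp add: keys_uminus)
    have carr: "p \<in> carrier (free_gs_algebra G)" if "p \<in> ?S" for p
      using that assms(3) closed[of _ 0] closed[of _ 1]
      by (auto intro!: free_carrier_mult diff simp: commutator_def numeral_2_eq_2 simp del: free_gs_algebra_simps)
    \<comment> \<open>Commutators vanish because the values lie in a commutative ring.\<close>
    have tev: "SB.tev a p = 0" if "p \<in> ?S" for a and p :: "('g, 'f) ncpoly"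
      using that distinct
      by (auto simp: commutator_def additive.diff[OF SB.additive_tev] SB.tev_mult SB.tev_X tmon_mult
          tmon_eq_0_iff SB.wt_def mult.commute)
    show "?S \<subseteq> SB.ids"
    proof (rule Set.subsetI)
      fix p assume "p \<in> ?S"
      from carr[OF this] tev[OF this] show "p \<in> SB.ids"
        unfolding SB.ids_def mem_Collect_eq by (intro conjI allI)
    qed
    \<comment> \<open>Here the vanishing variable of degree \<open>g\<close> is the symmetric
      one.\<close>
    show "X 1 s d \<in> ?S" if "s \<in> carrier G" "SB.wt s d > 2" for s d
    proof (cases "s \<in> {\<one>, g, g \<otimes> g}")
      case True
      have "SB.wt s d \<noteq> 0" "SB.wt s d \<noteq> Suc 0" "SB.wt s d \<noteq> 2" using that(2) by linarith+
      then have "s = \<one> \<and> d = Skew \<or> s = g \<and> d = Sym \<or> s = g \<otimes> g \<and> d = Skew"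
        unfolding SB.wt_eq_iff using True symmetry.exhaust[of d] by blast
      then show ?thesis by (elim disjE conjE) simp_all
    qed (use that in blast)
  qed simp_all
  ultimately show ?thesis
    by (intro conjI allI impI SA.codim_eq[OF IdA] SB.codim_eq[OF IdB]
        SA.colength_eq[OF assms(2) IdA] SB.colength_eq[OF assms(2) IdB]
        SA.nonzero_cocharacters_eq[OF assms(2) IdA, unfolded SA.shapes_def image_insert image_empty]
        SB.nonzero_cocharacters_eq[OF assms(2) IdB, unfolded SB.shapes_def image_insert image_empty])
qed

end
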